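(* Let $M=M_T\times_fM_\theta$ be a proper warped product semi-slant submanifold of a Kenmotsu manifold $(\tilde M,\varphi,\xi,\eta,g)$ such that the structure vector field $\xi$ is tangent to $M_T$, where $M_T$ is an invariant submanifold and $M_\theta$ is a proper slant submanifold of $\tilde M$ with slant angle $\theta$. Then: (i) The squared norm of the second fundamental form $h$ of $M$ satisfies $$\|h\|^2\ \geq\ 4s\left(\csc^2\theta+\cot^2\theta\right)\left(\|\nabla^T(\ln f)\|^2-1\right),$$ where $\nabla^T(\ln f)$ is the gradient of $\ln f$ along $M_T$ and $2s=\dim M_\theta$. (ii) If the equality sign in (i) holds, then $M_T$ is a totally geodesic submanifold of $\tilde M$ and $M_\theta$ is a totally umbilical submanifold of $\tilde M$. Furthermore, $M$ is minimal in $\tilde M$.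
   Context: An almost contact metric manifold $(\tilde M,\varphi,\xi,\eta,g)$ is a manifold with a $(1,1)$-tensor field $\varphi$, a vector field $\xi$, a $1$-form $\eta$ and a Riemannian metric $g$ such that $\varphi^2=-I+\eta\otimes\xi$, $\varphi\xi=0$, $\eta\circ\varphi=0$, $\eta(\xi)=1$ and $g(\varphi X,\varphi Y)=g(X,Y)-\eta(X)\eta(Y)$. It is a Kenmotsu manifold if moreover $(\tilde\nabla_X\varphi)Y=g(\varphi X,Y)\xi-\eta(Y)\varphi X$ for all $X,Y$, where $\tilde\nabla$ is the Levi-Civita connection of $g$. For a submanifold $M$ of $\tilde M$ with induced metric and Levi-Civita connection $\nabla$, the second fundamental form $h$ is given by $\tilde\nabla_XY=\nabla_XY+h(X,Y)$, and $\|h\|^2=\sum_{i,j}g(h(e_i,e_j),h(e_i,e_j))$ for a local orthonormal frame $\{e_i\}$ of $TM$. For $X$ tangent to $M$, $\varphi X=PX+FX$ with $PX$ tangent and $FX$ normal. A submanifold is invariant if $\varphi$ maps its tangent spaces into themselves. A submanifold is slant with slant angle $\theta$ if for every nonzero tangent vector $X$ (not proportional to $\xi$) the angle between $\varphi X$ and the tangent space is the constant $\theta$; it is proper slant if $\theta\neq 0,\pi/2$. A warped product $M_1\times_fM_2$ of Riemannian manifolds $(M_1,g_1)$, $(M_2,g_2)$ with $f$ a positive smooth function on $M_1$ is $M_1\times M_2$ with the metric $g=\pi_1^*g_1+(f\circ\pi_1)^2\pi_2^*g_2$. A warped product semi-slant submanifold is a submanifold $M=M_T\times_fM_\theta$ of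 $\tilde M$ (isometrically immersed) with $M_T$ invariant and tangent to $\xi$ and $M_\theta$ proper slant; its tangent bundle splits as $TM=\mathcal{D}\oplus\langle\xi\rangle\oplus\mathcal{D}^\theta$ with $TM_T=\mathcal{D}\oplus\langle\xi\rangle$, $TM_\theta=\mathcal{D}^\theta$. It is called proper if neither $\dim M_T$ is zero nor the slant angle of $M_\theta$ is $\pi/2$. *)

theory Defs
  imports "HOL-Analysis.Analysis"
begin

text \<open>For an open set \<open>U\<close> of a finite-dimensional space, \<open>Ck_on k U f\<close> says that \<open>f\<close> is of class
  \<open>C\<^sup>k\<close> on \<open>U\<close>: all iterated directional derivatives up to order \<open>k\<close> exist and are continuous.\<close>

primrec Ck_on :: "nat \<Rightarrow> 'e::euclidean_space set \<Rightarrow> ('e \<Rightarrow> 'h::real_normed_vector) \<Rightarrow> bool" where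
  "Ck_on 0 U f \<longleftrightarrow> continuous_on U f"
| "Ck_on (Suc k) U f \<longleftrightarrow>
     (\<forall>x\<in>U. f differentiable (at x)) \<and>
     (\<forall>v. Ck_on k U (\<lambda>x. frechet_derivative f (at x) v))"

definition smooth_on :: "'e::euclidean_space set \<Rightarrow> ('e \<Rightarrow> 'h::real_normed_vector) \<Rightarrow> bool" where
  "smooth_on U f \<longleftrightarrow> (\<forall>k. Ck_on k U f)"

text \<open>A manifold modelled on the Euclidean space \<open>'e\<close> (so its dimension is \<open>DIM('e)\<close>) consists of a
  topology (whose carrier \<open>topspace\<close> may be any set), a smooth atlas, and a choice of a chart of
  the atlas around each point.\<close>

record ('a, 'e) chart =
  chart_dom :: "'a set"
  chart_map :: "'a \<Rightarrow> 'e"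

record ('a, 'e) mfd =
  mfd_top :: "'a topology"
  atlas :: "('a, 'e) chart set"
  chart_at :: "'a \<Rightarrow> ('a, 'e) chart"

abbreviation carrier :: "('a, 'e) mfd \<Rightarrow> 'a set" where
  "carrier M \<equiv> topspace (mfd_top M)"

definition chart_inv :: "('a, 'e) chart \<Rightarrow> 'e \<Rightarrow> 'a" where
  "chart_inv c = inv_into (chart_dom c) (chart_map c)"

definition smooth_manifold :: "('a, 'e::euclidean_space) mfd \<Rightarrow> bool" where
  "smooth_manifold M \<longleftrightarrow>
     Hausdorff_space (mfd_top M) \<and> second_countable (mfd_top M) \<and>
     (\<forall>c\<in>atlas M. openin (mfd_top M) (chart_dom c) \<and> open (chart_map c ` chart_dom c) \<and>
        homeomorphic_map (subtopology (mfd_top M) (chart_dom c))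
          (top_of_set (chart_map c ` chart_dom c)) (chart_map c)) \<and>
     (\<forall>c\<in>atlas M. \<forall>d\<in>atlas M.
        smooth_on (chart_map c ` (chart_dom c \<inter> chart_dom d)) (chart_map d \<circ> chart_inv c)) \<and>
     (\<forall>p\<in>carrier M. chart_at M p \<in> atlas M \<and> p \<in> chart_dom (chart_at M p))"

definition prod_chart ::
  "('a, 'e) chart \<Rightarrow> ('b, 'f) chart \<Rightarrow> ('a \<times> 'b, 'e \<times> 'f) chart" where
  "prod_chart c d = \<lparr>chart_dom = chart_dom c \<times> chart_dom d,
                     chart_map = map_prod (chart_map c) (chart_map d)\<rparr>"

definition prod_mfd :: "('a, 'e) mfd \<Rightarrow> ('b, 'f) mfd \<Rightarrow> ('a \<times> 'b, 'e \<times> 'f) mfd" where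
  "prod_mfd M N = \<lparr>mfd_top = prod_topology (mfd_top M) (mfd_top N),
                   atlas = {prod_chart c d | c d. c \<in> atlas M \<and> d \<in> atlas N},
                   chart_at = (\<lambda>(p, q). prod_chart (chart_at M p) (chart_at N q))\<rparr>"

text \<open>The tangent space at \<open>p\<close> is identified with the model space \<open>'e\<close> by means of the chosen chart
  \<open>chart_at M p\<close>. The coordinate change \<open>to_chart M c p\<close> gives the components, in an arbitrary
  chart \<open>c\<close> around \<open>p\<close>, of a tangent vector at \<open>p\<close>; \<open>from_chart M c p\<close> goes the other way.\<close>

definition to_chart :: "('a, 'e::euclidean_space) mfd \<Rightarrow> ('a, 'e) chart \<Rightarrow> 'a \<Rightarrow> 'e \<Rightarrow> 'e" where
  "to_chart M c p =
     frechet_derivative (chart_map c \<circ> chart_inv (chart_at M p)) (at (chart_map (chart_at M p) p))"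

definition from_chart :: "('a, 'e::euclidean_space) mfd \<Rightarrow> ('a, 'e) chart \<Rightarrow> 'a \<Rightarrow> 'e \<Rightarrow> 'e" where
  "from_chart M c p =
     frechet_derivative (chart_map (chart_at M p) \<circ> chart_inv c) (at (chart_map c p))"

definition smooth_map ::
  "('a, 'e::euclidean_space) mfd \<Rightarrow> ('b, 'f::euclidean_space) mfd \<Rightarrow> ('a \<Rightarrow> 'b) \<Rightarrow> bool" where
  "smooth_map N M F \<longleftrightarrow>
     continuous_map (mfd_top N) (mfd_top M) F \<and>
     (\<forall>c\<in>atlas N. \<forall>d\<in>atlas M.
        smooth_on (chart_map c ` (chart_dom c \<inter> F -` chart_dom d))
          (chart_map d \<circ> F \<circ> chart_inv c))"

definition mdiff ::
  "('a, 'e::euclidean_space) mfd \<Rightarrow> ('b, 'f::euclidean_space) mfd \<Rightarrow> ('a \<Rightarrow> 'b) \<Rightarrow> 'a \<Rightarrow> 'e \<Rightarrow> 'f" where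
  "mdiff N M F p =
     frechet_derivative (chart_map (chart_at M (F p)) \<circ> F \<circ> chart_inv (chart_at N p))
       (at (chart_map (chart_at N p) p))"

definition immersion ::
  "('a, 'e::euclidean_space) mfd \<Rightarrow> ('b, 'f::euclidean_space) mfd \<Rightarrow> ('a \<Rightarrow> 'b) \<Rightarrow> bool" where
  "immersion N M F \<longleftrightarrow> smooth_map N M F \<and> (\<forall>p\<in>carrier N. inj (mdiff N M F p))"

definition smooth_function :: "('a, 'e::euclidean_space) mfd \<Rightarrow> ('a \<Rightarrow> real) \<Rightarrow> bool" where
  "smooth_function M f \<longleftrightarrow>
     (\<forall>c\<in>atlas M. smooth_on (chart_map c ` chart_dom c) (f \<circ> chart_inv c))"

definition fun_diff :: "('a, 'e::euclidean_space) mfd \<Rightarrow> ('a \<Rightarrow> real) \<Rightarrow> 'a \<Rightarrow> 'e \<Rightarrow> real" where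
  "fun_diff M f p =
     frechet_derivative (f \<circ> chart_inv (chart_at M p)) (at (chart_map (chart_at M p) p))"

definition smooth_vector_field_on ::
  "('a, 'e::euclidean_space) mfd \<Rightarrow> 'a set \<Rightarrow> ('a \<Rightarrow> 'e) \<Rightarrow> bool" where
  "smooth_vector_field_on M U X \<longleftrightarrow>
     (\<forall>c\<in>atlas M. smooth_on (chart_map c ` (chart_dom c \<inter> U))
        (\<lambda>x. to_chart M c (chart_inv c x) (X (chart_inv c x))))"

definition smooth_one_form :: "('a, 'e::euclidean_space) mfd \<Rightarrow> ('a \<Rightarrow> 'e \<Rightarrow> real) \<Rightarrow> bool" where
  "smooth_one_form M \<eta> \<longleftrightarrow>
     (\<forall>p\<in>carrier M. linear (\<eta> p)) \<and>
     (\<forall>c\<in>atlas M. \<forall>v. smooth_on (chart_map c ` chart_dom c)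
        (\<lambda>x. \<eta> (chart_inv c x) (from_chart M c (chart_inv c x) v)))"

definition smooth_endomorphism :: "('a, 'e::euclidean_space) mfd \<Rightarrow> ('a \<Rightarrow> 'e \<Rightarrow> 'e) \<Rightarrow> bool" where
  "smooth_endomorphism M \<phi> \<longleftrightarrow>
     (\<forall>p\<in>carrier M. linear (\<phi> p)) \<and>
     (\<forall>c\<in>atlas M. \<forall>v. smooth_on (chart_map c ` chart_dom c)
        (\<lambda>x. to_chart M c (chart_inv c x)
               (\<phi> (chart_inv c x) (from_chart M c (chart_inv c x) v))))"

type_synonym ('a, 'e) metric = "'a \<Rightarrow> 'e \<Rightarrow> 'e \<Rightarrow> real"

definition pos_def_form :: "('e::euclidean_space \<Rightarrow> 'e \<Rightarrow> real) \<Rightarrow> bool" where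
  "pos_def_form G \<longleftrightarrow>
     bilinear G \<and> (\<forall>u v. G u v = G v u) \<and> (\<forall>u. u \<noteq> 0 \<longrightarrow> G u u > 0)"

definition chart_metric ::
  "('a, 'e::euclidean_space) mfd \<Rightarrow> ('a, 'e) metric \<Rightarrow> ('a, 'e) chart \<Rightarrow> 'e \<Rightarrow> 'e \<Rightarrow> 'e \<Rightarrow> real" where
  "chart_metric M g c x u v =
     g (chart_inv c x) (from_chart M c (chart_inv c x) u) (from_chart M c (chart_inv c x) v)"

definition riemannian_metric :: "('a, 'e::euclidean_space) mfd \<Rightarrow> ('a, 'e) metric \<Rightarrow> bool" where
  "riemannian_metric M g \<longleftrightarrow>
     (\<forall>p\<in>carrier M. pos_def_form (g p)) \<and>
     (\<forall>c\<in>atlas M. \<forall>u v. smooth_on (chart_map c ` chart_dom c) (\<lambda>x. chart_metric M g c x u v))"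

definition pullback_metric ::
  "('a, 'e::euclidean_space) mfd \<Rightarrow> ('b, 'f::euclidean_space) mfd \<Rightarrow> ('a \<Rightarrow> 'b) \<Rightarrow>
     ('b, 'f) metric \<Rightarrow> ('a, 'e) metric" where
  "pullback_metric N M F g p u v = g (F p) (mdiff N M F p u) (mdiff N M F p v)"

definition warped_metric ::
  "('a, 'e::euclidean_space) mfd \<Rightarrow> ('a, 'e) metric \<Rightarrow> ('a \<Rightarrow> real) \<Rightarrow>
     ('b, 'f::euclidean_space) mfd \<Rightarrow> ('b, 'f) metric \<Rightarrow> ('a \<times> 'b, 'e \<times> 'f) metric" where
  "warped_metric M1 g1 f M2 g2 = (\<lambda>x u v.
     pullback_metric (prod_mfd M1 M2) M1 fst g1 x u v +
     (f (fst x))\<^sup>2 * pullback_metric (prod_mfd M1 M2) M2 snd g2 x u v)"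

definition gnorm :: "('e \<Rightarrow> 'e \<Rightarrow> real) \<Rightarrow> 'e \<Rightarrow> real" where
  "gnorm G v = sqrt (G v v)"

definition gradient ::
  "('a, 'e::euclidean_space) mfd \<Rightarrow> ('a, 'e) metric \<Rightarrow> ('a \<Rightarrow> real) \<Rightarrow> 'a \<Rightarrow> 'e" where
  "gradient M g f p = (THE w. \<forall>u. g p w u = fun_diff M f p u)"

text \<open>At \<open>p\<close>, in the chart \<open>chart_at M p\<close>, a connection is given by a bilinear map \<open>\<Gamma>\<close> (its Christoffel
  symbols) via \<open>\<nabla>\<^sub>u Y = D\<^sub>u Y + \<Gamma> u Y\<close>. It is torsion-free iff \<open>\<Gamma>\<close> is symmetric, and metric iff
  \<open>D\<^sub>u (g v w) = g (\<Gamma> u v) w + g v (\<Gamma> u w)\<close> for constant \<open>v\<close>, \<open>w\<close>. The Levi-Civita connection is the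
  unique connection with both properties; existence and uniqueness of \<open>\<Gamma>\<close> follow
  from \<open>ex1_metric_symmetric\<close> below, with \<open>A u v w = D\<^sub>u (g v w)\<close>.\<close>

definition christoffel ::
  "('a, 'e::euclidean_space) mfd \<Rightarrow> ('a, 'e) metric \<Rightarrow> 'a \<Rightarrow> 'e \<Rightarrow> 'e \<Rightarrow> 'e" where
  "christoffel M g p =
     (let c = chart_at M p; x = chart_map c p; gc = chart_metric M g c in
      THE \<Gamma>. bilinear \<Gamma> \<and> (\<forall>u v. \<Gamma> u v = \<Gamma> v u) \<and>
        (\<forall>u v w. frechet_derivative (\<lambda>y. gc y v w) (at x) u = gc x (\<Gamma> u v) w + gc x v (\<Gamma> u w)))"

lemma form_representation:
  fixes G :: "'e::euclidean_space \<Rightarrow> 'e \<Rightarrow> real"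
  assumes G: "pos_def_form G" and L: "linear L"
  shows "\<exists>z. \<forall>w. G z w = L w"
proof -
  have bil: "bilinear G" and pos: "\<And>u. u \<noteq> 0 \<Longrightarrow> G u u > 0"
    using G by (auto simp: pos_def_form_def)
  have linr: "linear (G z)" and linl: "linear (\<lambda>z. G z w)" for z w
    using bil by (auto simp: bilinear_def)
  define T where "T z = (\<Sum>b\<in>Basis. G z b *\<^sub>R b)" for z
  have T: "T z \<bullet> w = G z w" for z w
  proof -
    have "G z w = G z (\<Sum>b\<in>Basis. (w \<bullet> b) *\<^sub>R b)"
      by (simp add: euclidean_representation)
    also have "\<dots> = (\<Sum>b\<in>Basis. (w \<bullet> b) * G z b)"
      by (simp add: linear_sum[OF linr] linear_scale[OF linr])
    also have "\<dots> = T z \<bullet> w"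
      by (simp add: T_def inner_sum_right inner_commute[of _ w] mult.commute)
    finally show ?thesis by simp
  qed
  have linT: "linear T"
    unfolding T_def
    by (rule linearI) (simp_all add: linear_add[OF linl] linear_scale[OF linl]
        scaleR_left_distrib sum.distrib scaleR_sum_right)
  have "inj T"
    unfolding linear_injective_0[OF linT]
  proof (intro allI impI)
    fix z assume "T z = 0"
    then have "G z z = 0" using T[of z z] by simp
    then show "z = 0" using pos[of z] by force
  qed
  then have "surj T" using linT linear_injective_imp_surjective by blast
  then obtain z where z: "T z = (\<Sum>b\<in>Basis. L b *\<^sub>R b)" by (metis surjD)
  have "G z w = L w" for w
  proof -
    have "L w = L (\<Sum>b\<in>Basis. (w \<bullet> b) *\<^sub>R b)"
      by (simp add: euclidean_representation)
    also have "\<dots> = (\<Sum>b\<in>Basis. (w \<bullet> b) * L b)"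
      by (simp add: linear_sum[OF L] linear_scale[OF L])
    also have "\<dots> = T z \<bullet> w"
      by (simp add: z inner_sum_right inner_commute[of _ w] mult.commute)
    finally show ?thesis using T by simp
  qed
  then show ?thesis by blast
qed

lemma ex1_metric_symmetric:
  fixes G :: "'e::euclidean_space \<Rightarrow> 'e \<Rightarrow> real" and A :: "'e \<Rightarrow> 'e \<Rightarrow> 'e \<Rightarrow> real"
  assumes G: "pos_def_form G"
    and A1: "\<And>v w. linear (\<lambda>u. A u v w)"
    and A2: "\<And>u w. linear (\<lambda>v. A u v w)"
    and A3: "\<And>u v. linear (\<lambda>w. A u v w)"
    and sym: "\<And>u v w. A u v w = A u w v"
  shows "\<exists>!\<Gamma>. bilinear \<Gamma> \<and> (\<forall>u v. \<Gamma> u v = \<Gamma> v u) \<and>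
           (\<forall>u v w. A u v w = G (\<Gamma> u v) w + G v (\<Gamma> u w))"
proof -
  have Gsym: "G u v = G v u" and bil: "bilinear G" and pos: "u \<noteq> 0 \<Longrightarrow> G u u > 0" for u v
    using G by (auto simp: pos_def_form_def)
  have eqI: "y = z" if "\<And>w. G y w = G z w" for y z
  proof (rule ccontr)
    assume "y \<noteq> z"
    then have "G (y - z) (y - z) > 0" using pos by simp
    then show False using that[of "y - z"] bil by (simp add: bilinear_lsub)
  qed
  define K where "K u v w = (A u v w + A v u w - A w u v) / 2" for u v w
  have K: "linear (K u v)" for u v
    unfolding K_def
    by (rule linearI) (simp_all add: linear_add[OF A1] linear_add[OF A3] linear_scale[OF A1]
        linear_scale[OF A3] field_simps)
  define \<Gamma> where "\<Gamma> u v = (SOME z. \<forall>w. G z w = K u v w)" for u v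
  have \<Gamma>: "G (\<Gamma> u v) w = K u v w" for u v w
    using someI_ex[OF form_representation[OF G K[of u v]]] unfolding \<Gamma>_def by blast
  have "bilinear \<Gamma>"
    unfolding bilinear_def
    by (intro conjI allI linearI; rule eqI)
       (simp_all add: \<Gamma> bilinear_ladd[OF bil] bilinear_lmul[OF bil] K_def
          linear_add[OF A1] linear_add[OF A2] linear_add[OF A3]
          linear_scale[OF A1] linear_scale[OF A2] linear_scale[OF A3] field_simps)
  moreover have "\<Gamma> u v = \<Gamma> v u" for u v
    by (rule eqI) (simp add: \<Gamma> K_def sym[of _ u v])
  moreover have "A u v w = G (\<Gamma> u v) w + G v (\<Gamma> u w)" for u v w
    unfolding Gsym[of v "\<Gamma> u w"] \<Gamma> K_def
    using sym[of u v w] sym[of v u w] sym[of w u v] by (simp add: field_simps)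
  moreover have "\<Delta> = \<Gamma>"
    if "\<And>u v. \<Delta> u v = \<Delta> v u" and "\<And>u v w. A u v w = G (\<Delta> u v) w + G v (\<Delta> u w)" for \<Delta>
  proof (intro ext eqI)
    fix u v w
    have "A u v w = G (\<Delta> u v) w + G v (\<Delta> u w)" "A v u w = G (\<Delta> u v) w + G u (\<Delta> v w)"
      "A w u v = G v (\<Delta> u w) + G u (\<Delta> v w)"
      using that Gsym by metis+
    then show "G (\<Delta> u v) w = G (\<Gamma> u v) w" by (simp add: \<Gamma> K_def)
  qed
  ultimately show ?thesis by (intro ex1I[of _ \<Gamma>]) blast+
qed

text \<open>Covariant derivative, at \<open>p\<close> in the direction \<open>u\<close>, of a vector field \<open>V\<close> along a map \<open>F\<close> from \<open>N\<close>
  to \<open>M\<close> (so \<open>V q\<close> is a tangent vector of \<open>M\<close> at \<open>F q\<close>). For vector fields on \<open>M\<close> take \<open>F\<close> to be the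
  identity.\<close>

definition cov_along ::
  "('a, 'e::euclidean_space) mfd \<Rightarrow> ('b, 'f::euclidean_space) mfd \<Rightarrow> ('b, 'f) metric \<Rightarrow>
     ('a \<Rightarrow> 'b) \<Rightarrow> ('a \<Rightarrow> 'f) \<Rightarrow> 'a \<Rightarrow> 'e \<Rightarrow> 'f" where
  "cov_along N M g F V p u =
     (let c = chart_at N p in
      frechet_derivative
        (\<lambda>x. to_chart M (chart_at M (F p)) (F (chart_inv c x)) (V (chart_inv c x)))
        (at (chart_map c p)) u
      + christoffel M g (F p) (mdiff N M F p u) (V p))"

definition cov ::
  "('a, 'e::euclidean_space) mfd \<Rightarrow> ('a, 'e) metric \<Rightarrow> ('a \<Rightarrow> 'e) \<Rightarrow> 'a \<Rightarrow> 'e \<Rightarrow> 'e" where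
  "cov M g Y p u = cov_along M M g (\<lambda>q. q) Y p u"

text \<open>A submanifold of \<open>M\<close> is given by an immersion \<open>F\<close> of a manifold \<open>N\<close>, with the induced metric
  \<open>pullback_metric N M F g\<close>. By the Gauss formula \<open>h(X,Y)\<close> is the difference of the ambient and the
  induced covariant derivative; as \<open>h\<close> is tensorial, its value on the tangent vectors \<open>u\<close>, \<open>v\<close> at \<open>p\<close>
  is obtained by extending \<open>v\<close> to the vector field with constant components in the chart
  around \<open>p\<close>.\<close>

definition coord_field :: "('a, 'e::euclidean_space) mfd \<Rightarrow> 'a \<Rightarrow> 'e \<Rightarrow> 'a \<Rightarrow> 'e" where
  "coord_field M p v q = from_chart M (chart_at M p) q v"

definition sff ::
  "('a, 'e::euclidean_space) mfd \<Rightarrow> ('b, 'f::euclidean_space) mfd \<Rightarrow> ('b, 'f) metric \<Rightarrow>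
     ('a \<Rightarrow> 'b) \<Rightarrow> 'a \<Rightarrow> 'e \<Rightarrow> 'e \<Rightarrow> 'f" where
  "sff N M g F p u v =
     (let Y = coord_field N p v in
      cov_along N M g F (\<lambda>q. mdiff N M F q (Y q)) p u
      - mdiff N M F p (cov N (pullback_metric N M F g) Y p u))"

definition orthonormal_basis :: "('e::euclidean_space \<Rightarrow> 'e \<Rightarrow> real) \<Rightarrow> 'e set \<Rightarrow> bool" where
  "orthonormal_basis G B \<longleftrightarrow>
     finite B \<and> span B = UNIV \<and> (\<forall>u\<in>B. \<forall>v\<in>B. G u v = (if u = v then 1 else 0))"

definition some_frame ::
  "('a, 'e::euclidean_space) mfd \<Rightarrow> ('b, 'f::euclidean_space) mfd \<Rightarrow> ('b, 'f) metric \<Rightarrow>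
     ('a \<Rightarrow> 'b) \<Rightarrow> 'a \<Rightarrow> 'e set" where
  "some_frame N M g F p = (SOME B. orthonormal_basis (pullback_metric N M F g p) B)"

definition sff_sqnorm ::
  "('a, 'e::euclidean_space) mfd \<Rightarrow> ('b, 'f::euclidean_space) mfd \<Rightarrow> ('b, 'f) metric \<Rightarrow>
     ('a \<Rightarrow> 'b) \<Rightarrow> 'a \<Rightarrow> real" where
  "sff_sqnorm N M g F p =
     (\<Sum>u\<in>some_frame N M g F p. \<Sum>v\<in>some_frame N M g F p.
        g (F p) (sff N M g F p u v) (sff N M g F p u v))"

definition mean_curvature ::
  "('a, 'e::euclidean_space) mfd \<Rightarrow> ('b, 'f::euclidean_space) mfd \<Rightarrow> ('b, 'f) metric \<Rightarrow>
     ('a \<Rightarrow> 'b) \<Rightarrow> 'a \<Rightarrow> 'f" where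
  "mean_curvature N M g F p =
     (1 / real DIM('e)) *\<^sub>R (\<Sum>u\<in>some_frame N M g F p. sff N M g F p u u)"

definition totally_geodesic ::
  "('a, 'e::euclidean_space) mfd \<Rightarrow> ('b, 'f::euclidean_space) mfd \<Rightarrow> ('b, 'f) metric \<Rightarrow>
     ('a \<Rightarrow> 'b) \<Rightarrow> bool" where
  "totally_geodesic N M g F \<longleftrightarrow> (\<forall>p\<in>carrier N. \<forall>u v. sff N M g F p u v = 0)"

definition totally_umbilical ::
  "('a, 'e::euclidean_space) mfd \<Rightarrow> ('b, 'f::euclidean_space) mfd \<Rightarrow> ('b, 'f) metric \<Rightarrow>
     ('a \<Rightarrow> 'b) \<Rightarrow> bool" where
  "totally_umbilical N M g F \<longleftrightarrow>
     (\<forall>p\<in>carrier N. \<forall>u v.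
        sff N M g F p u v = pullback_metric N M F g p u v *\<^sub>R mean_curvature N M g F p)"

definition minimal ::
  "('a, 'e::euclidean_space) mfd \<Rightarrow> ('b, 'f::euclidean_space) mfd \<Rightarrow> ('b, 'f) metric \<Rightarrow>
     ('a \<Rightarrow> 'b) \<Rightarrow> bool" where
  "minimal N M g F \<longleftrightarrow> (\<forall>p\<in>carrier N. mean_curvature N M g F p = 0)"

definition almost_contact_metric_manifold ::
  "('m, 'k::euclidean_space) mfd \<Rightarrow> ('m \<Rightarrow> 'k \<Rightarrow> 'k) \<Rightarrow> ('m \<Rightarrow> 'k) \<Rightarrow> ('m \<Rightarrow> 'k \<Rightarrow> real) \<Rightarrow>
     ('m, 'k) metric \<Rightarrow> bool" where
  "almost_contact_metric_manifold M \<phi> \<xi> \<eta> g \<longleftrightarrow>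
     smooth_manifold M \<and> smooth_endomorphism M \<phi> \<and> smooth_vector_field_on M (carrier M) \<xi> \<and>
     smooth_one_form M \<eta> \<and> riemannian_metric M g \<and>
     (\<forall>p\<in>carrier M.
        (\<forall>u. \<phi> p (\<phi> p u) = - u + \<eta> p u *\<^sub>R \<xi> p) \<and>
        \<phi> p (\<xi> p) = 0 \<and> (\<forall>u. \<eta> p (\<phi> p u) = 0) \<and> \<eta> p (\<xi> p) = 1 \<and>
        (\<forall>u v. g p (\<phi> p u) (\<phi> p v) = g p u v - \<eta> p u * \<eta> p v))"

text \<open>The Kenmotsu identity is required for all smooth vector fields on open subsets; \<open>cov\<close> uses
  the Levi-Civita connection of \<open>g\<close>, and the left-hand side is \<open>(\<nabla>\<^sub>X \<phi>) Y\<close>.\<close>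

definition kenmotsu_manifold ::
  "('m, 'k::euclidean_space) mfd \<Rightarrow> ('m \<Rightarrow> 'k \<Rightarrow> 'k) \<Rightarrow> ('m \<Rightarrow> 'k) \<Rightarrow> ('m \<Rightarrow> 'k \<Rightarrow> real) \<Rightarrow>
     ('m, 'k) metric \<Rightarrow> bool" where
  "kenmotsu_manifold M \<phi> \<xi> \<eta> g \<longleftrightarrow>
     almost_contact_metric_manifold M \<phi> \<xi> \<eta> g \<and>
     (\<forall>U X Y. openin (mfd_top M) U \<and> smooth_vector_field_on M U X \<and> smooth_vector_field_on M U Y
        \<longrightarrow> (\<forall>p\<in>U. cov M g (\<lambda>q. \<phi> q (Y q)) p (X p) - \<phi> p (cov M g Y p (X p))
                 = g p (\<phi> p (X p)) (Y p) *\<^sub>R \<xi> p - \<eta> p (Y p) *\<^sub>R \<phi> p (X p)))"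

text \<open>Here and below a submanifold is an immersion \<open>\<iota>\<close> of \<open>N\<close> in \<open>M\<close>; its tangent space
  at \<open>p\<close>, seen in \<open>M\<close>, is the range of the differential of \<open>\<iota>\<close> at \<open>p\<close>.\<close>

definition invariant_submanifold ::
  "('a, 'e::euclidean_space) mfd \<Rightarrow> ('m, 'k::euclidean_space) mfd \<Rightarrow> ('m \<Rightarrow> 'k \<Rightarrow> 'k) \<Rightarrow>
     ('a \<Rightarrow> 'm) \<Rightarrow> bool" where
  "invariant_submanifold N M \<phi> \<iota> \<longleftrightarrow>
     (\<forall>p\<in>carrier N. \<phi> (\<iota> p) ` range (mdiff N M \<iota> p) \<subseteq> range (mdiff N M \<iota> p))"

definition tangent_to ::
  "('a, 'e::euclidean_space) mfd \<Rightarrow> ('m, 'k::euclidean_space) mfd \<Rightarrow> ('m \<Rightarrow> 'k) \<Rightarrow>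
     ('a \<Rightarrow> 'm) \<Rightarrow> bool" where
  "tangent_to N M \<xi> \<iota> \<longleftrightarrow> (\<forall>p\<in>carrier N. \<xi> (\<iota> p) \<in> range (mdiff N M \<iota> p))"

definition orth_proj :: "('k::real_vector \<Rightarrow> 'k \<Rightarrow> real) \<Rightarrow> 'k set \<Rightarrow> 'k \<Rightarrow> 'k" where
  "orth_proj G S w = (THE y. y \<in> S \<and> (\<forall>s\<in>S. G (w - y) s = 0))"

text \<open>For \<open>w \<noteq> 0\<close> this is the angle in \<open>[0, \<pi>/2]\<close> between \<open>w\<close> and its projection to \<open>S\<close>, and \<open>\<pi>/2\<close>
  if the projection vanishes.\<close>

definition angle_to_subspace :: "('k::real_vector \<Rightarrow> 'k \<Rightarrow> real) \<Rightarrow> 'k \<Rightarrow> 'k set \<Rightarrow> real" where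
  "angle_to_subspace G w S = arccos (gnorm G (orth_proj G S w) / gnorm G w)"

definition slant_submanifold ::
  "('a, 'e::euclidean_space) mfd \<Rightarrow> ('m, 'k::euclidean_space) mfd \<Rightarrow> ('m \<Rightarrow> 'k \<Rightarrow> 'k) \<Rightarrow>
     ('m \<Rightarrow> 'k) \<Rightarrow> ('m, 'k) metric \<Rightarrow> ('a \<Rightarrow> 'm) \<Rightarrow> real \<Rightarrow> bool" where
  "slant_submanifold N M \<phi> \<xi> g \<iota> \<theta> \<longleftrightarrow>
     (\<forall>p\<in>carrier N. \<forall>w\<in>range (mdiff N M \<iota> p). w \<noteq> 0 \<and> w \<notin> span {\<xi> (\<iota> p)} \<longrightarrow>
        angle_to_subspace (g (\<iota> p)) (\<phi> (\<iota> p) w) (range (mdiff N M \<iota> p)) = \<theta>)"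

definition proper_slant_submanifold ::
  "('a, 'e::euclidean_space) mfd \<Rightarrow> ('m, 'k::euclidean_space) mfd \<Rightarrow> ('m \<Rightarrow> 'k \<Rightarrow> 'k) \<Rightarrow>
     ('m \<Rightarrow> 'k) \<Rightarrow> ('m, 'k) metric \<Rightarrow> ('a \<Rightarrow> 'm) \<Rightarrow> real \<Rightarrow> bool" where
  "proper_slant_submanifold N M \<phi> \<xi> g \<iota> \<theta> \<longleftrightarrow>
     slant_submanifold N M \<phi> \<xi> g \<iota> \<theta> \<and> \<theta> \<noteq> 0 \<and> \<theta> \<noteq> pi / 2"

text \<open>The warped product of \<open>MT\<close> and \<open>M\<theta>\<close> with warping function \<open>f\<close> is isometrically immersed in \<open>M\<close>
  by \<open>F\<close>. The submanifolds \<open>M\<^sub>T\<close> and \<open>M\<^sub>\<theta>\<close> of \<open>M\<close> are the images of the leaves \<open>MT \<times> {q}\<close>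
  and \<open>{p} \<times> M\<theta>\<close>. Both factors are modelled on Euclidean spaces of positive dimension.\<close>

definition warped_product_semi_slant ::
  "('m, 'k::euclidean_space) mfd \<Rightarrow> ('m \<Rightarrow> 'k \<Rightarrow> 'k) \<Rightarrow> ('m \<Rightarrow> 'k) \<Rightarrow> ('m, 'k) metric \<Rightarrow>
     ('a, 'e::euclidean_space) mfd \<Rightarrow> ('a, 'e) metric \<Rightarrow> ('a \<Rightarrow> real) \<Rightarrow>
     ('b, 'f::euclidean_space) mfd \<Rightarrow> ('b, 'f) metric \<Rightarrow> ('a \<times> 'b \<Rightarrow> 'm) \<Rightarrow> real \<Rightarrow> bool" where
  "warped_product_semi_slant M \<phi> \<xi> g MT gT f M\<theta> g\<theta> F \<theta> \<longleftrightarrow>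
     smooth_manifold MT \<and> riemannian_metric MT gT \<and>
     smooth_manifold M\<theta> \<and> riemannian_metric M\<theta> g\<theta> \<and>
     smooth_function MT f \<and> (\<forall>p\<in>carrier MT. f p > 0) \<and>
     immersion (prod_mfd MT M\<theta>) M F \<and>
     (\<forall>x\<in>carrier (prod_mfd MT M\<theta>).
        pullback_metric (prod_mfd MT M\<theta>) M F g x = warped_metric MT gT f M\<theta> g\<theta> x) \<and>
     (\<forall>q\<in>carrier M\<theta>. invariant_submanifold MT M \<phi> (\<lambda>p. F (p, q)) \<and>
                      tangent_to MT M \<xi> (\<lambda>p. F (p, q))) \<and>
     (\<forall>p\<in>carrier MT. proper_slant_submanifold M\<theta> M \<phi> \<xi> g (\<lambda>q. F (p, q)) \<theta>)"

end

theory Submission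
  imports Defs
begin

text \<open>Let \<open>X\<close> be tangent to \<open>M\<^sub>T\<close> and let \<open>Z\<close>, \<open>W\<close> be tangent to \<open>M\<^sub>\<theta>\<close>. In the warped product
  \<open>\<nabla>\<^sub>X Z = \<nabla>\<^sub>Z X = X(ln f) Z\<close>, while the \<open>M\<^sub>T\<close>-part of \<open>\<nabla>\<^sub>Z W\<close> is \<open>- g(Z, W) \<nabla>(ln f)\<close>. Differentiating
  \<open>g(\<phi>X, W) = 0\<close> along \<open>Z\<close> and inserting the Kenmotsu identity gives
  \<open>g(h(X, Z), \<phi>W) = (X(ln f) - \<eta>(X)) g(\<phi>Z, W) - (\<phi>X)(ln f) g(Z, W)\<close>, and differentiating \<open>g(\<xi>, W) = 0\<close>
  gives \<open>\<xi>(ln f) = 1\<close>. The normal parts of \<open>\<phi>W / sin \<theta>\<close>, for \<open>W\<close> in an orthonormal basis, are orthonormal, so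
  Bessel's inequality bounds \<open>\<parallel>h(X, Z)\<parallel>\<^sup>2\<close> from below. Both \<open>(X(ln f) - \<eta>(X))\<^sup>2\<close> and \<open>((\<phi>X)(ln f))\<^sup>2\<close> sum to
  \<open>\<parallel>\<nabla>(ln f)\<parallel>\<^sup>2 - 1\<close> over an orthonormal basis of \<open>TM\<^sub>T\<close>, so the mixed terms of \<open>\<parallel>h\<parallel>\<^sup>2\<close> alone give the
  inequality. In the case of equality \<open>h\<close> vanishes on \<open>TM\<^sub>T \<times> TM\<^sub>T\<close> and on \<open>TM\<^sub>\<theta> \<times> TM\<^sub>\<theta>\<close>, and the second
  fundamental forms of the leaves in the ambient manifold are those in the warped product.\<close>

section \<open>Functions of class C^k\<close>

text \<open>Tangent vectors are stored in a chart chosen separately at each point, and this choice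
  may jump. So nothing can be differentiated before it is rewritten in one fixed chart around the
  base point; the Kenmotsu identity, too, becomes a formula for the derivative of \<phi> in such a
  chart. The connection of the warped product is not written out: the Koszul formula reads the
  tangential part of the ambient derivative off the first derivatives of the induced metric.

  Origin of the constants: for a unit Z, with a = X(ln f) - \<eta>(X) and b = (\<phi>X)(ln f), the
  functional that sends W to g(h(X, Z), \<phi>W) is represented by a PZ - b Z. As PZ is orthogonal
  to Z and has length cos \<theta>, its squared length is a^2 cos^2 \<theta> + b^2, and Bessel
  divides by sin^2 \<theta>: the cotangent belongs to a, the cosecant to b. Summing over Z gives 2s,
  and the pairs (X, Z) and (Z, X) another factor 2. In the equality case only mixed terms of h
  survive, and these do not enter its trace; hence minimality.\<close>

lemma Ck_on_cong:
  assumes "open U" "\<And>x. x \<in> U \<Longrightarrow> f x = g x" "Ck_on k U f"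
  shows "Ck_on k U g"
  using assms(2,3)
proof (induction k arbitrary: f g)
  case 0
  then show ?case by (simp cong: continuous_on_cong)
next
  case (Suc k)
  have d: "f differentiable (at x)" if "x \<in> U" for x
    using Suc.prems that by auto
  have D: "(g has_derivative frechet_derivative f (at x)) (at x)" if "x \<in> U" for x
    by (rule has_derivative_transform_within_open[OF _ \<open>open U\<close> that Suc.prems(1)])
      (use d that frechet_derivative_works in auto)
  then have "frechet_derivative f (at x) = frechet_derivative g (at x)" if "x \<in> U" for x
    using that frechet_derivative_at by blast
  then have "Ck_on k U (\<lambda>x. frechet_derivative g (at x) v)" for v
    using Suc.IH[of "\<lambda>x. frechet_derivative f (at x) v" "\<lambda>x. frechet_derivative g (at x) v"]
      Suc.prems(2) by simp
  moreover have "g differentiable (at x)" if "x \<in> U" for x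
    using D that differentiable_def by blast
  ultimately show ?case by simp
qed

text \<open>Derivatives are unique, so on an open set any explicit derivative formula may stand in
  for \<open>frechet_derivative\<close>.\<close>

lemma Ck_on_SucI:
  assumes "open U" "\<And>x. x \<in> U \<Longrightarrow> (f has_derivative f' x) (at x)" "\<And>v. Ck_on k U (\<lambda>x. f' x v)"
  shows "Ck_on (Suc k) U f"
proof -
  have "f' x = frechet_derivative f (at x)" if "x \<in> U" for x
    using assms(2) that frechet_derivative_at by blast
  then have "Ck_on k U (\<lambda>x. frechet_derivative f (at x) v)" for v
    by (intro Ck_on_cong[OF assms(1) _ assms(3)[of v]]) simp
  then show ?thesis using assms(2) differentiable_def by fastforce
qed

lemma Ck_on_SucD:
  assumes "Ck_on (Suc k) U f"
  shows "\<And>x. x \<in> U \<Longrightarrow> (f has_derivative frechet_derivative f (at x)) (at x)"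
    and "\<And>v. Ck_on k U (\<lambda>x. frechet_derivative f (at x) v)"
  using assms frechet_derivative_works by auto

lemma Ck_on_Suc_imp: "Ck_on (Suc k) U f \<Longrightarrow> Ck_on k U f"
proof (induction k arbitrary: f)
  case 0
  then show ?case
    by (auto intro!: continuous_at_imp_continuous_on differentiable_imp_continuous_within)
next
  case (Suc k)
  show ?case
    unfolding Ck_on.simps(2)[of k]
    by (intro conjI allI Suc.IH) (use Suc.prems in simp_all)
qed

lemma Ck_on_const: "Ck_on k U (\<lambda>x. c)"
  by (induction k arbitrary: c) auto

lemma Ck_on_add:
  assumes "open U" "Ck_on k U f" "Ck_on k U g"
  shows "Ck_on k U (\<lambda>x. f x + g x)"
  using assms(2,3)
proof (induction k arbitrary: f g)
  case (Suc k)
  note D = Ck_on_SucD[OF Suc.prems(1)] Ck_on_SucD[OF Suc.prems(2)]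
  show ?case
    by (rule Ck_on_SucI[OF \<open>open U\<close> has_derivative_add[OF D(1) D(3)]]) (use Suc.IH D in auto)
qed (auto intro: continuous_intros)

lemma Ck_on_sum:
  assumes "open U" "\<And>i. i \<in> I \<Longrightarrow> Ck_on k U (f i)"
  shows "Ck_on k U (\<lambda>x. \<Sum>i\<in>I. f i x)"
  using assms(2)
  by (induction I rule: infinite_finite_induct) (auto intro: Ck_on_const Ck_on_add[OF assms(1)])

lemma Ck_on_bounded_linear:
  assumes "open U" "bounded_linear L" "Ck_on k U f"
  shows "Ck_on k U (\<lambda>x. L (f x))"
  using assms(3)
proof (induction k arbitrary: f)
  case 0
  then show ?case using bounded_linear.continuous_on[OF assms(2)] by auto
next
  case (Suc k)
  note D = Ck_on_SucD[OF Suc.prems]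
  show ?case
    by (rule Ck_on_SucI[OF \<open>open U\<close> bounded_linear.has_derivative[OF assms(2) D(1)]])
      (use Suc.IH D in auto)
qed

lemma Ck_on_scaleR:
  fixes f :: "'a::euclidean_space \<Rightarrow> real"
  assumes "open U" "Ck_on k U f" "Ck_on k U g"
  shows "Ck_on k U (\<lambda>x. f x *\<^sub>R g x)"
  using assms(2,3)
proof (induction k arbitrary: f g)
  case (Suc k)
  note D = Ck_on_SucD[OF Suc.prems(1)] Ck_on_SucD[OF Suc.prems(2)]
  show ?case
    by (rule Ck_on_SucI[OF \<open>open U\<close> has_derivative_scaleR[OF D(1) D(3)]])
      (assumption | intro Ck_on_add[OF \<open>open U\<close>] Suc.IH D(2,4) Suc.prems[THEN Ck_on_Suc_imp])+
qed (auto intro: continuous_intros)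

lemma linear_expand:
  fixes L :: "'a::euclidean_space \<Rightarrow> 'b::real_vector"
  assumes "linear L"
  shows "L v = (\<Sum>i\<in>Basis. (v \<bullet> i) *\<^sub>R L i)"
proof -
  have "L v = L (\<Sum>i\<in>Basis. (v \<bullet> i) *\<^sub>R i)" by (simp add: euclidean_representation)
  also have "\<dots> = (\<Sum>i\<in>Basis. (v \<bullet> i) *\<^sub>R L i)"
    by (simp add: linear_sum[OF assms] linear_scale[OF assms])
  finally show ?thesis .
qed

text \<open>The chain rule applies a varying linear map to a varying vector. Expanding the vector in
  \<open>Basis\<close> turns this into a finite sum of products, each of class C^k by the induction
  hypothesis for the partial derivatives of \<open>f\<close>.\<close>

lemma Ck_on_compose:
  fixes f :: "'b::euclidean_space \<Rightarrow> 'c::real_normed_vector"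
  assumes U: "open U" and V: "open V" and sub: "g ` U \<subseteq> V" and g: "Ck_on k U g" and f: "Ck_on k V f"
  shows "Ck_on k U (\<lambda>x. f (g x))"
  using g f
proof (induction k arbitrary: f)
  case 0
  then show ?case using sub by (auto intro: continuous_on_compose2)
next
  case (Suc k)
  note D = Ck_on_SucD[OF Suc.prems(1)] Ck_on_SucD[OF Suc.prems(2)]
  let ?D = "\<lambda>x v. \<Sum>i\<in>Basis. (frechet_derivative g (at x) v \<bullet> i) *\<^sub>R frechet_derivative f (at (g x)) i"
  show ?case
  proof (rule Ck_on_SucI[OF U, of _ ?D])
    fix x assume x: "x \<in> U"
    have "(f has_derivative frechet_derivative f (at (g x))) (at (g x))"
      using D(3) x sub by blast
    then have "((\<lambda>x. f (g x)) has_derivative (\<lambda>v. frechet_derivative f (at (g x)) (frechet_derivative g (at x) v))) (at x)"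
      using has_derivative_compose[OF D(1)[OF x]] by blast
    moreover have "linear (frechet_derivative f (at (g x)))"
      using D(3) x sub has_derivative_linear by blast
    ultimately show "((\<lambda>x. f (g x)) has_derivative ?D x) (at x)"
      by (simp add: linear_expand[symmetric])
  next
    fix v
    have "Ck_on k U (\<lambda>x. frechet_derivative f (at (g x)) i)" for i
      by (rule Suc.IH) (simp_all only: Ck_on_Suc_imp[OF Suc.prems(1)] D)
    moreover have "Ck_on k U (\<lambda>x. frechet_derivative g (at x) v \<bullet> i)" for i
      by (rule Ck_on_bounded_linear[OF U bounded_linear_inner_left D(2)])
    ultimately show "Ck_on k U (\<lambda>x. ?D x v)"
      by (intro Ck_on_sum[OF U] Ck_on_scaleR[OF U])
  qed
qed

lemma Ck_on_subset: "Ck_on k V f \<Longrightarrow> U \<subseteq> V \<Longrightarrow> Ck_on k U f"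
  by (induction k arbitrary: f) (auto intro: continuous_on_subset)

lemma smooth_on_subset: "smooth_on V f \<Longrightarrow> U \<subseteq> V \<Longrightarrow> smooth_on U f"
  using Ck_on_subset unfolding smooth_on_def by blast

lemma smooth_on_cong:
  "open U \<Longrightarrow> (\<And>x. x \<in> U \<Longrightarrow> f x = g x) \<Longrightarrow> smooth_on U f \<Longrightarrow> smooth_on U g"
  using Ck_on_cong unfolding smooth_on_def by blast

lemma smooth_on_compose:
  "open U \<Longrightarrow> open V \<Longrightarrow> g ` U \<subseteq> V \<Longrightarrow> smooth_on U g \<Longrightarrow> smooth_on V f \<Longrightarrow> smooth_on U (\<lambda>x. f (g x))"
  using Ck_on_compose unfolding smooth_on_def by blast

lemma smooth_on_derivative:
  "smooth_on U f \<Longrightarrow> smooth_on U (\<lambda>x. frechet_derivative f (at x) v)"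
  unfolding smooth_on_def using Ck_on_SucD(2) by blast

lemma smooth_on_has_derivative:
  "smooth_on U f \<Longrightarrow> x \<in> U \<Longrightarrow> (f has_derivative frechet_derivative f (at x)) (at x)"
  unfolding smooth_on_def using Ck_on_SucD(1) by blast

lemma smooth_on_slice:
  fixes b :: "'b::euclidean_space"
  assumes "open U"
  shows "smooth_on U (\<lambda>x. (x, b))" "smooth_on U (\<lambda>x. (b, x))"
proof -
  have "Ck_on k U (\<lambda>x. (x, b)) \<and> Ck_on k U (\<lambda>x. (b, x))" for k
  proof (cases k)
    case (Suc n)
    have "Ck_on (Suc n) U (\<lambda>x. (x, b))"
      by (rule Ck_on_SucI[OF assms, where f' = "\<lambda>x v. (v, 0)"])
        (auto intro!: derivative_eq_intros Ck_on_const)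
    moreover have "Ck_on (Suc n) U (\<lambda>x. (b, x))"
      by (rule Ck_on_SucI[OF assms, where f' = "\<lambda>x v. (0, v)"])
        (auto intro!: derivative_eq_intros Ck_on_const)
    ultimately show ?thesis using Suc by blast
  qed (auto intro: continuous_intros)
  then show "smooth_on U (\<lambda>x. (x, b))" "smooth_on U (\<lambda>x. (b, x))"
    by (auto simp: smooth_on_def)
qed

text \<open>The mean value theorem is used twice: along \<open>u\<close> for the difference of
  \<open>f\<close> on two parallel segments, then along \<open>v\<close> for the derivative so
  obtained. The left side is symmetric in \<open>u\<close> and \<open>v\<close>, which is its
  purpose.\<close>

lemma second_difference_mean_value:
  fixes f :: "'a::euclidean_space \<Rightarrow> real"
  assumes t: "0 < t"
    and U: "\<And>s r. 0 \<le> s \<Longrightarrow> s \<le> t \<Longrightarrow> 0 \<le> r \<Longrightarrow> r \<le> t \<Longrightarrow> a + s *\<^sub>R u + r *\<^sub>R v \<in> U"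
    and f: "Ck_on 2 U f"
  shows "\<exists>s r. 0 < s \<and> s < t \<and> 0 < r \<and> r < t \<and>
    f (a + t *\<^sub>R u + t *\<^sub>R v) - f (a + t *\<^sub>R u) - f (a + t *\<^sub>R v) + f a =
    t\<^sup>2 * frechet_derivative (\<lambda>x. frechet_derivative f (at x) u) (at (a + s *\<^sub>R u + r *\<^sub>R v)) v"
proof -
  let ?D = "\<lambda>x. frechet_derivative f (at x)"
  let ?E = "\<lambda>x. frechet_derivative (\<lambda>x. frechet_derivative f (at x) u) (at x)"
  have f2: "Ck_on (Suc (Suc 0)) U f" using f by (simp add: numeral_2_eq_2)
  note D = Ck_on_SucD[OF f2]
  note D2 = Ck_on_SucD(1)[OF D(2)]
  define k where "k r s = f (a + s *\<^sub>R u + r *\<^sub>R v)" for r s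
  have dk: "(k r has_derivative (\<lambda>h. ?D (a + s *\<^sub>R u + r *\<^sub>R v) (h *\<^sub>R u))) (at s)"
    if "0 \<le> s" "s \<le> t" "0 \<le> r" "r \<le> t" for r s
  proof -
    have "((\<lambda>s. a + s *\<^sub>R u + r *\<^sub>R v) has_derivative (\<lambda>h. h *\<^sub>R u)) (at s)"
      by (auto intro!: derivative_eq_intros)
    from has_derivative_compose[OF this D(1)[OF U[OF that]]] show ?thesis
      unfolding k_def .
  qed
  have "\<exists>s\<in>{0<..<t}. (\<lambda>s. k t s - k 0 s) t - (\<lambda>s. k t s - k 0 s) 0 =
     ?D (a + s *\<^sub>R u + t *\<^sub>R v) ((t - 0) *\<^sub>R u) - ?D (a + s *\<^sub>R u + 0 *\<^sub>R v) ((t - 0) *\<^sub>R u)"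
  proof (rule mvt_simple[OF t])
    fix x assume "0 \<le> x" "x \<le> t"
    then show "((\<lambda>s. k t s - k 0 s) has_derivative
        (\<lambda>h. ?D (a + x *\<^sub>R u + t *\<^sub>R v) (h *\<^sub>R u) - ?D (a + x *\<^sub>R u + 0 *\<^sub>R v) (h *\<^sub>R u)))
        (at x within {0..t})"
      using has_derivative_at_withinI[OF has_derivative_diff[OF dk[of x t] dk[of x 0]]] t by simp
  qed
  then obtain s where s: "0 < s" "s < t" and e1:
    "k t t - k 0 t - (k t 0 - k 0 0) =
       ?D (a + s *\<^sub>R u + t *\<^sub>R v) (t *\<^sub>R u) - ?D (a + s *\<^sub>R u) (t *\<^sub>R u)"
    by auto
  have lin: "linear (?D (a + s *\<^sub>R u + r *\<^sub>R v))" "linear (?E (a + s *\<^sub>R u + r *\<^sub>R v))"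
    if "0 \<le> r" "r \<le> t" for r
    using D(1) D2 U[of s r] s that has_derivative_linear by force+
  have "\<exists>r\<in>{0<..<t}. ?D (a + s *\<^sub>R u + t *\<^sub>R v) u - ?D (a + s *\<^sub>R u + 0 *\<^sub>R v) u =
      ?E (a + s *\<^sub>R u + r *\<^sub>R v) ((t - 0) *\<^sub>R v)"
  proof (rule mvt_simple[OF t])
    fix r assume r: "0 \<le> r" "r \<le> t"
    have 1: "((\<lambda>r. a + s *\<^sub>R u + r *\<^sub>R v) has_derivative (\<lambda>h. h *\<^sub>R v)) (at r within {0..t})"
      by (auto intro!: derivative_eq_intros)
    show "((\<lambda>r. ?D (a + s *\<^sub>R u + r *\<^sub>R v) u) has_derivative (\<lambda>h. ?E (a + s *\<^sub>R u + r *\<^sub>R v) (h *\<^sub>R v)))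
        (at r within {0..t})"
      by (rule has_derivative_compose[OF 1, where g="\<lambda>x. ?D x u"]) (use D2 U[of s r] s r in auto)
  qed
  then obtain r where r: "0 < r" "r < t" and e2:
    "?D (a + s *\<^sub>R u + t *\<^sub>R v) u - ?D (a + s *\<^sub>R u) u = ?E (a + s *\<^sub>R u + r *\<^sub>R v) (t *\<^sub>R v)"
    by auto
  have "k t t - k 0 t - (k t 0 - k 0 0) = t * (?D (a + s *\<^sub>R u + t *\<^sub>R v) u - ?D (a + s *\<^sub>R u) u)"
    unfolding e1 using linear_scale[OF lin(1)[of t]] linear_scale[OF lin(1)[of 0]] t
    by (simp add: right_diff_distrib)
  also have "\<dots> = t\<^sup>2 * ?E (a + s *\<^sub>R u + r *\<^sub>R v) v"
    unfolding e2 using linear_scale[OF lin(2)[of r]] r by (simp add: power2_eq_square)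
  finally show ?thesis
    using s r by (intro exI[of _ s] exI[of _ r]) (simp add: k_def algebra_simps)
qed

text \<open>Exchanging \<open>u\<close> and \<open>v\<close> leaves the second difference unchanged,
  so some value of one mixed derivative near \<open>a\<close> equals some value of the other;
  continuity at \<open>a\<close> does the rest.\<close>

lemma second_derivative_symmetric_real:
  fixes f :: "'a::euclidean_space \<Rightarrow> real"
  assumes "open U" "a \<in> U" and f: "Ck_on 2 U f"
  shows "frechet_derivative (\<lambda>x. frechet_derivative f (at x) u) (at a) v =
         frechet_derivative (\<lambda>x. frechet_derivative f (at x) v) (at a) u"
proof -
  let ?E = "\<lambda>u v x. frechet_derivative (\<lambda>x. frechet_derivative f (at x) u) (at x) v"
  have cont: "isCont (?E u v) a" for u v
  proof -
    have "Ck_on (Suc (Suc 0)) U f" using f by (simp add: numeral_2_eq_2)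
    then have "continuous_on U (?E u v)" by simp
    then show ?thesis using assms continuous_on_eq_continuous_at by blast
  qed
  obtain B where B: "B > 0" "ball a B \<subseteq> U" using assms openE by metis
  have "\<bar>?E u v a - ?E v u a\<bar> \<le> e" if "e > 0" for e
  proof -
    have ev: "\<exists>d>0. \<forall>x. dist x a < d \<longrightarrow> \<bar>?E u v x - ?E u v a\<bar> < e / 2" for u v
      using cont[of u v] \<open>e > 0\<close> unfolding continuous_at_eps_delta dist_real_def
      by (metis half_gt_zero)
    obtain d1 where d1: "d1 > 0" "\<And>x. dist x a < d1 \<Longrightarrow> \<bar>?E u v x - ?E u v a\<bar> < e / 2"
      using ev[of u v] by blast
    obtain d2 where d2: "d2 > 0" "\<And>x. dist x a < d2 \<Longrightarrow> \<bar>?E v u x - ?E v u a\<bar> < e / 2"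
      using ev[of v u] by blast
    define d where "d = min d1 d2"
    have d: "d > 0"
      "\<And>x. dist x a < d \<Longrightarrow> \<bar>?E u v x - ?E u v a\<bar> < e / 2"
      "\<And>x. dist x a < d \<Longrightarrow> \<bar>?E v u x - ?E v u a\<bar> < e / 2"
      using d1 d2 by (auto simp: d_def)
    define c where "c = norm u + norm v + 1"
    have c: "c > 0" by (simp add: c_def add_nonneg_pos)
    \<comment> \<open>Any s u + r v with coefficients in [0, t] has norm below t * c = min B d, the
      summand 1 in \<open>c\<close> making this strict. The whole parallelogram thus lies in
      \<open>U\<close> and where both mixed derivatives are within e / 2 of their values at
      \<open>a\<close>.\<close>
    define t where "t = min B d / c"
    have t: "t > 0" using B d c by (simp add: t_def)
    have small: "norm (s *\<^sub>R u + r *\<^sub>R v) < min B d" if "0 \<le> s" "s \<le> t" "0 \<le> r" "r \<le> t" for s r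
    proof -
      have "norm (s *\<^sub>R u + r *\<^sub>R v) \<le> s * norm u + r * norm v"
        using norm_triangle_ineq[of "s *\<^sub>R u" "r *\<^sub>R v"] that by simp
      also have "\<dots> \<le> t * norm u + t * norm v"
        using that by (intro add_mono mult_right_mono) auto
      also have "\<dots> < t * c" using t by (simp add: c_def algebra_simps)
      finally show ?thesis using c by (simp add: t_def)
    qed
    have dist: "dist (a + s *\<^sub>R u + r *\<^sub>R v) a < min B d"
      if "0 \<le> s" "s \<le> t" "0 \<le> r" "r \<le> t" for s r
      using small[OF that] by (simp add: dist_norm add.assoc)
    then have U: "a + s *\<^sub>R u + r *\<^sub>R v \<in> U" if "0 \<le> s" "s \<le> t" "0 \<le> r" "r \<le> t" for s r
      using that B(2) by (force simp: dist_commute)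
    obtain s r where 1: "0 < s" "s < t" "0 < r" "r < t"
      "f (a + t *\<^sub>R u + t *\<^sub>R v) - f (a + t *\<^sub>R u) - f (a + t *\<^sub>R v) + f a =
       t\<^sup>2 * ?E u v (a + s *\<^sub>R u + r *\<^sub>R v)"
      using second_difference_mean_value[OF t U f] by blast
    have U': "a + s *\<^sub>R v + r *\<^sub>R u \<in> U" if "0 \<le> s" "s \<le> t" "0 \<le> r" "r \<le> t" for s r
      using U[OF that(3,4,1,2)] by (simp add: add.assoc add.commute[of "s *\<^sub>R v"])
    obtain s' r' where 2: "0 < s'" "s' < t" "0 < r'" "r' < t"
      "f (a + t *\<^sub>R v + t *\<^sub>R u) - f (a + t *\<^sub>R v) - f (a + t *\<^sub>R u) + f a =
       t\<^sup>2 * ?E v u (a + s' *\<^sub>R v + r' *\<^sub>R u)"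
      using second_difference_mean_value[OF t U' f] by blast
    have "t\<^sup>2 * ?E u v (a + s *\<^sub>R u + r *\<^sub>R v) = t\<^sup>2 * ?E v u (a + s' *\<^sub>R v + r' *\<^sub>R u)"
      unfolding 1(5)[symmetric] 2(5)[symmetric] by (simp add: add.commute add.left_commute)
    then have "?E u v (a + s *\<^sub>R u + r *\<^sub>R v) = ?E v u (a + s' *\<^sub>R v + r' *\<^sub>R u)"
      using t by simp
    moreover have "dist (a + s *\<^sub>R u + r *\<^sub>R v) a < d" "dist (a + s' *\<^sub>R v + r' *\<^sub>R u) a < d"
      using dist[of s r] dist[of r' s'] 1(1-4) 2(1-4)
      by (simp_all add: add.assoc add.commute[of "s' *\<^sub>R v"])
    ultimately show ?thesis
      using d(2)[of "a + s *\<^sub>R u + r *\<^sub>R v"] d(3)[of "a + s' *\<^sub>R v + r' *\<^sub>R u"] by linarith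
  qed
  then have "\<bar>?E u v a - ?E v u a\<bar> \<le> 0" using field_le_epsilon[of _ "0::real"] by (metis add_0)
  then show ?thesis by simp
qed

lemma second_derivative_symmetric:
  fixes f :: "'a::euclidean_space \<Rightarrow> 'b::euclidean_space"
  assumes "open U" "a \<in> U" and f: "smooth_on U f"
  shows "frechet_derivative (\<lambda>x. frechet_derivative f (at x) u) (at a) v =
         frechet_derivative (\<lambda>x. frechet_derivative f (at x) v) (at a) u"
proof (rule euclidean_eqI)
  fix i :: 'b assume "i \<in> Basis"
  have 1: "frechet_derivative (\<lambda>x. f x \<bullet> i) (at x) v = frechet_derivative f (at x) v \<bullet> i" if "x \<in> U" for x v
    using frechet_derivative_at[OF bounded_linear.has_derivative[OF bounded_linear_inner_left smooth_on_has_derivative[OF f that]]]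
    by (simp add: fun_eq_iff)
  have 2: "frechet_derivative (\<lambda>x. frechet_derivative (\<lambda>x. f x \<bullet> i) (at x) u) (at a) v
     = frechet_derivative (\<lambda>x. frechet_derivative f (at x) u) (at a) v \<bullet> i" for u v
  proof -
    have "((\<lambda>x. frechet_derivative f (at x) u \<bullet> i) has_derivative
        (\<lambda>v. frechet_derivative (\<lambda>x. frechet_derivative f (at x) u) (at a) v \<bullet> i)) (at a)"
      by (intro bounded_linear.has_derivative[OF bounded_linear_inner_left]
          smooth_on_has_derivative[OF smooth_on_derivative[OF f] \<open>a \<in> U\<close>])
    from has_derivative_transform_within_open[OF this assms(1,2) 1[symmetric]]
    have "((\<lambda>x. frechet_derivative (\<lambda>x. f x \<bullet> i) (at x) u) has_derivative
        (\<lambda>v. frechet_derivative (\<lambda>x. frechet_derivative f (at x) u) (at a) v \<bullet> i)) (at a)" .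
    from fun_cong[OF frechet_derivative_at[OF this], of v] show ?thesis by (rule sym)
  qed
  have "Ck_on 2 U (\<lambda>x. f x \<bullet> i)"
    using f Ck_on_bounded_linear[OF assms(1) bounded_linear_inner_left, of 2 f i]
    by (simp add: smooth_on_def)
  from second_derivative_symmetric_real[OF assms(1,2) this, of u v]
  show "frechet_derivative (\<lambda>x. frechet_derivative f (at x) u) (at a) v \<bullet> i =
        frechet_derivative (\<lambda>x. frechet_derivative f (at x) v) (at a) u \<bullet> i"
    by (simp add: 2)
qed

section \<open>Charts and products\<close>

text \<open>Only differentiable transition maps are required, which is enough for the chain rule at a point
  and passes to products at once.\<close>

definition C1_atlas :: "('a, 'e::euclidean_space) mfd \<Rightarrow> bool" where
  "C1_atlas M \<longleftrightarrow>
     (\<forall>c\<in>atlas M. openin (mfd_top M) (chart_dom c) \<and> inj_on (chart_map c) (chart_dom c) \<and>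
        (\<forall>V. openin (mfd_top M) V \<and> V \<subseteq> chart_dom c \<longrightarrow> open (chart_map c ` V))) \<and>
     (\<forall>c\<in>atlas M. \<forall>d\<in>atlas M. \<forall>p\<in>chart_dom c \<inter> chart_dom d.
        (chart_map d \<circ> chart_inv c) differentiable (at (chart_map c p))) \<and>
     (\<forall>p\<in>carrier M. chart_at M p \<in> atlas M \<and> p \<in> chart_dom (chart_at M p))"

lemma
  assumes "C1_atlas M" "c \<in> atlas M"
  shows C1_atlas_openin: "openin (mfd_top M) (chart_dom c)"
    and C1_atlas_inj: "inj_on (chart_map c) (chart_dom c)"
    and C1_atlas_open_image: "\<And>V. openin (mfd_top M) V \<Longrightarrow> V \<subseteq> chart_dom c \<Longrightarrow> open (chart_map c ` V)"
    and C1_atlas_differentiable: "\<And>d p. d \<in> atlas M \<Longrightarrow> p \<in> chart_dom c \<Longrightarrow> p \<in> chart_dom d \<Longrightarrow>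
        (chart_map d \<circ> chart_inv c) differentiable (at (chart_map c p))"
  using assms unfolding C1_atlas_def by blast+

lemma
  assumes "C1_atlas M" "p \<in> carrier M"
  shows chart_at_atlas: "chart_at M p \<in> atlas M" and chart_at_dom: "p \<in> chart_dom (chart_at M p)"
  using assms unfolding C1_atlas_def by blast+

lemma chart_dom_carrier: "C1_atlas M \<Longrightarrow> c \<in> atlas M \<Longrightarrow> p \<in> chart_dom c \<Longrightarrow> p \<in> carrier M"
  using C1_atlas_openin openin_subset by blast

lemma chart_inv_map: "C1_atlas M \<Longrightarrow> c \<in> atlas M \<Longrightarrow> p \<in> chart_dom c \<Longrightarrow> chart_inv c (chart_map c p) = p"
  by (simp add: chart_inv_def inv_into_f_f C1_atlas_inj)

lemma smooth_manifold_C1_atlas: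
  assumes "smooth_manifold M"
  shows "C1_atlas M"
proof -
  have *: "openin (mfd_top M) (chart_dom c) \<and> inj_on (chart_map c) (chart_dom c) \<and>
        (\<forall>V. openin (mfd_top M) V \<and> V \<subseteq> chart_dom c \<longrightarrow> open (chart_map c ` V))"
    if c: "c \<in> atlas M" for c
  proof -
    have o: "openin (mfd_top M) (chart_dom c)" "open (chart_map c ` chart_dom c)"
      and h: "homeomorphic_map (subtopology (mfd_top M) (chart_dom c))
          (top_of_set (chart_map c ` chart_dom c)) (chart_map c)"
      using assms c by (auto simp: smooth_manifold_def)
    have inj: "inj_on (chart_map c) (chart_dom c)"
      using homeomorphic_imp_injective_map[OF h] openin_subset[OF o(1)]
      by (simp add: topspace_subtopology inf.absorb2)
    have "open (chart_map c ` V)" if V: "openin (mfd_top M) V" "V \<subseteq> chart_dom c" for V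
    proof -
      have "openin (subtopology (mfd_top M) (chart_dom c)) V"
        using V o(1) openin_open_subtopology by blast
      then have "openin (top_of_set (chart_map c ` chart_dom c)) (chart_map c ` V)"
        using homeomorphic_imp_open_map[OF h] by (simp add: open_map_def)
      then show ?thesis using o(2) openin_open_eq by blast
    qed
    then show ?thesis using o inj by blast
  qed
  moreover have "(chart_map d \<circ> chart_inv c) differentiable (at (chart_map c p))"
    if "c \<in> atlas M" "d \<in> atlas M" "p \<in> chart_dom c \<inter> chart_dom d" for c d p
  proof -
    have "smooth_on (chart_map c ` (chart_dom c \<inter> chart_dom d)) (chart_map d \<circ> chart_inv c)"
      using assms that by (auto simp: smooth_manifold_def)
    from smooth_on_has_derivative[OF this] show ?thesis
      using that by (auto simp: differentiable_def)
  qed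
  ultimately show ?thesis
    using assms unfolding C1_atlas_def smooth_manifold_def by blast
qed

lemma chart_transition_has_derivative:
  assumes "C1_atlas M" "c \<in> atlas M" "p \<in> chart_dom c"
  shows "((chart_map c \<circ> chart_inv (chart_at M p)) has_derivative to_chart M c p)
      (at (chart_map (chart_at M p) p))"
    and "((chart_map (chart_at M p) \<circ> chart_inv c) has_derivative from_chart M c p)
      (at (chart_map c p))"
proof -
  note p = chart_dom_carrier[OF assms]
  note d = chart_at_atlas[OF assms(1) p] chart_at_dom[OF assms(1) p]
  show "((chart_map c \<circ> chart_inv (chart_at M p)) has_derivative to_chart M c p)
      (at (chart_map (chart_at M p) p))"
    using C1_atlas_differentiable[OF assms(1) d(1) assms(2) d(2) assms(3)]
    unfolding to_chart_def frechet_derivative_works[symmetric] .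
  show "((chart_map (chart_at M p) \<circ> chart_inv c) has_derivative from_chart M c p)
      (at (chart_map c p))"
    using C1_atlas_differentiable[OF assms(1,2) d(1) assms(3) d(2)]
    unfolding from_chart_def frechet_derivative_works[symmetric] .
qed

lemma from_chart_linear: "C1_atlas M \<Longrightarrow> c \<in> atlas M \<Longrightarrow> p \<in> chart_dom c \<Longrightarrow> linear (from_chart M c p)"
  by (rule has_derivative_linear[OF chart_transition_has_derivative(2)])

lemma to_chart_linear: "C1_atlas M \<Longrightarrow> c \<in> atlas M \<Longrightarrow> p \<in> chart_dom c \<Longrightarrow> linear (to_chart M c p)"
  by (rule has_derivative_linear[OF chart_transition_has_derivative(1)])

text \<open>Near the point the two transition maps compose to the identity, and the chain rule
  passes this on to their derivatives.\<close>

lemma transition_inverse: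
  assumes M: "C1_atlas M" and c: "c \<in> atlas M" "p \<in> chart_dom c" and d: "d \<in> atlas M" "p \<in> chart_dom d"
    and f: "((chart_map d \<circ> chart_inv c) has_derivative f) (at (chart_map c p))"
    and g: "((chart_map c \<circ> chart_inv d) has_derivative g) (at (chart_map d p))"
  shows "f (g v) = v"
proof -
  note inv = chart_inv_map[OF M]
  have "((\<lambda>x. (chart_map d \<circ> chart_inv c) ((chart_map c \<circ> chart_inv d) x)) has_derivative (\<lambda>v. f (g v)))
      (at (chart_map d p))"
    by (rule has_derivative_compose[OF g]) (use f inv[OF d] in \<open>simp add: o_def\<close>)
  moreover have "open (chart_map d ` (chart_dom c \<inter> chart_dom d))"
    using C1_atlas_open_image[OF M d(1)] C1_atlas_openin[OF M] c d by blast
  ultimately have "((\<lambda>x. x) has_derivative (\<lambda>v. f (g v))) (at (chart_map d p))"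
    by (rule has_derivative_transform_within_open) (use c d inv in auto)
  from has_derivative_unique[OF this has_derivative_ident] show ?thesis by (rule fun_cong)
qed

lemma to_from_chart:
  assumes "C1_atlas M" "c \<in> atlas M" "p \<in> chart_dom c"
  shows "to_chart M c p (from_chart M c p v) = v" "from_chart M c p (to_chart M c p v) = v"
proof -
  note p = chart_dom_carrier[OF assms]
  note d = chart_at_atlas[OF assms(1) p] chart_at_dom[OF assms(1) p]
  show "to_chart M c p (from_chart M c p v) = v"
    by (rule transition_inverse[OF assms(1) d assms(2,3) chart_transition_has_derivative[OF assms]])
  show "from_chart M c p (to_chart M c p v) = v"
    by (rule transition_inverse[OF assms d chart_transition_has_derivative(2,1)[OF assms]])
qed

text \<open>The chart chosen at \<open>p\<close> changes to itself by the identity. This removes all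
  coordinate changes once an expression is evaluated at the base point.\<close>

lemma to_from_chart_at:
  assumes "C1_atlas M" "p \<in> carrier M"
  shows "to_chart M (chart_at M p) p v = v" "from_chart M (chart_at M p) p v = v"
proof -
  let ?c = "chart_at M p"
  note c = chart_at_atlas[OF assms] chart_at_dom[OF assms]
  have "((chart_map ?c \<circ> chart_inv ?c) has_derivative (\<lambda>v. v)) (at (chart_map ?c p))"
    by (rule has_derivative_transform_within_open
          [OF has_derivative_ident, of "chart_map ?c ` chart_dom ?c"])
      (use c chart_inv_map[OF assms(1) c(1)] C1_atlas_open_image[OF assms(1) c(1)]
        C1_atlas_openin[OF assms(1) c(1)] in auto)
  from frechet_derivative_at[OF this]
  show "to_chart M ?c p v = v" "from_chart M ?c p v = v"
    unfolding to_chart_def from_chart_def by (metis)+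
qed

section \<open>Smooth maps in charts\<close>

abbreviation loc :: "('a, 'e) chart \<Rightarrow> ('b, 'f) chart \<Rightarrow> ('a \<Rightarrow> 'b) \<Rightarrow> 'e \<Rightarrow> 'f" where
  "loc c d F \<equiv> chart_map d \<circ> F \<circ> chart_inv c"

lemma smooth_map_openin:
  assumes "C1_atlas N" "C1_atlas M" "smooth_map N M F" "c \<in> atlas N" "d \<in> atlas M"
  shows "openin (mfd_top N) (chart_dom c \<inter> F -` chart_dom d)"
proof -
  have "openin (mfd_top N) {x \<in> carrier N. F x \<in> chart_dom d}"
    using assms C1_atlas_openin[OF assms(2,5)] openin_continuous_map_preimage
    by (auto simp: smooth_map_def)
  moreover have "chart_dom c \<inter> F -` chart_dom d = chart_dom c \<inter> {x \<in> carrier N. F x \<in> chart_dom d}"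
    using chart_dom_carrier[OF assms(1,4)] by auto
  ultimately show ?thesis using C1_atlas_openin[OF assms(1,4)] by auto
qed

lemma smooth_map_open_image:
  assumes "C1_atlas N" "C1_atlas M" "smooth_map N M F" "c \<in> atlas N" "d \<in> atlas M"
  shows "open (chart_map c ` (chart_dom c \<inter> F -` chart_dom d))"
  using C1_atlas_open_image[OF assms(1,4) smooth_map_openin[OF assms]] by blast

lemma smooth_map_carrier: "smooth_map N M F \<Longrightarrow> p \<in> carrier N \<Longrightarrow> F p \<in> carrier M"
  unfolding smooth_map_def continuous_map_def by blast

lemma smooth_map_loc:
  "smooth_map N M F \<Longrightarrow> c \<in> atlas N \<Longrightarrow> d \<in> atlas M \<Longrightarrow>
    smooth_on (chart_map c ` (chart_dom c \<inter> F -` chart_dom d)) (loc c d F)"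
  unfolding smooth_map_def by blast

lemma mdiff_has_derivative:
  assumes "C1_atlas N" "C1_atlas M" "smooth_map N M F" "p \<in> carrier N"
  shows "(loc (chart_at N p) (chart_at M (F p)) F has_derivative mdiff N M F p)
    (at (chart_map (chart_at N p) p))"
proof -
  note Fp = smooth_map_carrier[OF assms(3,4)]
  have "chart_map (chart_at N p) p \<in> chart_map (chart_at N p) `
      (chart_dom (chart_at N p) \<inter> F -` chart_dom (chart_at M (F p)))"
    using chart_at_dom[OF assms(1,4)] chart_at_dom[OF assms(2) Fp] by simp
  from smooth_on_has_derivative[OF smooth_map_loc[OF assms(3) chart_at_atlas[OF assms(1,4)]
        chart_at_atlas[OF assms(2) Fp]] this]
  show ?thesis unfolding mdiff_def .
qed

lemma mdiff_linear:
  "C1_atlas N \<Longrightarrow> C1_atlas M \<Longrightarrow> smooth_map N M F \<Longrightarrow> p \<in> carrier N \<Longrightarrow> linear (mdiff N M F p)"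
  by (rule has_derivative_linear[OF mdiff_has_derivative])

text \<open>The differential at a moving point refers to charts that depend on the point. Conversion
  to fixed charts \<open>c\<close>, \<open>d\<close> by the chain rule is what allows it to be
  differentiated again.\<close>

lemma mdiff_in_charts:
  assumes N: "C1_atlas N" and M: "C1_atlas M" and F: "smooth_map N M F"
    and c: "c \<in> atlas N" "p \<in> chart_dom c" and d: "d \<in> atlas M" "F p \<in> chart_dom d"
  shows "frechet_derivative (loc c d F) (at (chart_map c p)) v =
    to_chart M d (F p) (mdiff N M F p (from_chart N c p v))"
proof -
  let ?c = "chart_at N p" and ?d = "chart_at M (F p)"
  have p: "p \<in> carrier N" using chart_dom_carrier[OF N c] .
  have Fp: "F p \<in> carrier M" using smooth_map_carrier[OF F p] .
  have c0: "?c \<in> atlas N" "p \<in> chart_dom ?c" using chart_at_atlas[OF N p] chart_at_dom[OF N p] .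
  have d0: "?d \<in> atlas M" "F p \<in> chart_dom ?d" using chart_at_atlas[OF M Fp] chart_at_dom[OF M Fp] .
  note inv = chart_inv_map[OF N]
  have 1: "((\<lambda>x. loc ?c ?d F ((chart_map ?c \<circ> chart_inv c) x)) has_derivative
      (\<lambda>v. mdiff N M F p (from_chart N c p v))) (at (chart_map c p))"
    by (rule has_derivative_compose[OF chart_transition_has_derivative(2)[OF N c]])
      (use mdiff_has_derivative[OF N M F p] inv[OF c] in \<open>simp add: o_def\<close>)
  have 2: "((\<lambda>x. (chart_map d \<circ> chart_inv ?d) (loc ?c ?d F ((chart_map ?c \<circ> chart_inv c) x))) has_derivative
      (\<lambda>v. to_chart M d (F p) (mdiff N M F p (from_chart N c p v)))) (at (chart_map c p))"
    by (rule has_derivative_compose[OF 1])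
      (use chart_transition_has_derivative(1)[OF M d] inv[OF c] inv[OF c0] in \<open>simp add: o_def\<close>)
  have "openin (mfd_top N) (chart_dom c \<inter> (chart_dom ?c \<inter> F -` chart_dom ?d))"
    using C1_atlas_openin[OF N c(1)] smooth_map_openin[OF N M F c0(1) d0(1)] by blast
  then have "open (chart_map c ` (chart_dom c \<inter> (chart_dom ?c \<inter> F -` chart_dom ?d)))"
    using C1_atlas_open_image[OF N c(1)] by blast
  moreover have "chart_map c p \<in> chart_map c ` (chart_dom c \<inter> (chart_dom ?c \<inter> F -` chart_dom ?d))"
    using c(2) c0(2) d0(2) by simp
  moreover have "(chart_map d \<circ> chart_inv ?d) (loc ?c ?d F ((chart_map ?c \<circ> chart_inv c) x)) = loc c d F x"
    if "x \<in> chart_map c ` (chart_dom c \<inter> (chart_dom ?c \<inter> F -` chart_dom ?d))" for x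
    using that inv[OF c0(1)] inv[OF c(1)] chart_inv_map[OF M d0(1)] by (auto simp: o_def)
  ultimately have "(loc c d F has_derivative (\<lambda>v. to_chart M d (F p) (mdiff N M F p (from_chart N c p v))))
      (at (chart_map c p))"
    by (rule has_derivative_transform_within_open[OF 2])
  from fun_cong[OF frechet_derivative_at[OF this], of v] show ?thesis by (rule sym)
qed

section \<open>Product manifolds\<close>

lemma has_derivative_map_prod:
  assumes "(f has_derivative f') (at a)" "(g has_derivative g') (at b)"
  shows "(map_prod f g has_derivative map_prod f' g') (at (a, b))"
proof -
  have "((\<lambda>x. (f (fst x), g (snd x))) has_derivative (\<lambda>v. (f' (fst v), g' (snd v)))) (at (a, b))"
    using assms by (auto intro!: has_derivative_Pair has_derivative_compose[of fst _ _ _ f]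
        has_derivative_compose[of snd _ _ _ g] has_derivative_fst has_derivative_snd)
  then show ?thesis by (simp add: map_prod_def case_prod_beta')
qed

lemma prod_mfd_simps:
  "carrier (prod_mfd M N) = carrier M \<times> carrier N"
  "chart_at (prod_mfd M N) (p, q) = prod_chart (chart_at M p) (chart_at N q)"
  "chart_dom (prod_chart c d) = chart_dom c \<times> chart_dom d"
  "chart_map (prod_chart c d) = map_prod (chart_map c) (chart_map d)"
  by (simp_all add: prod_mfd_def prod_chart_def)

lemma prod_atlasE:
  assumes "e \<in> atlas (prod_mfd M N)"
  obtains c d where "e = prod_chart c d" "c \<in> atlas M" "d \<in> atlas N"
  using assms by (auto simp: prod_mfd_def)

lemma prod_atlasI: "c \<in> atlas M \<Longrightarrow> d \<in> atlas N \<Longrightarrow> prod_chart c d \<in> atlas (prod_mfd M N)"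
  by (auto simp: prod_mfd_def)

lemma chart_inv_prod:
  assumes "C1_atlas M" "C1_atlas N" "c \<in> atlas M" "d \<in> atlas N"
    and "x \<in> chart_map c ` chart_dom c" "y \<in> chart_map d ` chart_dom d"
  shows "chart_inv (prod_chart c d) (x, y) = (chart_inv c x, chart_inv d y)"
proof -
  obtain p q where pq: "p \<in> chart_dom c" "q \<in> chart_dom d" "x = chart_map c p" "y = chart_map d q"
    using assms by auto
  have "inj_on (map_prod (chart_map c) (chart_map d)) (chart_dom c \<times> chart_dom d)"
    by (intro map_prod_inj_on C1_atlas_inj[OF assms(1,3)] C1_atlas_inj[OF assms(2,4)])
  then have "inv_into (chart_dom c \<times> chart_dom d) (map_prod (chart_map c) (chart_map d))
      (map_prod (chart_map c) (chart_map d) (p, q)) = (p, q)"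
    using pq by (intro inv_into_f_f) auto
  then show ?thesis
    using pq chart_inv_map[OF assms(1,3)] chart_inv_map[OF assms(2,4)]
    by (simp add: chart_inv_def[of "prod_chart c d"] prod_mfd_simps)
qed

lemma prod_transition_has_derivative:
  assumes M: "C1_atlas M" and N: "C1_atlas N"
    and c: "c \<in> atlas M" "p \<in> chart_dom c" and c': "c' \<in> atlas M" "p \<in> chart_dom c'"
    and d: "d \<in> atlas N" "q \<in> chart_dom d" and d': "d' \<in> atlas N" "q \<in> chart_dom d'"
    and f: "((chart_map c' \<circ> chart_inv c) has_derivative f) (at (chart_map c p))"
    and g: "((chart_map d' \<circ> chart_inv d) has_derivative g) (at (chart_map d q))"
  shows "((chart_map (prod_chart c' d') \<circ> chart_inv (prod_chart c d)) has_derivative map_prod f g)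
      (at (chart_map (prod_chart c d) (p, q)))"
proof -
  have "open (chart_map c ` (chart_dom c \<inter> chart_dom c') \<times> chart_map d ` (chart_dom d \<inter> chart_dom d'))"
    by (intro open_Times C1_atlas_open_image[OF M c(1)] C1_atlas_open_image[OF N d(1)] openin_Int
        C1_atlas_openin[OF M c(1)] C1_atlas_openin[OF M c'(1)]
        C1_atlas_openin[OF N d(1)] C1_atlas_openin[OF N d'(1)]) auto
  moreover have "(chart_map c p, chart_map d q) \<in>
      chart_map c ` (chart_dom c \<inter> chart_dom c') \<times> chart_map d ` (chart_dom d \<inter> chart_dom d')"
    using c c' d d' by simp
  moreover have "map_prod (chart_map c' \<circ> chart_inv c) (chart_map d' \<circ> chart_inv d) x =
      (chart_map (prod_chart c' d') \<circ> chart_inv (prod_chart c d)) x"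
    if "x \<in> chart_map c ` (chart_dom c \<inter> chart_dom c') \<times> chart_map d ` (chart_dom d \<inter> chart_dom d')" for x
    using that chart_inv_prod[OF M N c(1) d(1)] by (auto simp: prod_mfd_simps)
  ultimately show ?thesis
    unfolding prod_mfd_simps map_prod_simp
    by (rule has_derivative_transform_within_open[OF has_derivative_map_prod[OF f g]])
qed

text \<open>An open set of the product is a union of boxes, and the image of a box is a box of
  images.\<close>

lemma open_map_prod_image:
  assumes V: "openin (prod_topology X Y) V" "V \<subseteq> A \<times> B"
    and f: "\<And>U. openin X U \<Longrightarrow> U \<subseteq> A \<Longrightarrow> open (f ` U)" and g: "\<And>U. openin Y U \<Longrightarrow> U \<subseteq> B \<Longrightarrow> open (g ` U)"
  shows "open (map_prod f g ` V)"
proof (subst open_subopen, intro ballI)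
  fix z assume "z \<in> map_prod f g ` V"
  then obtain p q where pq: "(p, q) \<in> V" "z = (f p, g q)" by auto
  then obtain U W where UW: "openin X U" "openin Y W" "p \<in> U" "q \<in> W" "U \<times> W \<subseteq> V"
    using V(1) unfolding openin_prod_topology_alt by meson
  then have "U \<times> W \<subseteq> A \<times> B" using V(2) by blast
  then have "U \<subseteq> A" "W \<subseteq> B" using UW(3,4) by auto
  then have "open (f ` U \<times> g ` W)" using f g UW by (intro open_Times) auto
  moreover have "z \<in> f ` U \<times> g ` W" using UW pq by auto
  moreover have "f ` U \<times> g ` W \<subseteq> map_prod f g ` V" using UW(5) by (auto simp: image_iff)
  ultimately show "\<exists>T. open T \<and> z \<in> T \<and> T \<subseteq> map_prod f g ` V" by blast
qed

lemma C1_atlas_prod: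
  assumes M: "C1_atlas M" and N: "C1_atlas N"
  shows "C1_atlas (prod_mfd M N)"
  unfolding C1_atlas_def
proof (intro conjI ballI allI impI)
  fix e assume "e \<in> atlas (prod_mfd M N)"
  then obtain c d where e: "e = prod_chart c d" "c \<in> atlas M" "d \<in> atlas N" by (rule prod_atlasE)
  show "openin (mfd_top (prod_mfd M N)) (chart_dom e)"
    using C1_atlas_openin[OF M e(2)] C1_atlas_openin[OF N e(3)]
    by (auto simp: e(1) prod_mfd_def prod_chart_def openin_prod_Times_iff)
  show "inj_on (chart_map e) (chart_dom e)"
    unfolding e(1) prod_mfd_simps by (intro map_prod_inj_on C1_atlas_inj[OF M e(2)] C1_atlas_inj[OF N e(3)])
  fix V assume "openin (mfd_top (prod_mfd M N)) V \<and> V \<subseteq> chart_dom e"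
  then show "open (chart_map e ` V)"
    using open_map_prod_image[OF _ _ C1_atlas_open_image[OF M e(2)] C1_atlas_open_image[OF N e(3)]]
    by (auto simp: e(1) prod_mfd_def prod_chart_def)
next
  fix e e' z assume ee: "e \<in> atlas (prod_mfd M N)" "e' \<in> atlas (prod_mfd M N)" "z \<in> chart_dom e \<inter> chart_dom e'"
  obtain c d where e: "e = prod_chart c d" "c \<in> atlas M" "d \<in> atlas N" using ee(1) by (rule prod_atlasE)
  obtain c' d' where e': "e' = prod_chart c' d'" "c' \<in> atlas M" "d' \<in> atlas N" using ee(2) by (rule prod_atlasE)
  obtain p q where z: "z = (p, q)" "p \<in> chart_dom c" "q \<in> chart_dom d" "p \<in> chart_dom c'" "q \<in> chart_dom d'"
    using ee(3) e e' by (auto simp: prod_mfd_simps)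
  show "(chart_map e' \<circ> chart_inv e) differentiable (at (chart_map e z))"
    unfolding e e' z(1)
    by (rule differentiableI, rule prod_transition_has_derivative[OF M N e(2) z(2) e'(2) z(4) e(3) z(3) e'(3) z(5)
      C1_atlas_differentiable[OF M e(2) e'(2) z(2,4), unfolded frechet_derivative_works]
      C1_atlas_differentiable[OF N e(3) e'(3) z(3,5), unfolded frechet_derivative_works]])
next
  fix z assume "z \<in> carrier (prod_mfd M N)"
  then obtain p q where z: "z = (p, q)" "p \<in> carrier M" "q \<in> carrier N" by (auto simp: prod_mfd_simps)
  show "chart_at (prod_mfd M N) z \<in> atlas (prod_mfd M N)" "z \<in> chart_dom (chart_at (prod_mfd M N) z)"
    using chart_at_atlas[OF M z(2)] chart_at_atlas[OF N z(3)] chart_at_dom[OF M z(2)] chart_at_dom[OF N z(3)]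
    by (auto simp: z(1) prod_mfd_simps prod_atlasI)
qed

lemma from_chart_prod:
  assumes M: "C1_atlas M" and N: "C1_atlas N"
    and c: "c \<in> atlas M" "p \<in> chart_dom c" and d: "d \<in> atlas N" "q \<in> chart_dom d"
  shows "from_chart (prod_mfd M N) (prod_chart c d) (p, q) = map_prod (from_chart M c p) (from_chart N d q)"
proof -
  note p = chart_dom_carrier[OF M c] and q = chart_dom_carrier[OF N d]
  from frechet_derivative_at[OF prod_transition_has_derivative[OF M N c chart_at_atlas[OF M p] chart_at_dom[OF M p]
      d chart_at_atlas[OF N q] chart_at_dom[OF N q] chart_transition_has_derivative(2)[OF M c]
      chart_transition_has_derivative(2)[OF N d]]]
  show ?thesis by (simp add: from_chart_def[of "prod_mfd M N"] prod_mfd_simps)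
qed

lemma mdiff_projections:
  assumes M: "C1_atlas M" and N: "C1_atlas N" and p: "p \<in> carrier M" and q: "q \<in> carrier N"
  shows "mdiff (prod_mfd M N) M fst (p, q) = fst" "mdiff (prod_mfd M N) N snd (p, q) = snd"
proof -
  let ?c = "chart_at M p" and ?d = "chart_at N q"
  note c = chart_at_atlas[OF M p] chart_at_dom[OF M p] and d = chart_at_atlas[OF N q] chart_at_dom[OF N q]
  let ?U = "chart_map ?c ` chart_dom ?c \<times> chart_map ?d ` chart_dom ?d"
  have U: "open ?U"
    using C1_atlas_open_image[OF M c(1) C1_atlas_openin[OF M c(1)]]
      C1_atlas_open_image[OF N d(1) C1_atlas_openin[OF N d(1)]] by (intro open_Times) auto
  have a: "(chart_map ?c p, chart_map ?d q) \<in> ?U" using c d by auto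
  have eq: "loc (prod_chart ?c ?d) ?c fst x = fst x" "loc (prod_chart ?c ?d) ?d snd x = snd x" if "x \<in> ?U" for x
    using that chart_inv_prod[OF M N c(1) d(1)] chart_inv_map[OF M c(1)] chart_inv_map[OF N d(1)] by auto
  have "(loc (prod_chart ?c ?d) ?c fst has_derivative fst) (at (chart_map ?c p, chart_map ?d q))"
    by (rule has_derivative_transform_within_open[OF has_derivative_fst[OF has_derivative_ident] U a])
      (simp add: eq del: o_apply)
  from frechet_derivative_at[OF this]
  show "mdiff (prod_mfd M N) M fst (p, q) = fst" by (simp add: mdiff_def prod_mfd_simps)
  have "(loc (prod_chart ?c ?d) ?d snd has_derivative snd) (at (chart_map ?c p, chart_map ?d q))"
    by (rule has_derivative_transform_within_open[OF has_derivative_snd[OF has_derivative_ident] U a])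
      (simp add: eq del: o_apply)
  from frechet_derivative_at[OF this]
  show "mdiff (prod_mfd M N) N snd (p, q) = snd" by (simp add: mdiff_def prod_mfd_simps)
qed

section \<open>Immersions into Riemannian manifolds\<close>

text \<open>A product rule that needs the family \<open>L y\<close> to be differentiable only on
  each fixed vector. In finite dimension this is enough: expand the argument in
  \<open>Basis\<close>, so that only the coefficients and finitely many fixed vectors are
  differentiated.\<close>

lemma has_derivative_linear_family:
  fixes L :: "'e::real_normed_vector \<Rightarrow> 'a::euclidean_space \<Rightarrow> 'c::real_normed_vector"
  assumes W: "open W" "a \<in> W" and L: "\<And>y. y \<in> W \<Longrightarrow> linear (L y)"
    and L': "\<And>v. ((\<lambda>y. L y v) has_derivative L' v) (at a)"
  shows linear_family_derivative_linear: "linear (\<lambda>v. L' v h)"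
    and "(V has_derivative V') (at a) \<Longrightarrow>
      ((\<lambda>y. L y (V y)) has_derivative (\<lambda>h. L' (V a) h + L a (V' h))) (at a)"
proof -
  have L'eq: "L' v h = (\<Sum>i\<in>Basis. (v \<bullet> i) *\<^sub>R L' i h)" for v h
  proof -
    have "((\<lambda>y. \<Sum>i\<in>Basis. (v \<bullet> i) *\<^sub>R L y i) has_derivative (\<lambda>h. \<Sum>i\<in>Basis. (v \<bullet> i) *\<^sub>R L' i h)) (at a)"
      by (intro has_derivative_sum has_derivative_scaleR_right L')
    from has_derivative_transform_within_open[OF this W linear_expand[OF L, symmetric]]
    have "((\<lambda>y. L y v) has_derivative (\<lambda>h. \<Sum>i\<in>Basis. (v \<bullet> i) *\<^sub>R L' i h)) (at a)" .
    from fun_cong[OF has_derivative_unique[OF L' this]] show ?thesis .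
  qed
  show "linear (\<lambda>v. L' v h)"
  proof (rule linearI)
    show "L' (u + v) h = L' u h + L' v h" for u v
      unfolding L'eq[of "u + v"] L'eq[of u] L'eq[of v]
      by (simp add: inner_add_left scaleR_left_distrib sum.distrib)
    show "L' (r *\<^sub>R v) h = r *\<^sub>R L' v h" for r v
      unfolding L'eq[of "r *\<^sub>R v"] L'eq[of v] by (simp add: scaleR_sum_right)
  qed
  assume V: "(V has_derivative V') (at a)"
  have "((\<lambda>y. \<Sum>i\<in>Basis. (V y \<bullet> i) *\<^sub>R L y i) has_derivative
      (\<lambda>h. \<Sum>i\<in>Basis. (V a \<bullet> i) *\<^sub>R L' i h + (V' h \<bullet> i) *\<^sub>R L a i)) (at a)"
    by (intro has_derivative_sum has_derivative_scaleR has_derivative_inner_left V L')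
  from has_derivative_transform_within_open[OF this W linear_expand[OF L, symmetric]]
  show "((\<lambda>y. L y (V y)) has_derivative (\<lambda>h. L' (V a) h + L a (V' h))) (at a)"
    by (simp add: sum.distrib L'eq[symmetric] linear_expand[OF L[OF W(2)], symmetric])
qed

lemma has_derivative_bilinear_family:
  fixes B :: "'e::real_normed_vector \<Rightarrow> 'a::euclidean_space \<Rightarrow> 'b::euclidean_space \<Rightarrow> 'c::real_normed_vector"
  assumes W: "open W" "a \<in> W" and B: "\<And>y. y \<in> W \<Longrightarrow> bilinear (B y)"
    and B': "\<And>u v. ((\<lambda>y. B y u v) has_derivative B' u v) (at a)"
    and V: "(V has_derivative V') (at a)" and Z: "(Z has_derivative Z') (at a)"
  shows "((\<lambda>y. B y (V y) (Z y)) has_derivative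
      (\<lambda>h. B' (V a) (Z a) h + B a (V a) (Z' h) + B a (V' h) (Z a))) (at a)"
proof -
  have "((\<lambda>y. B y u (Z y)) has_derivative (\<lambda>h. B' u (Z a) h + B a u (Z' h))) (at a)" for u
    by (rule has_derivative_linear_family(2)[OF W _ B' Z]) (use B in \<open>auto simp: bilinear_def\<close>)
  from has_derivative_linear_family(2)[where L = "\<lambda>y u. B y u (Z y)", OF W _ this V]
  show ?thesis using B by (simp add: bilinear_def)
qed

section \<open>Christoffel symbols in charts\<close>

lemma chart_metric_bilinear:
  assumes "C1_atlas M" "c \<in> atlas M" "q \<in> chart_dom c" "pos_def_form (g q)"
  shows "bilinear (chart_metric M g c (chart_map c q))"
proof -
  note l = from_chart_linear[OF assms(1-3)]
  have b: "bilinear (g q)" using assms(4) by (simp add: pos_def_form_def)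
  show ?thesis
    unfolding bilinear_def chart_metric_def chart_inv_map[OF assms(1-3)]
    by (auto intro!: linearI simp: linear_add[OF l] linear_scale[OF l] bilinear_ladd[OF b]
        bilinear_radd[OF b] bilinear_lmul[OF b] bilinear_rmul[OF b])
qed

lemma chart_metric_at:
  "C1_atlas M \<Longrightarrow> p \<in> carrier M \<Longrightarrow>
    chart_metric M g (chart_at M p) (chart_map (chart_at M p) p) u v = g p u v"
  by (simp add: chart_metric_def chart_inv_map[OF _ chart_at_atlas chart_at_dom] to_from_chart_at)

lemma metric_in_chart:
  "C1_atlas M \<Longrightarrow> c \<in> atlas M \<Longrightarrow> q \<in> chart_dom c \<Longrightarrow>
    chart_metric M g c (chart_map c q) (to_chart M c q u) (to_chart M c q v) = g q u v"
  by (simp add: chart_metric_def chart_inv_map to_from_chart)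

text \<open>The derivatives of the metric coefficients serve as \<open>A\<close> in
  \<open>ex1_metric_symmetric\<close>. The hypotheses ask for differentiability at one point, not
  for a smooth metric, so that they can be checked for an induced metric.\<close>

lemma christoffel_properties:
  assumes M: "C1_atlas M" and p: "p \<in> carrier M"
    and pos: "\<And>q. q \<in> chart_dom (chart_at M p) \<Longrightarrow> pos_def_form (g q)"
    and diff: "\<And>v w. (\<lambda>y. chart_metric M g (chart_at M p) y v w) differentiable
        (at (chart_map (chart_at M p) p))"
  shows "bilinear (christoffel M g p)"
    and "christoffel M g p u v = christoffel M g p v u"
    and "frechet_derivative (\<lambda>y. chart_metric M g (chart_at M p) y v w) (at (chart_map (chart_at M p) p)) u
      = g p (christoffel M g p u v) w + g p v (christoffel M g p u w)"
proof -
  let ?c = "chart_at M p"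
  note c = chart_at_atlas[OF M p] chart_at_dom[OF M p]
  let ?A = "\<lambda>v w. frechet_derivative (\<lambda>y. chart_metric M g ?c y v w) (at (chart_map ?c p))"
  have G: "chart_metric M g ?c (chart_map ?c p) = g p"
    using chart_metric_at[OF M p] by (intro ext)
  have W: "open (chart_map ?c ` chart_dom ?c)" "chart_map ?c p \<in> chart_map ?c ` chart_dom ?c"
    using C1_atlas_open_image[OF M c(1) C1_atlas_openin[OF M c(1)]] c by auto
  have A: "((\<lambda>y. chart_metric M g ?c y v w) has_derivative ?A v w) (at (chart_map ?c p))" for v w
    using diff frechet_derivative_works by blast
  have bil: "bilinear (chart_metric M g ?c y)" if "y \<in> chart_map ?c ` chart_dom ?c" for y
    using that chart_metric_bilinear[of M ?c _ g] M c pos by auto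
  have sym: "?A v w = ?A w v" for v w
  proof -
    have eq: "chart_metric M g ?c y v w = chart_metric M g ?c y w v" if "y \<in> chart_map ?c ` chart_dom ?c" for y
      using that pos chart_inv_map[OF M c(1)] by (auto simp: chart_metric_def pos_def_form_def)
    from has_derivative_transform_within_open[OF A W eq]
    show ?thesis by (rule has_derivative_unique[OF _ A])
  qed
  have "linear (\<lambda>u. ?A v w u)" for v w
    using has_derivative_linear[OF A] .
  moreover have "linear (\<lambda>v. ?A v w u)" for w u
    by (rule linear_family_derivative_linear[OF W _ A]) (use bil bilinear_def in blast)
  moreover have "linear (\<lambda>w. ?A v w u)" for v u
    by (rule linear_family_derivative_linear[OF W _ A]) (use bil bilinear_def in blast)
  ultimately have "\<exists>!\<Gamma>. bilinear \<Gamma> \<and> (\<forall>u v. \<Gamma> u v = \<Gamma> v u) \<and>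
      (\<forall>u v w. ?A v w u = g p (\<Gamma> u v) w + g p v (\<Gamma> u w))"
    using sym by (intro ex1_metric_symmetric[of "g p" "\<lambda>u v w. ?A v w u"] pos[OF c(2)]) auto
  from theI'[OF this]
  have "bilinear (christoffel M g p) \<and> (\<forall>u v. christoffel M g p u v = christoffel M g p v u) \<and>
      (\<forall>u v w. ?A v w u = g p (christoffel M g p u v) w + g p v (christoffel M g p u w))"
    unfolding christoffel_def Let_def G .
  then show "bilinear (christoffel M g p)"
    and "christoffel M g p u v = christoffel M g p v u"
    and "?A v w u = g p (christoffel M g p u v) w + g p v (christoffel M g p u w)"
    by (iprover)+
qed

lemma riemannian_metric_chart_differentiable:
  assumes "C1_atlas M" "riemannian_metric M g" "c \<in> atlas M" "q \<in> chart_dom c"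
  shows "(\<lambda>y. chart_metric M g c y v w) differentiable (at (chart_map c q))"
proof -
  have "smooth_on (chart_map c ` chart_dom c) (\<lambda>y. chart_metric M g c y v w)"
    using assms(2,3) by (simp add: riemannian_metric_def)
  from smooth_on_has_derivative[OF this imageI[OF assms(4)]] show ?thesis
    by (rule differentiableI)
qed

lemma riemannian_metric_pos_def: "riemannian_metric M g \<Longrightarrow> p \<in> carrier M \<Longrightarrow> pos_def_form (g p)"
  by (simp add: riemannian_metric_def)

lemma riemannian_christoffel:
  assumes M: "C1_atlas M" and g: "riemannian_metric M g" and p: "p \<in> carrier M"
  shows "bilinear (christoffel M g p)"
    and "christoffel M g p u v = christoffel M g p v u"
    and "((\<lambda>y. chart_metric M g (chart_at M p) y v w) has_derivative
      (\<lambda>u. g p (christoffel M g p u v) w + g p v (christoffel M g p u w)))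
      (at (chart_map (chart_at M p) p))"
proof -
  note c = chart_at_atlas[OF M p] chart_at_dom[OF M p]
  note pos = riemannian_metric_pos_def[OF g chart_dom_carrier[OF M c(1)]]
  note diff = riemannian_metric_chart_differentiable[OF M g c]
  note * = christoffel_properties[OF M p pos diff]
  show "bilinear (christoffel M g p)" "christoffel M g p u v = christoffel M g p v u"
    using * by blast+
  show "((\<lambda>y. chart_metric M g (chart_at M p) y v w) has_derivative
      (\<lambda>u. g p (christoffel M g p u v) w + g p v (christoffel M g p u w)))
      (at (chart_map (chart_at M p) p))"
    using diff[of v w] unfolding frechet_derivative_works by (simp add: *(3)[symmetric])
qed

text \<open>Read \<open>C u v w\<close> as the product of \<open>w\<close> with the derivative of
  \<open>v\<close> along \<open>u\<close>: metric compatibility and vanishing torsion determine it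
  from the derivatives \<open>A\<close> of the metric. It is applied both to the ambient derivative
  and to the induced connection.\<close>

lemma koszul_formula:
  fixes A :: "'e \<Rightarrow> 'e \<Rightarrow> 'e \<Rightarrow> real"
  assumes "\<And>u v w. A u v w = C u v w + C u w v" "\<And>u v w. C u v w = C v u w"
  shows "C u v w = (A u v w + A v u w - A w u v) / 2"
  unfolding assms(1) using assms(2)[of v u w] assms(2)[of w u v] assms(2)[of v w u] by simp

lemma mdiff_ident:
  assumes N: "C1_atlas N" and x: "x \<in> carrier N"
  shows "mdiff N N (\<lambda>q. q) x u = u"
proof -
  let ?c = "chart_at N x"
  note c = chart_at_atlas[OF N x] chart_at_dom[OF N x]
  have "((\<lambda>y. loc ?c ?c (\<lambda>q. q) y) has_derivative (\<lambda>v. v)) (at (chart_map ?c x))"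
    by (rule has_derivative_transform_within_open[OF has_derivative_ident, of "chart_map ?c ` chart_dom ?c"])
      (use c chart_inv_map[OF N c(1)] C1_atlas_open_image[OF N c(1) C1_atlas_openin[OF N c(1)]] in auto)
  from fun_cong[OF frechet_derivative_at[OF this], of u]
  show ?thesis by (simp add: mdiff_def o_def)
qed

lemma cov_in_chart:
  assumes N: "C1_atlas N" and x: "x \<in> carrier N"
    and "((\<lambda>y. to_chart N (chart_at N x) (chart_inv (chart_at N x) y) (Y (chart_inv (chart_at N x) y)))
      has_derivative Y') (at (chart_map (chart_at N x) x))"
  shows "cov N h Y x u = Y' u + christoffel N h x u (Y x)"
  using fun_cong[OF frechet_derivative_at[OF assms(3)], of u]
  by (simp add: cov_def cov_along_def Let_def mdiff_ident[OF N x])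

text \<open>In the chart at \<open>x\<close> a coordinate field is constant, so only the Christoffel
  term is left.\<close>

lemma cov_coord_field:
  assumes N: "C1_atlas N" and x: "x \<in> carrier N"
  shows "cov N h (coord_field N x v) x u = christoffel N h x u v"
proof -
  let ?c = "chart_at N x"
  note c = chart_at_atlas[OF N x] chart_at_dom[OF N x]
  let ?f = "\<lambda>y. to_chart N ?c (chart_inv ?c y) (coord_field N x v (chart_inv ?c y))"
  have W: "open (chart_map ?c ` chart_dom ?c)" "chart_map ?c x \<in> chart_map ?c ` chart_dom ?c"
    using C1_atlas_open_image[OF N c(1) C1_atlas_openin[OF N c(1)]] c by auto
  have "(?f has_derivative (\<lambda>_. 0)) (at (chart_map ?c x))"
    by (rule has_derivative_transform_within_open[OF has_derivative_const[of v] W])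
      (use to_from_chart[OF N c(1)] chart_inv_map[OF N c(1)] in \<open>auto simp: coord_field_def\<close>)
  from cov_in_chart[OF N x this] have "cov N h (coord_field N x v) x u = christoffel N h x u (coord_field N x v x)"
    by simp
  then show ?thesis by (simp only: coord_field_def to_from_chart_at[OF N x])
qed

text \<open>\<open>N\<close> is asked to satisfy \<open>C1_atlas\<close> so that a product of
  manifolds can take its place by \<open>C1_atlas_prod\<close>, and the leaves can as well.\<close>

locale riemannian_immersion =
  fixes N :: "('a, 'e::euclidean_space) mfd" and M :: "('b, 'f::euclidean_space) mfd"
    and g :: "('b, 'f) metric" and F :: "'a \<Rightarrow> 'b"
  assumes N: "C1_atlas N" and M: "C1_atlas M" and g: "riemannian_metric M g" and F: "immersion N M F"
begin

definition loc_rep :: "'a \<Rightarrow> 'e \<Rightarrow> 'f" where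
  "loc_rep x = loc (chart_at N x) (chart_at M (F x)) F"

definition loc_dom :: "'a \<Rightarrow> 'e set" where
  "loc_dom x = chart_map (chart_at N x) ` (chart_dom (chart_at N x) \<inter> F -` chart_dom (chart_at M (F x)))"

definition base :: "'a \<Rightarrow> 'e" where
  "base x = chart_map (chart_at N x) x"

definition second_deriv :: "'a \<Rightarrow> 'e \<Rightarrow> 'e \<Rightarrow> 'f" where
  "second_deriv x u v = frechet_derivative (\<lambda>y. frechet_derivative (loc_rep x) (at y) v) (at (base x)) u"

text \<open>The ambient covariant derivative, in the direction \<open>u\<close>, of the image under \<open>F\<close> of the coordinate
  field \<open>v\<close>.\<close>

definition ambient_deriv :: "'a \<Rightarrow> 'e \<Rightarrow> 'e \<Rightarrow> 'f" where
  "ambient_deriv x u v =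
     second_deriv x u v + christoffel M g (F x) (mdiff N M F x u) (mdiff N M F x v)"

lemma smooth: "smooth_map N M F" and inj: "x \<in> carrier N \<Longrightarrow> inj (mdiff N M F x)"
  using F by (auto simp: immersion_def)

lemma F_carrier: "x \<in> carrier N \<Longrightarrow> F x \<in> carrier M"
  by (rule smooth_map_carrier[OF smooth])

lemma mdiff_lin: "x \<in> carrier N \<Longrightarrow> linear (mdiff N M F x)"
  using mdiff_linear[OF N M smooth] .

lemma mdiff_eq: "mdiff N M F x = frechet_derivative (loc_rep x) (at (base x))"
  by (simp add: mdiff_def loc_rep_def base_def)

context
  fixes x assumes x: "x \<in> carrier N"
begin

lemmas chart_N = chart_at_atlas[OF N x] chart_at_dom[OF N x]
lemmas chart_M = chart_at_atlas[OF M F_carrier[OF x]] chart_at_dom[OF M F_carrier[OF x]]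

lemma open_loc_dom: "open (loc_dom x)"
  unfolding loc_dom_def using smooth_map_open_image[OF N M smooth chart_N(1) chart_M(1)] .

lemma base_in_loc_dom: "base x \<in> loc_dom x"
  unfolding loc_dom_def base_def using chart_N chart_M by auto

lemma smooth_loc_rep: "smooth_on (loc_dom x) (loc_rep x)"
  unfolding loc_dom_def loc_rep_def using smooth_map_loc[OF smooth chart_N(1) chart_M(1)] .

lemma loc_rep_base: "loc_rep x (base x) = chart_map (chart_at M (F x)) (F x)"
  by (simp add: loc_rep_def base_def chart_inv_map[OF N chart_N])

lemma loc_rep_has_derivative: "(loc_rep x has_derivative mdiff N M F x) (at (base x))"
  unfolding mdiff_eq by (rule smooth_on_has_derivative[OF smooth_loc_rep base_in_loc_dom])

lemma second_deriv_has_derivative: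
  "((\<lambda>y. frechet_derivative (loc_rep x) (at y) v) has_derivative (\<lambda>u. second_deriv x u v)) (at (base x))"
  unfolding second_deriv_def
  by (rule smooth_on_has_derivative[OF smooth_on_derivative[OF smooth_loc_rep] base_in_loc_dom])

lemma second_deriv_sym: "second_deriv x u v = second_deriv x v u"
  unfolding second_deriv_def
  by (rule second_derivative_symmetric[OF open_loc_dom base_in_loc_dom smooth_loc_rep])

lemma second_deriv_bilinear: "bilinear (second_deriv x)"
proof -
  have "linear (\<lambda>u. second_deriv x u v)" for v
    using has_derivative_linear[OF second_deriv_has_derivative] .
  moreover from this have "linear (\<lambda>v. second_deriv x u v)" for u
    by (subst second_deriv_sym)
  ultimately show ?thesis by (simp add: bilinear_def)
qed

lemma ambient_deriv_sym: "ambient_deriv x u v = ambient_deriv x v u"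
  by (simp add: ambient_deriv_def second_deriv_sym[of u v]
      riemannian_christoffel(2)[OF M g F_carrier[OF x], of "mdiff N M F x u"])

lemma ambient_deriv_bilinear: "bilinear (ambient_deriv x)"
proof -
  note b = second_deriv_bilinear riemannian_christoffel(1)[OF M g F_carrier[OF x]]
    and l = mdiff_lin[OF x]
  show ?thesis
    unfolding bilinear_def ambient_deriv_def
    by (auto intro!: linearI simp: linear_add[OF l] linear_scale[OF l] b[THEN bilinear_ladd]
      b[THEN bilinear_radd] b[THEN bilinear_lmul] b[THEN bilinear_rmul] scaleR_right_distrib)
qed

text \<open>Here \<open>V\<close> and \<open>Z\<close> are the coordinate representations of vector fields along \<open>F\<close>.\<close>

lemma metric_compatible_along:
  assumes V: "(V has_derivative V') (at (base x))" and Z: "(Z has_derivative Z') (at (base x))"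
  shows "((\<lambda>y. chart_metric M g (chart_at M (F x)) (loc_rep x y) (V y) (Z y)) has_derivative
    (\<lambda>u. g (F x) (V' u + christoffel M g (F x) (mdiff N M F x u) (V (base x))) (Z (base x))
       + g (F x) (V (base x)) (Z' u + christoffel M g (F x) (mdiff N M F x u) (Z (base x))))) (at (base x))"
proof -
  let ?d = "chart_at M (F x)"
  let ?G = "chart_metric M g ?d"
  note Fx = F_carrier[OF x]
  have b: "bilinear (g (F x))" using riemannian_metric_pos_def[OF g Fx] by (simp add: pos_def_form_def)
  have bil: "bilinear (?G (loc_rep x y))" if y: "y \<in> loc_dom x" for y
  proof -
    obtain q where q: "q \<in> chart_dom (chart_at N x)" "F q \<in> chart_dom ?d" "y = chart_map (chart_at N x) q"
      using y by (auto simp: loc_dom_def)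
    show ?thesis
      using chart_metric_bilinear[where g = g, OF M chart_M(1) q(2) riemannian_metric_pos_def[OF g chart_dom_carrier[OF M chart_M(1) q(2)]]]
      by (simp add: q(3) loc_rep_def chart_inv_map[OF N chart_N(1) q(1)])
  qed
  have base: "?G (loc_rep x (base x)) u v = g (F x) u v" for u v
    unfolding loc_rep_base using chart_metric_at[OF M Fx] .
  \<comment> \<open>Compatibility in the chart of \<open>M\<close>, composed with
    \<open>loc_rep\<close>: the direction \<open>u\<close> enters through the differential of
    \<open>F\<close>.\<close>
  have B': "((\<lambda>y. ?G (loc_rep x y) v w) has_derivative
      (\<lambda>u. g (F x) (christoffel M g (F x) (mdiff N M F x u) v) w
        + g (F x) v (christoffel M g (F x) (mdiff N M F x u) w))) (at (base x))" for v w
    by (rule has_derivative_compose[OF loc_rep_has_derivative])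
      (use riemannian_christoffel(3)[OF M g Fx] in \<open>simp add: loc_rep_base\<close>)
  show ?thesis
    using has_derivative_bilinear_family[OF open_loc_dom base_in_loc_dom bil B' V Z]
    by (simp add: base bilinear_ladd[OF b] bilinear_radd[OF b] algebra_simps)
qed

lemma loc_rep_deriv:
  assumes "q \<in> chart_dom (chart_at N x)" "F q \<in> chart_dom (chart_at M (F x))"
  shows "frechet_derivative (loc_rep x) (at (chart_map (chart_at N x) q)) v =
    to_chart M (chart_at M (F x)) (F q) (mdiff N M F q (from_chart N (chart_at N x) q v))"
  unfolding loc_rep_def
  by (rule mdiff_in_charts[OF N M smooth chart_N(1) assms(1) chart_M(1) assms(2)])

lemma pullback_chart_metric:
  assumes "y \<in> loc_dom x"
  shows "chart_metric N (pullback_metric N M F g) (chart_at N x) y u v =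
    chart_metric M g (chart_at M (F x)) (loc_rep x y)
      (frechet_derivative (loc_rep x) (at y) u) (frechet_derivative (loc_rep x) (at y) v)"
proof -
  obtain q where q: "q \<in> chart_dom (chart_at N x)" "F q \<in> chart_dom (chart_at M (F x))"
      "y = chart_map (chart_at N x) q"
    using assms by (auto simp: loc_dom_def)
  have "loc_rep x y = chart_map (chart_at M (F x)) (F q)"
    by (simp add: q(3) loc_rep_def chart_inv_map[OF N chart_N(1) q(1)])
  then show ?thesis
    unfolding chart_metric_def[of N] q(3) pullback_metric_def chart_inv_map[OF N chart_N(1) q(1)]
      loc_rep_deriv[OF q(1,2)]
    by (simp add: metric_in_chart[OF M chart_M(1) q(2)])
qed

text \<open>The coefficients of the induced metric are products of two images of coordinate fields,
  so compatibility along \<open>F\<close> applies to these images, whose covariant derivatives are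
  \<open>ambient_deriv\<close>. This also supplies the differentiability required by
  \<open>christoffel_properties\<close>.\<close>

lemma pullback_chart_metric_has_derivative:
  "((\<lambda>y. chart_metric N (pullback_metric N M F g) (chart_at N x) y v w) has_derivative
    (\<lambda>u. g (F x) (ambient_deriv x u v) (mdiff N M F x w)
       + g (F x) (mdiff N M F x v) (ambient_deriv x u w))) (at (base x))"
  by (rule has_derivative_transform_within_open[OF _ open_loc_dom base_in_loc_dom pullback_chart_metric[symmetric]])
    (use metric_compatible_along[OF second_deriv_has_derivative second_deriv_has_derivative, of v w]
      in \<open>simp add: ambient_deriv_def mdiff_eq\<close>)

lemma pullback_pos_def: "pos_def_form (pullback_metric N M F g x)"
proof -
  have p: "pos_def_form (g (F x))" using riemannian_metric_pos_def[OF g F_carrier[OF x]] .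
  then have b: "bilinear (g (F x))" by (simp add: pos_def_form_def)
  note l = mdiff_lin[OF x]
  have "mdiff N M F x u \<noteq> 0" if "u \<noteq> 0" for u
    using inj[OF x] that linear_injective_0[OF l] by blast
  moreover have "bilinear (pullback_metric N M F g x)"
    unfolding bilinear_def pullback_metric_def
    by (auto intro!: linearI simp: linear_add[OF l] linear_scale[OF l] bilinear_ladd[OF b]
        bilinear_radd[OF b] bilinear_lmul[OF b] bilinear_rmul[OF b])
  ultimately show ?thesis
    using p by (auto simp: pos_def_form_def pullback_metric_def)
qed

text \<open>\<open>ambient_deriv\<close> is symmetric and compatible with the induced metric, hence
  its tangential part obeys the Koszul formula. For the warped product this replaces a computation
  of Christoffel symbols.\<close>

lemma koszul_ambient:
  "g (F x) (ambient_deriv x u v) (mdiff N M F x w) =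
    (let A = (\<lambda>u v w. frechet_derivative
        (\<lambda>y. chart_metric N (pullback_metric N M F g) (chart_at N x) y v w) (at (base x)) u)
     in (A u v w + A v u w - A w u v) / 2)"
  unfolding Let_def
proof (rule koszul_formula[where C = "\<lambda>u v w. g (F x) (ambient_deriv x u v) (mdiff N M F x w)"])
  fix u v w
  have "g (F x) a b = g (F x) b a" for a b
    using riemannian_metric_pos_def[OF g F_carrier[OF x]] by (simp add: pos_def_form_def)
  then show "frechet_derivative
        (\<lambda>y. chart_metric N (pullback_metric N M F g) (chart_at N x) y v w) (at (base x)) u =
      g (F x) (ambient_deriv x u v) (mdiff N M F x w) + g (F x) (ambient_deriv x u w) (mdiff N M F x v)"
    using frechet_derivative_at[OF pullback_chart_metric_has_derivative, of v w]
    by (simp add: fun_eq_iff)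
qed (simp add: ambient_deriv_sym)

end

text \<open>The Gauss formula: both products are given by the Koszul formula with the same
  derivatives of the induced metric, so the induced connection is the tangential part of the ambient
  one.\<close>

lemma pullback_christoffel:
  assumes x: "x \<in> carrier N"
  shows "bilinear (christoffel N (pullback_metric N M F g) x)"
    and "g (F x) (mdiff N M F x (christoffel N (pullback_metric N M F g) x u v)) (mdiff N M F x w) =
      g (F x) (ambient_deriv x u v) (mdiff N M F x w)"
proof -
  let ?gN = "pullback_metric N M F g" and ?\<Gamma> = "christoffel N (pullback_metric N M F g) x"
  note pos = pullback_pos_def[OF chart_dom_carrier[OF N chart_N(1)[OF x]]]
  have diff: "(\<lambda>y. chart_metric N ?gN (chart_at N x) y v w) differentiable
      (at (chart_map (chart_at N x) x))" for v w
    using pullback_chart_metric_has_derivative[OF x] unfolding base_def differentiable_def by blast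
  note * = christoffel_properties[OF N x pos diff]
  show "bilinear ?\<Gamma>" by (rule *(1))
  have sym: "g (F x) a b = g (F x) b a" for a b
    using riemannian_metric_pos_def[OF g F_carrier[OF x]] by (simp add: pos_def_form_def)
  have "?gN x (?\<Gamma> u v) w =
    (let A = (\<lambda>u v w. frechet_derivative (\<lambda>y. chart_metric N ?gN (chart_at N x) y v w) (at (base x)) u)
     in (A u v w + A v u w - A w u v) / 2)"
    unfolding Let_def
  proof (rule koszul_formula[where C = "\<lambda>u v w. ?gN x (?\<Gamma> u v) w"])
    fix u v w
    show "frechet_derivative (\<lambda>y. chart_metric N ?gN (chart_at N x) y v w) (at (base x)) u =
       ?gN x (?\<Gamma> u v) w + ?gN x (?\<Gamma> u w) v"
      using *(3) sym by (simp add: base_def pullback_metric_def)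
    show "?gN x (?\<Gamma> u v) w = ?gN x (?\<Gamma> v u) w" by (simp add: *(2)[of u v])
  qed
  then show "g (F x) (mdiff N M F x (?\<Gamma> u v)) (mdiff N M F x w) =
      g (F x) (ambient_deriv x u v) (mdiff N M F x w)"
    unfolding koszul_ambient[OF x] by (simp add: pullback_metric_def)
qed

text \<open>The field differentiated in \<open>sff\<close> is, in fixed charts, the derivative of
  \<open>loc_rep\<close> in a constant direction; its derivative is \<open>second_deriv\<close>, and
  the intrinsic term is a Christoffel term by \<open>cov_coord_field\<close>.\<close>

lemma sff_eq:
  assumes x: "x \<in> carrier N"
  shows "sff N M g F x u v =
    ambient_deriv x u v - mdiff N M F x (christoffel N (pullback_metric N M F g) x u v)"
proof -
  let ?c = "chart_at N x" and ?d = "chart_at M (F x)"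
  let ?f = "\<lambda>y. to_chart M ?d (F (chart_inv ?c y)) (mdiff N M F (chart_inv ?c y)
      (from_chart N ?c (chart_inv ?c y) v))"
  have "frechet_derivative (loc_rep x) (at y) v = ?f y" if "y \<in> loc_dom x" for y
    using that loc_rep_deriv[OF x] chart_inv_map[OF N chart_N(1)[OF x]] by (auto simp: loc_dom_def)
  from has_derivative_transform_within_open[OF second_deriv_has_derivative[OF x] open_loc_dom[OF x]
      base_in_loc_dom[OF x] this]
  have "(?f has_derivative (\<lambda>u. second_deriv x u v)) (at (base x))" .
  from fun_cong[OF frechet_derivative_at[OF this], of u]
  have "frechet_derivative ?f (at (base x)) u = second_deriv x u v" by simp
  then show ?thesis
    unfolding sff_def Let_def cov_coord_field[OF N x] cov_along_def coord_field_def
    by (simp add: ambient_deriv_def base_def to_from_chart_at[OF N x])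
qed

lemma sff_normal:
  assumes x: "x \<in> carrier N"
  shows "g (F x) (sff N M g F x u v) (mdiff N M F x w) = 0"
proof -
  have "bilinear (g (F x))"
    using riemannian_metric_pos_def[OF g F_carrier[OF x]] by (simp add: pos_def_form_def)
  then show ?thesis
    by (simp add: sff_eq[OF x] bilinear_lsub pullback_christoffel(2)[OF x])
qed

lemma sff_bilinear:
  assumes x: "x \<in> carrier N"
  shows "bilinear (sff N M g F x)"
proof -
  note b = ambient_deriv_bilinear[OF x] pullback_christoffel(1)[OF x] and l = mdiff_lin[OF x]
  show ?thesis
    unfolding bilinear_def sff_eq[OF x]
    by (auto intro!: linearI simp: linear_add[OF l] linear_scale[OF l] b[THEN bilinear_ladd]
      b[THEN bilinear_radd] b[THEN bilinear_lmul] b[THEN bilinear_rmul] scaleR_right_diff_distrib)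
qed

end

section \<open>The pointwise inequality\<close>

lemma bilinear_compose_linear:
  assumes B: "bilinear B" and p: "linear p" and q: "linear q"
  shows "bilinear (\<lambda>u v. B (p u) (q v))"
  unfolding bilinear_def
  by (intro conjI allI linearI)
    (simp_all only: linear_add[OF p] linear_add[OF q] linear_scale[OF p] linear_scale[OF q]
      bilinear_ladd[OF B] bilinear_radd[OF B] bilinear_lmul[OF B] bilinear_rmul[OF B])

lemma pos_def_formD:
  assumes "pos_def_form G"
  shows "bilinear G" "G u v = G v u" "u \<noteq> 0 \<Longrightarrow> G u u > 0" "G u u \<ge> 0" "G u u = 0 \<longleftrightarrow> u = 0"
proof -
  show b: "bilinear G" and "G u v = G v u" and p: "u \<noteq> 0 \<Longrightarrow> G u u > 0" for u v
    using assms by (auto simp: pos_def_form_def)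
  have "G 0 0 = 0" using b by (rule bilinear_lzero)
  then show "G u u \<ge> 0" "G u u = 0 \<longleftrightarrow> u = 0" using p[of u] by (cases "u = 0"; simp)+
qed

lemma pos_def_form_eqI:
  assumes "pos_def_form G" "\<And>w. G u w = G v w"
  shows "u = v"
proof -
  have "G (u - v) (u - v) = 0"
    using assms(2) by (simp add: bilinear_lsub[OF pos_def_formD(1)[OF assms(1)]])
  then show ?thesis using pos_def_formD(5)[OF assms(1)] by simp
qed

lemma orthonormal_coefficient:
  assumes G: "pos_def_form G" and B: "finite B" "\<And>u v. u \<in> B \<Longrightarrow> v \<in> B \<Longrightarrow> G u v = (if u = v then 1 else 0)"
    and b: "b \<in> B"
  shows "G (\<Sum>u\<in>B. c u *\<^sub>R u) b = c b"
proof -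
  have l: "linear (\<lambda>u. G u b)" using pos_def_formD(1)[OF G] by (simp add: bilinear_def)
  have "G (\<Sum>u\<in>B. c u *\<^sub>R u) b = (\<Sum>u\<in>B. c u * G u b)"
    by (simp add: linear_sum[OF l] linear_scale[OF l])
  also have "\<dots> = (\<Sum>u\<in>B. if u = b then c b else 0)"
    using B b by (intro sum.cong) auto
  finally show ?thesis using B b by simp
qed

lemma orthonormal_independent:
  assumes G: "pos_def_form G" and B: "finite B" "\<And>u v. u \<in> B \<Longrightarrow> v \<in> B \<Longrightarrow> G u v = (if u = v then 1 else 0)"
  shows "independent B"
proof (rule independent_if_scalars_zero[OF B(1)])
  fix c x assume "(\<Sum>u\<in>B. c u *\<^sub>R u) = 0" "x \<in> B"
  then show "c x = 0"
    using orthonormal_coefficient[OF assms, where b = x and c = c] bilinear_lzero[OF pos_def_formD(1)[OF G], of x]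
    by simp
qed

text \<open>Independence bounds the size of orthonormal sets, so one of maximal size exists. If it
  did not span, a Gram-Schmidt step would enlarge it.\<close>

lemma orthonormal_basis_exists:
  fixes G :: "'e::euclidean_space \<Rightarrow> 'e \<Rightarrow> real"
  assumes G: "pos_def_form G"
  shows "\<exists>B. orthonormal_basis G B"
proof -
  define on where "on B \<longleftrightarrow> finite B \<and> (\<forall>u\<in>B. \<forall>v\<in>B. G u v = (if u = v then 1 else 0))" for B
  have "on {}" by (simp add: on_def)
  moreover have "card B < Suc DIM('e)" if "on B" for B
    using orthonormal_independent[OF G, of B] that independent_card_le[of B] by (auto simp: on_def)
  ultimately obtain B where B: "on B" and max: "\<And>C. on C \<Longrightarrow> card C \<le> card B"
    using ex_has_greatest_nat[of on "{}" card "Suc DIM('e)"] by auto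
  have bil: "bilinear G" and sym: "\<And>u v. G u v = G v u" using pos_def_formD[OF G] by auto
  have fin: "finite B" and B1: "\<And>u v. u \<in> B \<Longrightarrow> v \<in> B \<Longrightarrow> G u v = (if u = v then 1 else 0)"
    using B by (auto simp: on_def)
  have "span B = UNIV"
  proof (rule ccontr)
    assume "span B \<noteq> UNIV"
    then obtain v where v: "v \<notin> span B" by auto
    define w where "w = v - (\<Sum>u\<in>B. G v u *\<^sub>R u)"
    have "w \<noteq> 0"
    proof
      assume "w = 0"
      then have "v = (\<Sum>u\<in>B. G v u *\<^sub>R u)" by (simp add: w_def)
      also have "\<dots> \<in> span B" by (intro span_sum span_scale span_base)
      finally show False using v by blast
    qed
    then have w0: "G w w > 0" using pos_def_formD[OF G] by blast
    have wb: "G w b = 0" if "b \<in> B" for b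
      using orthonormal_coefficient[OF G fin B1 that, of "G v"] by (simp add: w_def bilinear_lsub[OF bil])
    define e where "e = (1 / sqrt (G w w)) *\<^sub>R w"
    have e: "G e e = 1" "\<And>b. b \<in> B \<Longrightarrow> G e b = 0"
      using w0 wb by (auto simp: e_def bilinear_lmul[OF bil] bilinear_rmul[OF bil])
    then have "e \<notin> B" by force
    have "on (insert e B)"
      using e(1) e(2) e(2)[unfolded sym[of e]] fin B1 \<open>e \<notin> B\<close> by (auto simp: on_def)
    then show False using max[of "insert e B"] \<open>e \<notin> B\<close> fin by simp
  qed
  then show ?thesis using fin B1 by (auto simp: orthonormal_basis_def)
qed

lemma orthonormal_expansion:
  assumes G: "pos_def_form G" and B: "orthonormal_basis G B"
  shows "(\<Sum>b\<in>B. G v b *\<^sub>R b) = v"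
proof -
  have fin: "finite B" and B1: "\<And>u v. u \<in> B \<Longrightarrow> v \<in> B \<Longrightarrow> G u v = (if u = v then 1 else 0)"
    and v: "v \<in> span B" using B by (auto simp: orthonormal_basis_def)
  obtain c where c: "v = (\<Sum>b\<in>B. c b *\<^sub>R b)" using v unfolding span_finite[OF fin] by auto
  have "G v b = c b" if "b \<in> B" for b
    unfolding c by (rule orthonormal_coefficient[OF G fin B1 that])
  then show ?thesis using c by simp
qed

context
  fixes G :: "'e::euclidean_space \<Rightarrow> 'e \<Rightarrow> real" and B :: "'e set"
  assumes G: "pos_def_form G" and B: "orthonormal_basis G B"
begin

lemma orthonormal_basis_card: "card B = DIM('e)"
proof -
  have "independent B" using orthonormal_independent[OF G] B by (auto simp: orthonormal_basis_def)
  then show ?thesis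
    using B dim_eq_card[of B UNIV] by (simp add: orthonormal_basis_def)
qed

lemma orthonormal_parseval: "(\<Sum>b\<in>B. G u b * G v b) = G u v"
proof -
  have l: "linear (G u)" using pos_def_formD(1)[OF G] by (simp add: bilinear_def)
  have "G u v = G u (\<Sum>b\<in>B. G v b *\<^sub>R b)" by (simp add: orthonormal_expansion[OF G B])
  then show ?thesis by (simp add: linear_sum[OF l] linear_scale[OF l] mult.commute)
qed

lemma bilinear_zero_on_orthonormal_basis:
  assumes h: "bilinear h" and "\<And>b c. b \<in> B \<Longrightarrow> c \<in> B \<Longrightarrow> h b c = 0"
  shows "h u v = 0"
proof -
  have "h u v = h (\<Sum>b\<in>B. G u b *\<^sub>R b) (\<Sum>b\<in>B. G v b *\<^sub>R b)" by (simp add: orthonormal_expansion[OF G B])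
  also have "\<dots> = 0"
    using assms(2) by (auto simp: bilinear_sum[OF h] bilinear_lmul[OF h] bilinear_rmul[OF h] intro!: sum.neutral)
  finally show ?thesis .
qed

text \<open>Expand one slot in \<open>C\<close>, swap the sums, and collect the expansion in
  \<open>B\<close> in the other slot. This frees the definitions by \<open>some_frame\<close> from
  the frame picked, for vector-valued forms too.\<close>

lemma trace_orthonormal_invariant:
  assumes C: "orthonormal_basis G C" and h: "bilinear h"
  shows "(\<Sum>b\<in>B. h b b) = (\<Sum>c\<in>C. h c c)"
proof -
  have fin: "finite C" using C by (simp add: orthonormal_basis_def)
  have l: "linear (\<lambda>u. h u v)" "linear (h v)" for v using h by (auto simp: bilinear_def)
  have sym: "G b c = G c b" for b c using pos_def_formD(2)[OF G] .
  have "(\<Sum>b\<in>B. h b b) = (\<Sum>b\<in>B. h (\<Sum>c\<in>C. G b c *\<^sub>R c) b)" by (simp add: orthonormal_expansion[OF G C])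
  also have "\<dots> = (\<Sum>b\<in>B. \<Sum>c\<in>C. G b c *\<^sub>R h c b)"
    by (simp add: linear_sum[OF l(1)] linear_scale[OF l(1)])
  also have "\<dots> = (\<Sum>c\<in>C. h c (\<Sum>b\<in>B. G c b *\<^sub>R b))"
    by (subst sum.swap) (simp add: linear_sum[OF l(2)] linear_scale[OF l(2)] sym)
  finally show ?thesis by (simp add: orthonormal_expansion[OF G B])
qed

end

text \<open>With \<open>k\<close> the projection of \<open>h\<close> to the span of the
  \<open>e i\<close>, this is 0 \<le> G (h - k) (h - k). The common squared length \<open>r\<close>
  will be sin^2 \<theta>, so that the normal parts of \<phi>W need not be rescaled.\<close>

lemma bessel_inequality:
  assumes G: "pos_def_form G" and "finite I" and r: "r > 0"
    and e: "\<And>i j. i \<in> I \<Longrightarrow> j \<in> I \<Longrightarrow> G (e i) (e j) = (if i = j then r else 0)"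
  shows "(\<Sum>i\<in>I. (G h (e i))\<^sup>2) \<le> r * G h h"
proof -
  have bil: "bilinear G" and sym: "\<And>u v. G u v = G v u" using pos_def_formD[OF G] by auto
  have l: "linear (\<lambda>u. G u v)" "linear (G v)" for v using bil by (auto simp: bilinear_def)
  define k where "k = (\<Sum>i\<in>I. (G h (e i) / r) *\<^sub>R e i)"
  have hk: "G h k = (\<Sum>i\<in>I. (G h (e i))\<^sup>2) / r"
    by (simp add: k_def linear_sum[OF l(2)] linear_scale[OF l(2)] power2_eq_square sum_divide_distrib)
  have ke: "G k (e j) = G h (e j)" if j: "j \<in> I" for j
  proof -
    have "G k (e j) = (\<Sum>i\<in>I. G h (e i) / r * G (e i) (e j))"
      by (simp add: k_def linear_sum[OF l(1)] linear_scale[OF l(1)])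
    also have "\<dots> = (\<Sum>i\<in>I. if i = j then G h (e j) else 0)"
      using e j r by (intro sum.cong) auto
    finally show ?thesis using j \<open>finite I\<close> by simp
  qed
  have "G k k = (\<Sum>j\<in>I. (G h (e j) / r) * G k (e j))"
    by (subst (2) k_def) (simp add: linear_sum[OF l(2)] linear_scale[OF l(2)])
  also have "\<dots> = G h k" by (simp add: ke hk power2_eq_square sum_divide_distrib)
  finally have kk: "G k k = G h k" .
  have "0 \<le> G (h - k) (h - k)" using pos_def_formD(4)[OF G] .
  also have "\<dots> = G h h - G h k"
    by (simp add: bilinear_lsub[OF bil] bilinear_rsub[OF bil] kk sym[of k h])
  finally show ?thesis using r hk by (simp add: field_simps)
qed

lemma orthonormal_basis_prod:
  fixes gT :: "'a::euclidean_space \<Rightarrow> 'a \<Rightarrow> real" and gF :: "'b::euclidean_space \<Rightarrow> 'b \<Rightarrow> real"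
  assumes gT: "pos_def_form gT" and gF: "pos_def_form gF"
    and G: "\<And>u v. G u v = gT (fst u) (fst v) + gF (snd u) (snd v)"
    and B1: "orthonormal_basis gT B1" and B2: "orthonormal_basis gF B2"
  shows "orthonormal_basis G ((\<lambda>x. (x, 0)) ` B1 \<union> Pair 0 ` B2)"
    and "(\<Sum>b\<in>(\<lambda>x. (x, 0)) ` B1 \<union> Pair 0 ` B2. k b) = (\<Sum>x\<in>B1. k (x, 0)) + (\<Sum>z\<in>B2. k (0, z))"
proof -
  have z: "gT 0 u = 0" "gT u 0 = 0" "gF 0 v = 0" "gF v 0 = 0" for u v
    using pos_def_formD(1)[OF gT] pos_def_formD(1)[OF gF] bilinear_lzero bilinear_rzero by blast+
  \<comment> \<open>A basis vector has norm 1, hence is not 0; the two embedded bases are therefore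
    disjoint.\<close>
  have n: "0 \<notin> B1" "0 \<notin> B2" using B1 B2 z(1)[of 0] z(3)[of 0] by (fastforce simp: orthonormal_basis_def)+
  have fin: "finite B1" "finite B2" using B1 B2 by (auto simp: orthonormal_basis_def)
  have "(x, y) \<in> span ((\<lambda>x. (x, 0)) ` B1 \<union> Pair 0 ` B2)" for x y
  proof -
    have l: "linear (\<lambda>x::'a. (x, 0::'b))" "linear (Pair (0::'a) :: 'b \<Rightarrow> _)"
      by (auto intro!: linearI)
    have "(x, 0::'b) \<in> (\<lambda>x. (x, 0)) ` span B1" "(0::'a, y) \<in> Pair 0 ` span B2"
      using B1 B2 by (simp_all add: orthonormal_basis_def)
    then have "(x, 0::'b) \<in> span ((\<lambda>x. (x, 0)) ` B1)" "(0::'a, y) \<in> span (Pair 0 ` B2)"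
      unfolding span_linear_image[OF l(1)] span_linear_image[OF l(2)] .
    then have "(x, 0) + (0, y) \<in> span ((\<lambda>x. (x, 0)) ` B1 \<union> Pair 0 ` B2)"
      by (intro span_add) (meson span_mono subsetD Un_upper1 Un_upper2)+
    then show ?thesis by simp
  qed
  then have "span ((\<lambda>x. (x, 0)) ` B1 \<union> Pair 0 ` B2) = UNIV" by auto
  then show "orthonormal_basis G ((\<lambda>x. (x, 0)) ` B1 \<union> Pair 0 ` B2)"
    using B1 B2 n unfolding orthonormal_basis_def G by (auto simp: z split: if_splits) metis+
  have "((\<lambda>x. (x, 0)) ` B1) \<inter> (Pair 0 ` B2) = {}" using n by auto
  then have "(\<Sum>b\<in>(\<lambda>x. (x, 0)) ` B1 \<union> Pair 0 ` B2. k b)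
      = (\<Sum>b\<in>(\<lambda>x. (x, 0)) ` B1. k b) + (\<Sum>b\<in>Pair 0 ` B2. k b)"
    using fin by (intro sum.union_disjoint) auto
  then show "(\<Sum>b\<in>(\<lambda>x. (x, 0)) ` B1 \<union> Pair 0 ` B2. k b) = (\<Sum>x\<in>B1. k (x, 0)) + (\<Sum>z\<in>B2. k (0, z))"
    by (simp add: sum.reindex inj_on_def)
qed

section \<open>The tangent space at one point\<close>

locale almost_contact_form =
  fixes G :: "'k::euclidean_space \<Rightarrow> 'k \<Rightarrow> real" and \<phi> :: "'k \<Rightarrow> 'k" and \<xi> :: 'k and \<eta> :: "'k \<Rightarrow> real"
  assumes G: "pos_def_form G" and phi: "linear \<phi>" and eta: "linear \<eta>"
    and phi_phi: "\<phi> (\<phi> u) = - u + \<eta> u *\<^sub>R \<xi>" and phi_xi: "\<phi> \<xi> = 0" and eta_phi: "\<eta> (\<phi> u) = 0"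
    and eta_xi: "\<eta> \<xi> = 1" and phi_metric: "G (\<phi> u) (\<phi> v) = G u v - \<eta> u * \<eta> v"
begin

lemma bil: "bilinear G" and sym: "G u v = G v u"
  using pos_def_formD[OF G] by auto

text \<open>Compatibility with v = \<xi>, where the left side vanishes because \<phi> \<xi> =
  0.\<close>

lemma eta_eq: "\<eta> u = G u \<xi>"
  using phi_metric[of u \<xi>] by (simp add: phi_xi bilinear_rzero[OF bil] eta_xi)

text \<open>Compatibility for \<open>u\<close> and \<open>\<phi> v\<close>; the terms with \<eta>
  drop out because \<eta> vanishes on the image of \<phi>.\<close>

lemma phi_skew: "G (\<phi> u) v = - G u (\<phi> v)"
  using phi_metric[of u "\<phi> v"] eta_eq[of "\<phi> u"]
  by (simp add: phi_phi eta_phi bilinear_radd[OF bil] bilinear_rsub[OF bil] bilinear_rneg[OF bil] bilinear_rmul[OF bil])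

lemma phi_self: "G (\<phi> u) u = 0"
  using phi_skew[of u u] sym[of u "\<phi> u"] by simp

end

text \<open>The data at one point of the submanifold: \<open>T\<close> is the differential of the immersion, \<open>h\<close> the
  second fundamental form, \<open>L\<close> the differential of \<open>ln f\<close> and \<open>n\<close> its gradient. The assumption
  \<open>mixed\<close> is what the Kenmotsu identity says about \<open>h\<close>.\<close>

locale semi_slant_point = almost_contact_form G \<phi> \<xi> \<eta>
  for G :: "'k::euclidean_space \<Rightarrow> 'k \<Rightarrow> real" and \<phi> \<xi> \<eta> +
  fixes T :: "'e::euclidean_space \<times> 'f::euclidean_space \<Rightarrow> 'k" and gT :: "'e \<Rightarrow> 'e \<Rightarrow> real"
    and gF :: "'f \<Rightarrow> 'f \<Rightarrow> real" and L :: "'e \<Rightarrow> real" and n \<xi>0 :: 'e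
    and h :: "'e \<times> 'f \<Rightarrow> 'e \<times> 'f \<Rightarrow> 'k" and \<theta> :: real
  assumes T: "linear T" and gT: "pos_def_form gT" and gF: "pos_def_form gF"
    and metric: "G (T u) (T v) = gT (fst u) (fst v) + gF (snd u) (snd v)"
    and h: "bilinear h" and h_sym: "h u v = h v u" and normal: "G (h u v) (T y) = 0"
    and invariant: "\<exists>x'. \<phi> (T (x, 0)) = T (x', 0)"
    and reeb: "\<xi> = T (\<xi>0, 0)"
    and slant: "z \<noteq> 0 \<Longrightarrow> angle_to_subspace G (\<phi> (T (0, z))) (range (\<lambda>z. T (0, z))) = \<theta>"
    and theta: "\<theta> \<noteq> 0"
    and L: "L x = gT n x" and L_reeb: "L \<xi>0 = 1"
    and mixed: "\<phi> (T (x, 0)) = T (x', 0) \<Longrightarrow> G (h (0, z) (x, 0)) (\<phi> (T (0, w))) =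
        (L x - \<eta> (T (x, 0))) * G (\<phi> (T (0, z))) (T (0, w)) - L x' * gF z w"
begin

lemma gT_gF_zero [simp]: "gT 0 x = 0" "gT x 0 = 0" "gF 0 z = 0" "gF z 0 = 0"
  using pos_def_formD(1)[OF gT] pos_def_formD(1)[OF gF] bilinear_lzero bilinear_rzero by blast+

text \<open>The projection of \<phi>Z to the tangent space of the slant leaf, pulled back to the
  model space of that leaf and obtained there as the \<open>gF\<close>-representative of a linear
  functional.\<close>

definition P :: "'f \<Rightarrow> 'f" where
  "P z = (SOME y. \<forall>w. gF y w = G (\<phi> (T (0, z))) (T (0, w)))"

lemma T_snd_linear: "linear (\<lambda>z. T (0, z))"
  using linear_add[OF T, of "(0, _)" "(0, _)"] linear_scale[OF T, of _ "(0, _)"] by (auto intro!: linearI)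

lemma gF_P: "gF (P z) w = G (\<phi> (T (0, z))) (T (0, w))"
proof -
  have "linear (\<lambda>w. G (\<phi> (T (0, z))) (T (0, w)))"
    using linear_compose[OF T_snd_linear, of "G (\<phi> (T (0, z)))"] bil by (simp add: bilinear_def o_def)
  from someI_ex[OF form_representation[OF gF this]] show ?thesis
    unfolding P_def by blast
qed

lemma P_linear: "linear P"
  by (rule linearI; rule pos_def_form_eqI[OF gF])
    (simp_all add: gF_P linear_add[OF T_snd_linear] linear_scale[OF T_snd_linear] linear_add[OF phi]
      linear_scale[OF phi] bilinear_ladd[OF bil] bilinear_lmul[OF bil]
      bilinear_ladd[OF pos_def_formD(1)[OF gF]] bilinear_lmul[OF pos_def_formD(1)[OF gF]])

lemma orth_proj_phi: "orth_proj G (range (\<lambda>z. T (0, z))) (\<phi> (T (0, z))) = T (0, P z)"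
  unfolding orth_proj_def
proof (rule the_equality)
  show "T (0, P z) \<in> range (\<lambda>z. T (0, z)) \<and>
      (\<forall>s\<in>range (\<lambda>z. T (0, z)). G (\<phi> (T (0, z)) - T (0, P z)) s = 0)"
    by (auto simp: bilinear_lsub[OF bil] metric gF_P)
next
  fix y assume y: "y \<in> range (\<lambda>z. T (0, z)) \<and> (\<forall>s\<in>range (\<lambda>z. T (0, z)). G (\<phi> (T (0, z)) - y) s = 0)"
  then obtain v where v: "y = T (0, v)" by auto
  have "gF v w = gF (P z) w" for w
    using y by (auto simp: v bilinear_lsub[OF bil] metric gF_P)
  then show "y = T (0, P z)" using pos_def_form_eqI[OF gF] v by blast
qed

lemma eta_theta: "\<eta> (T (0, z)) = 0"
  by (simp add: eta_eq reeb metric)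

lemma phi_norm: "G (\<phi> (T (0, z))) (\<phi> (T (0, z))) = gF z z"
  by (simp add: phi_metric eta_theta metric)

definition Q :: "'f \<Rightarrow> 'k" where "Q z = \<phi> (T (0, z)) - T (0, P z)"

lemma Q_normal: "G (Q z) (T (0, w)) = 0"
  by (simp add: Q_def bilinear_lsub[OF bil] metric gF_P)

lemma phi_pythagoras: "gF z z = gF (P z) (P z) + G (Q z) (Q z)"
proof -
  have "\<phi> (T (0, z)) = T (0, P z) + Q z" by (simp add: Q_def)
  then have "gF z z = G (T (0, P z) + Q z) (T (0, P z) + Q z)" using phi_norm by metis
  then show ?thesis
    using Q_normal[of z "P z"] sym[of "Q z" "T (0, P z)"]
    by (simp add: bilinear_ladd[OF bil] bilinear_radd[OF bil] metric)
qed

text \<open>The angle is by definition the arccosine of |PZ| / |Z|. Pythagoras puts this quotient in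
  [0, 1], where the arccosine can be inverted.\<close>

lemma slant_ratio:
  assumes "z \<noteq> 0"
  shows "\<theta> = arccos (sqrt (gF (P z) (P z)) / sqrt (gF z z))"
    and "0 \<le> sqrt (gF (P z) (P z)) / sqrt (gF z z)" "sqrt (gF (P z) (P z)) / sqrt (gF z z) \<le> 1"
proof -
  show "\<theta> = arccos (sqrt (gF (P z) (P z)) / sqrt (gF z z))"
    using slant[OF assms] by (simp add: angle_to_subspace_def orth_proj_phi gnorm_def metric phi_norm)
  have z: "gF z z > 0" and "gF (P z) (P z) \<ge> 0" using pos_def_formD[OF gF] assms by blast+
  then show "0 \<le> sqrt (gF (P z) (P z)) / sqrt (gF z z)" by simp
  have "gF (P z) (P z) \<le> gF z z" using phi_pythagoras[of z] pos_def_formD(4)[OF G, of "Q z"] by simp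
  then show "sqrt (gF (P z) (P z)) / sqrt (gF z z) \<le> 1" using z by simp
qed

lemma P_norm: "gF (P z) (P z) = (cos \<theta>)\<^sup>2 * gF z z"
proof (cases "z = 0")
  case True
  then show ?thesis using linear_0[OF P_linear] by simp
next
  case False
  have z: "gF z z > 0" and p: "gF (P z) (P z) \<ge> 0" using pos_def_formD[OF gF] False by blast+
  have "cos \<theta> = sqrt (gF (P z) (P z)) / sqrt (gF z z)"
    using slant_ratio[OF False] by (metis cos_arccos order_trans zero_le_one neg_le_0_iff_le)
  then have "(cos \<theta>)\<^sup>2 = gF (P z) (P z) / gF z z" using z p by (simp add: power_divide)
  then show ?thesis using z by simp
qed

lemma sin_theta: "sin \<theta> \<noteq> 0"
proof -
  \<comment> \<open>The model space has positive dimension. A single nonzero vector forces \<theta>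
    into [0, \<pi>/2], as an arccosine of a number in [0, 1]; \<theta> \<noteq> 0 then makes the
    sine positive.\<close>
  obtain z :: 'f where "z \<noteq> 0" using nonempty_Basis nonzero_Basis by blast
  note r = slant_ratio[OF this]
  have "0 \<le> \<theta>" "\<theta> \<le> pi / 2"
    using r arccos_le_pi2[OF r(2,3)] arccos_bounded[of "sqrt (gF (P z) (P z)) / sqrt (gF z z)"] by linarith+
  then have "sin \<theta> > 0" using theta pi_gt_zero by (intro sin_gt_zero) linarith+
  then show ?thesis by simp
qed

lemma Q_norm: "G (Q z) (Q z) = (sin \<theta>)\<^sup>2 * gF z z"
  using phi_pythagoras[of z] P_norm[of z] by (simp add: sin_squared_eq algebra_simps)

text \<open>Polarization of \<open>Q_norm\<close>. It shows that \<open>Q\<close> maps an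
  orthonormal basis to orthogonal vectors of squared length sin^2 \<theta>.\<close>

lemma Q_inner: "G (Q z) (Q w) = (sin \<theta>)\<^sup>2 * gF z w"
proof -
  have "linear Q"
    using linear_compose_sub[OF linear_compose[OF T_snd_linear phi] linear_compose[OF P_linear T_snd_linear]]
    by (simp add: Q_def[abs_def] o_def)
  note add = linear_add[OF this]
  have b: "bilinear gF" and s: "gF w z = gF z w" using pos_def_formD[OF gF] by auto
  have "G (Q (z + w)) (Q (z + w)) = (sin \<theta>)\<^sup>2 * gF (z + w) (z + w)" by (rule Q_norm)
  then show ?thesis
    using sym[of "Q w" "Q z"] Q_norm[of z] Q_norm[of w] s
    by (simp add: add bilinear_ladd[OF bil] bilinear_radd[OF bil] bilinear_ladd[OF b] bilinear_radd[OF b] algebra_simps)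
qed

text \<open>Since \<open>h\<close> is normal to the submanifold, pairing it with \<open>Q w\<close>
  is the same as pairing it with \<phi>W, and \<open>mixed\<close> makes this a linear functional of
  \<open>w\<close>. Bessel bounds the norm of that functional.\<close>

lemma mixed_norm_ge:
  assumes z: "gF z z = 1" and x': "\<phi> (T (x, 0)) = T (x', 0)"
  shows "G (h (0, z) (x, 0)) (h (0, z) (x, 0)) \<ge>
    ((L x - \<eta> (T (x, 0)))\<^sup>2 * (cos \<theta>)\<^sup>2 + (L x')\<^sup>2) / (sin \<theta>)\<^sup>2"
proof -
  obtain B where B: "orthonormal_basis gF B" using orthonormal_basis_exists[OF gF] by blast
  let ?h = "h (0, z) (x, 0)" and ?a = "L x - \<eta> (T (x, 0))" and ?b = "L x'"
  \<comment> \<open>The \<open>gF\<close>-representative of the functional. Its two summands are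
    orthogonal because \<phi> is skew, so its squared length has no cross term.\<close>
  define v where "v = ?a *\<^sub>R P z - ?b *\<^sub>R z"
  have b: "bilinear gF" and s: "gF u w = gF w u" for u w using pos_def_formD[OF gF] by auto
  have hQ: "G ?h (Q w) = gF v w" for w
  proof -
    have "G ?h (Q w) = G ?h (\<phi> (T (0, w)))" by (simp add: Q_def bilinear_rsub[OF bil] normal)
    also have "\<dots> = gF v w"
      unfolding mixed[OF x'] by (simp add: v_def gF_P bilinear_lsub[OF b] bilinear_lmul[OF b])
    finally show ?thesis .
  qed
  have "gF (P z) z = 0" by (simp add: gF_P phi_self)
  then have "gF v v = ?a\<^sup>2 * gF (P z) (P z) + ?b\<^sup>2"
    using z s[of z "P z"]
    by (simp add: v_def bilinear_lsub[OF b] bilinear_lmul[OF b] bilinear_rsub[OF b] bilinear_rmul[OF b] power2_eq_square)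
  then have vv: "gF v v = ?a\<^sup>2 * (cos \<theta>)\<^sup>2 + ?b\<^sup>2" by (simp add: P_norm z)
  have "(\<Sum>w\<in>B. (G ?h (Q w))\<^sup>2) \<le> (sin \<theta>)\<^sup>2 * G ?h ?h"
    using B sin_theta by (intro bessel_inequality[OF G]) (auto simp: orthonormal_basis_def Q_inner)
  moreover have "(\<Sum>w\<in>B. (G ?h (Q w))\<^sup>2) = gF v v"
    unfolding hQ using orthonormal_parseval[OF gF B, of v v] by (simp add: power2_eq_square)
  ultimately show ?thesis using sin_theta by (simp add: vv divide_le_eq mult.commute)
qed

text \<open>The functional is represented by \<open>n - \<xi>0\<close>, and Parseval gives its
  squared length |n|^2 - 2 + 1, because both \<open>gT n \<xi>0\<close> and
  \<open>gT \<xi>0 \<xi>0\<close> equal 1.\<close>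

lemma sum_eta:
  assumes B: "orthonormal_basis gT B"
  shows "(\<Sum>x\<in>B. (L x - \<eta> (T (x, 0)))\<^sup>2) = gT n n - 1"
proof -
  have b: "bilinear gT" and s: "gT u w = gT w u" for u w using pos_def_formD[OF gT] by auto
  have "L x - \<eta> (T (x, 0)) = gT (n - \<xi>0) x" for x
    using s[of x \<xi>0] by (simp add: L eta_eq reeb metric bilinear_lsub[OF b])
  then have "(\<Sum>x\<in>B. (L x - \<eta> (T (x, 0)))\<^sup>2) = gT (n - \<xi>0) (n - \<xi>0)"
    using orthonormal_parseval[OF gT B, of "n - \<xi>0" "n - \<xi>0"] by (simp add: power2_eq_square)
  moreover have "gT n \<xi>0 = 1" "gT \<xi>0 \<xi>0 = 1"
    using L_reeb L eta_xi eta_eq[of \<xi>] by (simp_all add: reeb metric)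
  ultimately show ?thesis using s[of n \<xi>0] by (simp add: bilinear_lsub[OF b] bilinear_rsub[OF b])
qed

text \<open>By skewness the functional is represented by \<open>- J n\<close>, and |J n|^2 = |n|^2 -
  \<eta>(n)^2, where \<eta>(n) is \<open>L \<xi>0\<close>, that is, 1.\<close>

lemma sum_phi:
  assumes B: "orthonormal_basis gT B" and J: "\<And>x. \<phi> (T (x, 0)) = T (J x, 0)"
  shows "(\<Sum>x\<in>B. (L (J x))\<^sup>2) = gT n n - 1"
proof -
  have "L (J x) = - gT (J n) x" for x
    using phi_skew[of "T (n, 0)" "T (x, 0)"] by (simp add: J L metric)
  then have "(\<Sum>x\<in>B. (L (J x))\<^sup>2) = gT (J n) (J n)"
    using orthonormal_parseval[OF gT B, of "J n" "J n"] by (simp add: power2_eq_square)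
  also have "\<dots> = G (\<phi> (T (n, 0))) (\<phi> (T (n, 0)))" by (simp add: J metric)
  also have "\<dots> = gT n n - (gT n \<xi>0)\<^sup>2"
    unfolding phi_metric by (simp add: eta_eq reeb metric power2_eq_square)
  finally show ?thesis using L_reeb L by simp
qed

text \<open>The squared norm is a trace in each slot, so \<open>trace_orthonormal_invariant\<close>,
  used once per slot, replaces the given frame by one adapted to the two factors. Symmetry of
  \<open>h\<close> merges the two mixed blocks.\<close>

lemma norm_decomposition:
  assumes B: "orthonormal_basis (\<lambda>u v. G (T u) (T v)) B"
    and B1: "orthonormal_basis gT B1" and B2: "orthonormal_basis gF B2"
  shows "(\<Sum>u\<in>B. \<Sum>v\<in>B. G (h u v) (h u v)) =
    (\<Sum>x\<in>B1. \<Sum>y\<in>B1. G (h (x, 0) (y, 0)) (h (x, 0) (y, 0))) +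
    2 * (\<Sum>z\<in>B2. \<Sum>x\<in>B1. G (h (0, z) (x, 0)) (h (0, z) (x, 0))) +
    (\<Sum>z\<in>B2. \<Sum>w\<in>B2. G (h (0, z) (0, w)) (h (0, z) (0, w)))"
proof -
  let ?GN = "\<lambda>u v. G (T u) (T v)"
  let ?C = "(\<lambda>x. (x, 0)) ` B1 \<union> Pair 0 ` B2"
  let ?N = "\<lambda>u v. G (h u v) (h u v)"
  have bGN: "bilinear ?GN"
    by (rule bilinear_compose_linear[OF bil T T])
  have GN: "pos_def_form ?GN"
    unfolding pos_def_form_def
  proof (intro conjI allI impI)
    fix u :: "'e \<times> 'f" assume "u \<noteq> 0"
    then have "fst u \<noteq> 0 \<or> snd u \<noteq> 0" by (auto simp: prod_eq_iff)
    then show "?GN u u > 0"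
      using pos_def_formD(3,4)[OF gT, of "fst u"] pos_def_formD(3,4)[OF gF, of "snd u"]
      by (auto simp: metric intro: add_pos_nonneg add_nonneg_pos)
  qed (use bGN sym in auto)
  have C: "orthonormal_basis ?GN ?C" and sumC: "(\<Sum>b\<in>?C. k b) = (\<Sum>x\<in>B1. k (x, 0)) + (\<Sum>z\<in>B2. k (0, z))"
    for k :: "_ \<Rightarrow> real"
    by (rule orthonormal_basis_prod[OF gT gF metric B1 B2])+
  have bN: "bilinear (\<lambda>v w. G (h u v) (h u w))" "bilinear (\<lambda>v w. G (h v u) (h w u))" for u
  proof -
    have l: "linear (h u)" "linear (\<lambda>v. h v u)" using h by (auto simp only: bilinear_def)
    show "bilinear (\<lambda>v w. G (h u v) (h u w))" "bilinear (\<lambda>v w. G (h v u) (h w u))"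
      by (rule bilinear_compose_linear[OF bil l(1) l(1)], rule bilinear_compose_linear[OF bil l(2) l(2)])
  qed
  have "(\<Sum>u\<in>B. \<Sum>v\<in>B. ?N u v) = (\<Sum>u\<in>B. \<Sum>v\<in>?C. ?N u v)"
    by (intro sum.cong refl trace_orthonormal_invariant[OF GN B C bN(1)])
  also have "\<dots> = (\<Sum>v\<in>?C. \<Sum>u\<in>B. ?N u v)" by (rule sum.swap)
  also have "\<dots> = (\<Sum>v\<in>?C. \<Sum>u\<in>?C. ?N u v)"
    by (intro sum.cong refl trace_orthonormal_invariant[OF GN B C bN(2)])
  also have "\<dots> = (\<Sum>u\<in>?C. \<Sum>v\<in>?C. ?N u v)" by (rule sum.swap)
  finally show ?thesis
    using sum.swap[of "\<lambda>x z. ?N (x, 0) (0, z)" B2 B1]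
    by (simp add: sumC sum.distrib h_sym[of "(_, 0)" "(0, _)"])
qed

text \<open>Each of the DIM('f) unit vectors of \<open>B2\<close> contributes at least (csc^2
  \<theta> + cot^2 \<theta>)(|n|^2 - 1) to the mixed block, which is counted twice.\<close>

lemma sqnorm_ge:
  assumes B: "orthonormal_basis (\<lambda>u v. G (T u) (T v)) B"
  defines "c \<equiv> 2 * real DIM('f) * ((1 / sin \<theta>)\<^sup>2 + (cot \<theta>)\<^sup>2) * (gT n n - 1)"
  shows "(\<Sum>u\<in>B. \<Sum>v\<in>B. G (h u v) (h u v)) \<ge> c"
    and "(\<Sum>u\<in>B. \<Sum>v\<in>B. G (h u v) (h u v)) = c \<Longrightarrow> h (x, 0) (y, 0) = 0"
    and "(\<Sum>u\<in>B. \<Sum>v\<in>B. G (h u v) (h u v)) = c \<Longrightarrow> h (0, z) (0, w) = 0"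
proof -
  obtain B1 where B1: "orthonormal_basis gT B1" using orthonormal_basis_exists[OF gT] by blast
  obtain B2 where B2: "orthonormal_basis gF B2" using orthonormal_basis_exists[OF gF] by blast
  have fin: "finite B1" "finite B2" using B1 B2 by (auto simp: orthonormal_basis_def)
  let ?N = "\<lambda>u v. G (h u v) (h u v)"
  let ?TT = "\<Sum>x\<in>B1. \<Sum>y\<in>B1. ?N (x, 0) (y, 0)" and ?FF = "\<Sum>z\<in>B2. \<Sum>w\<in>B2. ?N (0, z) (0, w)"
  let ?FT = "\<Sum>z\<in>B2. \<Sum>x\<in>B1. ?N (0, z) (x, 0)"
  obtain J where J: "\<And>x. \<phi> (T (x, 0)) = T (J x, 0)" using invariant by metis
  have nonneg: "?N u v \<ge> 0" for u v using pos_def_formD(4)[OF G] .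
  have pos: "?TT \<ge> 0" "?FF \<ge> 0" by (intro sum_nonneg nonneg)+
  have "(\<Sum>x\<in>B1. ?N (0, z) (x, 0)) \<ge> ((1 / sin \<theta>)\<^sup>2 + (cot \<theta>)\<^sup>2) * (gT n n - 1)" if z: "z \<in> B2" for z
  proof -
    have "gF z z = 1" using B2 z by (auto simp: orthonormal_basis_def)
    then have "(\<Sum>x\<in>B1. ?N (0, z) (x, 0)) \<ge>
        (\<Sum>x\<in>B1. ((L x - \<eta> (T (x, 0)))\<^sup>2 * (cos \<theta>)\<^sup>2 + (L (J x))\<^sup>2) / (sin \<theta>)\<^sup>2)"
      by (intro sum_mono mixed_norm_ge J)
    also have "(\<Sum>x\<in>B1. ((L x - \<eta> (T (x, 0)))\<^sup>2 * (cos \<theta>)\<^sup>2 + (L (J x))\<^sup>2) / (sin \<theta>)\<^sup>2) =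
        ((gT n n - 1) * (cos \<theta>)\<^sup>2 + (gT n n - 1)) / (sin \<theta>)\<^sup>2"
      by (simp only: sum_divide_distrib[symmetric] sum.distrib sum_distrib_right[symmetric]
          sum_eta[OF B1] sum_phi[OF B1 J])
    also have "\<dots> = ((1 / sin \<theta>)\<^sup>2 + (cot \<theta>)\<^sup>2) * (gT n n - 1)"
      by (simp add: cot_def power_divide add_divide_distrib algebra_simps diff_divide_distrib)
    finally show ?thesis .
  qed
  then have "?FT \<ge> (\<Sum>z\<in>B2. ((1 / sin \<theta>)\<^sup>2 + (cot \<theta>)\<^sup>2) * (gT n n - 1))"
    by (intro sum_mono)
  then have FT: "2 * ?FT \<ge> c" by (simp add: c_def orthonormal_basis_card[OF gF B2])
  note eq = norm_decomposition[OF B B1 B2]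
  show "(\<Sum>u\<in>B. \<Sum>v\<in>B. ?N u v) \<ge> c" using eq pos FT by linarith
  have bT: "bilinear (\<lambda>x y. h (x, 0) (y, 0))" and bF: "bilinear (\<lambda>z w. h (0, z) (0, w))"
    using bilinear_ladd[OF h, of "(_, 0)" "(_, 0)"] bilinear_radd[OF h, of _ "(_, 0)" "(_, 0)"]
      bilinear_lmul[OF h, of _ "(_, 0)"] bilinear_rmul[OF h, of _ _ "(_, 0)"]
      bilinear_ladd[OF h, of "(0, _)" "(0, _)"] bilinear_radd[OF h, of _ "(0, _)" "(0, _)"]
      bilinear_lmul[OF h, of _ "(0, _)"] bilinear_rmul[OF h, of _ _ "(0, _)"]
    by (auto simp: bilinear_def intro!: linearI)
  \<comment> \<open>Twice the mixed block is already at least \<open>c\<close>, which squeezes the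
    two other sums of squares to 0, and with them each of their terms.\<close>
  assume "(\<Sum>u\<in>B. \<Sum>v\<in>B. ?N u v) = c"
  then have 0: "?TT = 0" "?FF = 0" using eq pos FT by linarith+
  have "h (x, 0) (y, 0) = 0" if "x \<in> B1" "y \<in> B1" for x y
  proof -
    have "(\<Sum>y\<in>B1. ?N (x, 0) (y, 0)) = 0"
      using 0(1) that fin nonneg by (subst (asm) sum_nonneg_eq_0_iff) (auto intro: sum_nonneg)
    then have "?N (x, 0) (y, 0) = 0"
      using that fin nonneg by (subst (asm) sum_nonneg_eq_0_iff) auto
    then show ?thesis using pos_def_formD(5)[OF G] by blast
  qed
  then show "h (x, 0) (y, 0) = 0" for x y
    by (rule bilinear_zero_on_orthonormal_basis[OF gT B1 bT])
  have "h (0, z) (0, w) = 0" if "z \<in> B2" "w \<in> B2" for z w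
  proof -
    have "(\<Sum>w\<in>B2. ?N (0, z) (0, w)) = 0"
      using 0(2) that fin nonneg by (subst (asm) sum_nonneg_eq_0_iff) (auto intro: sum_nonneg)
    then have "?N (0, z) (0, w) = 0"
      using that fin nonneg by (subst (asm) sum_nonneg_eq_0_iff) auto
    then show ?thesis using pos_def_formD(5)[OF G] by blast
  qed
  then show "h (0, z) (0, w) = 0" for z w
    by (rule bilinear_zero_on_orthonormal_basis[OF gF B2 bF])
qed

end

section \<open>Leaves of a warped product\<close>

text \<open>An embedding \<open>\<sigma>\<close> of \<open>A\<close> in \<open>N\<close> which is the map \<open>\<iota>\<close>, of constant derivative \<open>j\<close>, between the charts
  \<open>c\<close> of \<open>A\<close> and \<open>E c\<close> of \<open>N\<close>; the leaves of a product are of this form.\<close>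

locale chartwise_affine =
  fixes A :: "('a, 'e::euclidean_space) mfd" and N :: "('n, 'h::euclidean_space) mfd"
    and \<sigma> :: "'a \<Rightarrow> 'n" and E :: "('a, 'e) chart \<Rightarrow> ('n, 'h) chart" and \<iota> j :: "'e \<Rightarrow> 'h"
  assumes A: "C1_atlas A" and N: "C1_atlas N" and cont: "continuous_map (mfd_top A) (mfd_top N) \<sigma>"
    and E_atlas: "c \<in> atlas A \<Longrightarrow> E c \<in> atlas N"
    and E_dom: "c \<in> atlas A \<Longrightarrow> p \<in> chart_dom c \<Longrightarrow> \<sigma> p \<in> chart_dom (E c)"
    and E_map: "c \<in> atlas A \<Longrightarrow> p \<in> chart_dom c \<Longrightarrow> chart_map (E c) (\<sigma> p) = \<iota> (chart_map c p)"
    and E_at: "p \<in> carrier A \<Longrightarrow> chart_at N (\<sigma> p) = E (chart_at A p)"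
    and deriv: "(\<iota> has_derivative j) (at y)" and smooth_iota: "open U \<Longrightarrow> smooth_on U \<iota>"
    and inj_j: "inj j"
begin

lemma sigma_carrier: "p \<in> carrier A \<Longrightarrow> \<sigma> p \<in> carrier N"
  using cont by (auto simp: continuous_map_def)

lemma loc_compose:
  assumes "c \<in> atlas A" "y \<in> chart_map c ` chart_dom c"
  shows "loc c d (\<lambda>p. F (\<sigma> p)) y = loc (E c) d F (\<iota> y)"
proof -
  obtain p where p: "p \<in> chart_dom c" "y = chart_map c p" using assms by auto
  have "chart_inv (E c) (\<iota> y) = \<sigma> p"
    using chart_inv_map[OF N E_atlas[OF assms(1)] E_dom[OF assms(1) p(1)]] E_map[OF assms(1) p(1)] p by simp
  then show ?thesis using p chart_inv_map[OF A assms(1)] by simp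
qed

text \<open>Between the charts \<open>c\<close> and \<open>E c\<close> the map
  \<open>\<sigma>\<close> is \<open>\<iota>\<close>, so every local representative of the composite
  is one of \<open>F\<close> preceded by \<open>\<iota>\<close>.\<close>

lemma immersion_compose:
  assumes M: "C1_atlas M" and F: "immersion N M F"
  shows "immersion A M (\<lambda>p. F (\<sigma> p))"
    and "p \<in> carrier A \<Longrightarrow> mdiff A M (\<lambda>p. F (\<sigma> p)) p u = mdiff N M F (\<sigma> p) (j u)"
proof -
  have sF: "smooth_map N M F" using F by (simp add: immersion_def)
  have cont_F: "continuous_map (mfd_top A) (mfd_top M) (\<lambda>p. F (\<sigma> p))"
    using continuous_map_compose[OF cont, of "mfd_top M" F] sF by (simp add: smooth_map_def o_def)
  have op: "open (chart_map c ` (chart_dom c \<inter> (\<lambda>p. F (\<sigma> p)) -` chart_dom d))"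
    if c: "c \<in> atlas A" and d: "d \<in> atlas M" for c d
  proof -
    have "openin (mfd_top A) {x \<in> carrier A. F (\<sigma> x) \<in> chart_dom d}"
      using openin_continuous_map_preimage[OF cont_F C1_atlas_openin[OF M d]] .
    moreover have "chart_dom c \<inter> (\<lambda>p. F (\<sigma> p)) -` chart_dom d =
        chart_dom c \<inter> {x \<in> carrier A. F (\<sigma> x) \<in> chart_dom d}"
      using chart_dom_carrier[OF A c] by auto
    ultimately show ?thesis
      by (intro C1_atlas_open_image[OF A c]) (auto intro: C1_atlas_openin[OF A c])
  qed
  have smooth: "smooth_map A M (\<lambda>p. F (\<sigma> p))"
    unfolding smooth_map_def
  proof (intro conjI ballI cont_F)
    fix c d assume c: "c \<in> atlas A" and d: "d \<in> atlas M"
    let ?U = "chart_map c ` (chart_dom c \<inter> (\<lambda>p. F (\<sigma> p)) -` chart_dom d)"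
    let ?V = "chart_map (E c) ` (chart_dom (E c) \<inter> F -` chart_dom d)"
    have sub: "\<iota> ` ?U \<subseteq> ?V"
    proof
      fix z assume "z \<in> \<iota> ` ?U"
      then obtain p where p: "p \<in> chart_dom c" "F (\<sigma> p) \<in> chart_dom d" "z = \<iota> (chart_map c p)" by auto
      then have "z = chart_map (E c) (\<sigma> p)" using E_map[OF c p(1)] by simp
      then show "z \<in> ?V" using p E_dom[OF c p(1)] by auto
    qed
    have "smooth_on ?U (\<lambda>y. loc (E c) d F (\<iota> y))"
      by (rule smooth_on_compose[OF op[OF c d] smooth_map_open_image[OF N M sF E_atlas[OF c] d] sub
        smooth_iota[OF op[OF c d]] smooth_map_loc[OF sF E_atlas[OF c] d]])
    then show "smooth_on ?U (loc c d (\<lambda>p. F (\<sigma> p)))"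
      by (rule smooth_on_cong[OF op[OF c d], rotated]) (use loc_compose[OF c, of _ d F] in auto)
  qed
  show mdiff: "mdiff A M (\<lambda>p. F (\<sigma> p)) p u = mdiff N M F (\<sigma> p) (j u)" if p: "p \<in> carrier A" for p u
  proof -
    let ?c = "chart_at A p" and ?d = "chart_at M (F (\<sigma> p))"
    note c = chart_at_atlas[OF A p] chart_at_dom[OF A p]
    have "((\<lambda>y. loc (E ?c) ?d F (\<iota> y)) has_derivative (\<lambda>u. mdiff N M F (\<sigma> p) (j u))) (at (chart_map ?c p))"
      by (rule has_derivative_compose[OF deriv])
        (use mdiff_has_derivative[OF N M sF sigma_carrier[OF p]] in \<open>simp add: E_at[OF p] E_map[OF c] o_def\<close>)
    from has_derivative_transform_within_open[OF this _ _ loc_compose[OF c(1), symmetric],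
        of "chart_map ?c ` chart_dom ?c"]
    have "(loc ?c ?d (\<lambda>p. F (\<sigma> p)) has_derivative (\<lambda>u. mdiff N M F (\<sigma> p) (j u))) (at (chart_map ?c p))"
      using c C1_atlas_open_image[OF A c(1) C1_atlas_openin[OF A c(1)]] by blast
    from fun_cong[OF frechet_derivative_at[OF this], of u] show ?thesis
      by (simp add: mdiff_def)
  qed
  show "immersion A M (\<lambda>p. F (\<sigma> p))"
    unfolding immersion_def
  proof (intro conjI ballI smooth)
    fix p assume p: "p \<in> carrier A"
    have "inj (\<lambda>u. mdiff N M F (\<sigma> p) (j u))"
      using F sigma_carrier[OF p] inj_j inj_compose[of "mdiff N M F (\<sigma> p)" j]
      by (simp add: immersion_def o_def)
    then show "inj (mdiff A M (\<lambda>p. F (\<sigma> p)) p)"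
      using mdiff[OF p] by (simp add: inj_def)
  qed
qed

text \<open>Since \<open>\<iota>\<close> has constant derivative, the second derivative of the
  composite contains no term with a second derivative of \<open>\<iota>\<close>. Hence a leaf and
  the whole submanifold share the same ambient derivative, and only their tangential parts
  differ.\<close>

lemma ambient_deriv_compose:
  assumes "riemannian_immersion N M g F" and p: "p \<in> carrier A"
  shows "riemannian_immersion A M g (\<lambda>p. F (\<sigma> p))"
    and "riemannian_immersion.ambient_deriv A M g (\<lambda>p. F (\<sigma> p)) p u v =
      riemannian_immersion.ambient_deriv N M g F (\<sigma> p) (j u) (j v)"
proof -
  interpret X: riemannian_immersion N M g F by fact
  note imm = immersion_compose[OF X.M X.F]
  show "riemannian_immersion A M g (\<lambda>p. F (\<sigma> p))"
    using A X.M X.g imm(1) by (simp add: riemannian_immersion_def)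
  then interpret S: riemannian_immersion A M g "\<lambda>p. F (\<sigma> p)" .
  note c = chart_at_atlas[OF A p] chart_at_dom[OF A p]
  note sp = sigma_carrier[OF p]
  have rep: "S.loc_rep p y = X.loc_rep (\<sigma> p) (\<iota> y)" if "y \<in> chart_map (chart_at A p) ` chart_dom (chart_at A p)" for y
    unfolding S.loc_rep_def X.loc_rep_def E_at[OF p] using loc_compose[OF c(1) that] .
  have dom: "S.loc_dom p \<subseteq> chart_map (chart_at A p) ` chart_dom (chart_at A p)"
    by (auto simp: S.loc_dom_def)
  have dom2: "\<iota> y \<in> X.loc_dom (\<sigma> p)" if y: "y \<in> S.loc_dom p" for y
  proof -
    obtain q where q: "q \<in> chart_dom (chart_at A p)" "F (\<sigma> q) \<in> chart_dom (chart_at M (F (\<sigma> p)))"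
        "y = chart_map (chart_at A p) q"
      using y by (auto simp: S.loc_dom_def)
    then show ?thesis
      using E_map[OF c(1) q(1)] E_dom[OF c(1) q(1)] unfolding X.loc_dom_def E_at[OF p]
      by (metis IntI image_eqI vimageI)
  qed
  have base: "\<iota> (S.base p) = X.base (\<sigma> p)"
    unfolding S.base_def X.base_def E_at[OF p] E_map[OF c] ..
  have D: "frechet_derivative (S.loc_rep p) (at y) v = frechet_derivative (X.loc_rep (\<sigma> p)) (at (\<iota> y)) (j v)"
    if y: "y \<in> S.loc_dom p" for y v
  proof -
    have "((\<lambda>y. X.loc_rep (\<sigma> p) (\<iota> y)) has_derivative
        (\<lambda>v. frechet_derivative (X.loc_rep (\<sigma> p)) (at (\<iota> y)) (j v))) (at y)"
      by (rule has_derivative_compose[OF deriv smooth_on_has_derivative[OF X.smooth_loc_rep[OF sp] dom2[OF y]]])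
    from has_derivative_transform_within_open[OF this S.open_loc_dom[OF p] y rep[symmetric]]
    have "(S.loc_rep p has_derivative (\<lambda>v. frechet_derivative (X.loc_rep (\<sigma> p)) (at (\<iota> y)) (j v))) (at y)"
      using dom by blast
    from fun_cong[OF frechet_derivative_at[OF this], of v] show ?thesis by simp
  qed
  have "((\<lambda>y. frechet_derivative (X.loc_rep (\<sigma> p)) (at (\<iota> y)) (j v)) has_derivative
      (\<lambda>u. X.second_deriv (\<sigma> p) (j u) (j v))) (at (S.base p))"
    by (rule has_derivative_compose[OF deriv]) (use X.second_deriv_has_derivative[OF sp] in \<open>simp add: base\<close>)
  from has_derivative_transform_within_open[OF this S.open_loc_dom[OF p] S.base_in_loc_dom[OF p] D[symmetric]]
  have "((\<lambda>y. frechet_derivative (S.loc_rep p) (at y) v) has_derivative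
      (\<lambda>u. X.second_deriv (\<sigma> p) (j u) (j v))) (at (S.base p))" .
  from fun_cong[OF frechet_derivative_at[OF this], of u]
  have "S.second_deriv p u v = X.second_deriv (\<sigma> p) (j u) (j v)" by (simp add: S.second_deriv_def)
  then show "S.ambient_deriv p u v = X.ambient_deriv (\<sigma> p) (j u) (j v)"
    by (simp add: S.ambient_deriv_def X.ambient_deriv_def imm(2)[OF p])
qed

end

lemma chartwise_affine_slices:
  assumes A: "C1_atlas A" and B: "C1_atlas B"
  shows "q \<in> carrier B \<Longrightarrow> chartwise_affine A (prod_mfd A B) (\<lambda>p. (p, q))
      (\<lambda>c. prod_chart c (chart_at B q)) (\<lambda>y. (y, chart_map (chart_at B q) q)) (\<lambda>u. (u, 0))"
    and "p \<in> carrier A \<Longrightarrow> chartwise_affine B (prod_mfd A B) (\<lambda>q. (p, q))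
      (\<lambda>c. prod_chart (chart_at A p) c) (\<lambda>y. (chart_map (chart_at A p) p, y)) (\<lambda>u. (0, u))"
proof -
  note P = C1_atlas_prod[OF A B]
  assume q: "q \<in> carrier B"
  show "chartwise_affine A (prod_mfd A B) (\<lambda>p. (p, q))
      (\<lambda>c. prod_chart c (chart_at B q)) (\<lambda>y. (y, chart_map (chart_at B q) q)) (\<lambda>u. (u, 0))"
  proof
    show "continuous_map (mfd_top A) (mfd_top (prod_mfd A B)) (\<lambda>p. (p, q))"
      using q by (auto simp: prod_mfd_def continuous_map_pairwise o_def)
  qed (use A P q chart_at_atlas[OF B q] chart_at_dom[OF B q] in
      \<open>auto simp: prod_mfd_simps inj_def intro!: derivative_eq_intros smooth_on_slice prod_atlasI\<close>)
next
  note P = C1_atlas_prod[OF A B]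
  assume p: "p \<in> carrier A"
  show "chartwise_affine B (prod_mfd A B) (\<lambda>q. (p, q))
      (\<lambda>c. prod_chart (chart_at A p) c) (\<lambda>y. (chart_map (chart_at A p) p, y)) (\<lambda>u. (0, u))"
  proof
    show "continuous_map (mfd_top B) (mfd_top (prod_mfd A B)) (\<lambda>q. (p, q))"
      using p by (auto simp: prod_mfd_def continuous_map_pairwise o_def)
  qed (use B P p chart_at_atlas[OF A p] chart_at_dom[OF A p] in
      \<open>auto simp: prod_mfd_simps inj_def intro!: derivative_eq_intros smooth_on_slice prod_atlasI\<close>)
qed

lemma warped_chart_metric:
  assumes A: "C1_atlas A" and B: "C1_atlas B" and c: "c \<in> atlas A" "p \<in> chart_dom c"
    and d: "d \<in> atlas B" "q \<in> chart_dom d"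
  shows "chart_metric (prod_mfd A B) (warped_metric A gA f B gB) (prod_chart c d) (chart_map c p, chart_map d q) v w =
    chart_metric A gA c (chart_map c p) (fst v) (fst w) +
    (f p)\<^sup>2 * chart_metric B gB d (chart_map d q) (snd v) (snd w)"
proof -
  note pq = chart_dom_carrier[OF A c] chart_dom_carrier[OF B d]
  have "chart_inv (prod_chart c d) (chart_map c p, chart_map d q) = (p, q)"
    using chart_inv_prod[OF A B c(1) d(1)] chart_inv_map[OF A c] chart_inv_map[OF B d] c d by simp
  then show ?thesis
    by (simp add: chart_metric_def warped_metric_def pullback_metric_def from_chart_prod[OF A B c d]
      mdiff_projections[OF A B pq] chart_inv_map[OF A c] chart_inv_map[OF B d])
qed

text \<open>Makes coordinate fields admissible in the Kenmotsu identity. In another chart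
  \<open>c\<close> such a field is the derivative of the transition map in a constant direction,
  evaluated at the transformed point.\<close>

lemma smooth_coord_field:
  assumes M: "smooth_manifold M" and b: "b \<in> carrier M"
  shows "smooth_vector_field_on M (chart_dom (chart_at M b)) (coord_field M b v)"
  unfolding smooth_vector_field_on_def
proof
  note M1 = smooth_manifold_C1_atlas[OF M]
  let ?d = "chart_at M b"
  note d = chart_at_atlas[OF M1 b] chart_at_dom[OF M1 b]
  fix c assume c: "c \<in> atlas M"
  let ?U = "chart_map c ` (chart_dom c \<inter> chart_dom ?d)" and ?V = "chart_map ?d ` (chart_dom ?d \<inter> chart_dom c)"
  have trans: "smooth_on (chart_map c ` (chart_dom c \<inter> chart_dom d)) (chart_map d \<circ> chart_inv c)"
    if "c \<in> atlas M" "d \<in> atlas M" for c d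
    using M that by (auto simp: smooth_manifold_def)
  have op: "open (chart_map c ` (chart_dom c \<inter> chart_dom d))" if "c \<in> atlas M" "d \<in> atlas M" for c d
    using that by (intro C1_atlas_open_image[OF M1] openin_Int C1_atlas_openin[OF M1]) auto
  have id: "smooth_map M M (\<lambda>q. q)"
    using trans by (simp add: smooth_map_def vimage_def o_def continuous_map_id[unfolded id_def])
  have "smooth_on ?U (\<lambda>y. frechet_derivative (chart_map c \<circ> chart_inv ?d) (at ((chart_map ?d \<circ> chart_inv c) y)) v)"
    by (rule smooth_on_compose[OF op[OF c d(1)] op[OF d(1) c] _ trans[OF c d(1)]
          smooth_on_derivative[OF trans[OF d(1) c]]])
      (use chart_inv_map[OF M1 c] in auto)
  then show "smooth_on ?U (\<lambda>y. to_chart M c (chart_inv c y) (coord_field M b v (chart_inv c y)))"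
  proof (rule smooth_on_cong[OF op[OF c d(1)], rotated])
    fix y assume "y \<in> ?U"
    then obtain q where q: "q \<in> chart_dom c" "q \<in> chart_dom ?d" "y = chart_map c q" by auto
    have "frechet_derivative (loc ?d c (\<lambda>q. q)) (at (chart_map ?d q)) v = to_chart M c q (from_chart M ?d q v)"
      using mdiff_in_charts[OF M1 M1 id d(1) q(2) c q(1)]
        mdiff_ident[OF M1 chart_dom_carrier[OF M1 c q(1)]] by simp
    then show "frechet_derivative (chart_map c \<circ> chart_inv ?d) (at ((chart_map ?d \<circ> chart_inv c) y)) v =
        to_chart M c (chart_inv c y) (coord_field M b v (chart_inv c y))"
      by (simp add: q(3) chart_inv_map[OF M1 c q(1)] coord_field_def o_def)
  qed
qed

section \<open>Kenmotsu manifolds\<close>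

locale kenmotsu =
  fixes M :: "('m, 'k::euclidean_space) mfd"
    and \<phi> :: "'m \<Rightarrow> 'k \<Rightarrow> 'k" and \<xi> :: "'m \<Rightarrow> 'k" and \<eta> :: "'m \<Rightarrow> 'k \<Rightarrow> real" and g :: "('m, 'k) metric"
  assumes kenmotsu: "kenmotsu_manifold M \<phi> \<xi> \<eta> g"
begin

lemma smooth_M: "smooth_manifold M" and g: "riemannian_metric M g"
  and smooth_phi: "smooth_endomorphism M \<phi>" and smooth_xi: "smooth_vector_field_on M (carrier M) \<xi>"
  using kenmotsu by (simp_all add: kenmotsu_manifold_def almost_contact_metric_manifold_def)

lemma M: "C1_atlas M"
  using smooth_manifold_C1_atlas[OF smooth_M] .

lemma contact_form:
  assumes "b \<in> carrier M"
  shows "almost_contact_form (g b) (\<phi> b) (\<xi> b) (\<eta> b)"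
proof -
  have lin: "pos_def_form (g b)" "linear (\<phi> b)" "linear (\<eta> b)"
    using kenmotsu assms
    unfolding kenmotsu_manifold_def almost_contact_metric_manifold_def riemannian_metric_def
      smooth_endomorphism_def smooth_one_form_def by blast+
  have alg: "(\<forall>u. \<phi> b (\<phi> b u) = - u + \<eta> b u *\<^sub>R \<xi> b) \<and>
      \<phi> b (\<xi> b) = 0 \<and> (\<forall>u. \<eta> b (\<phi> b u) = 0) \<and> \<eta> b (\<xi> b) = 1 \<and>
      (\<forall>u v. g b (\<phi> b u) (\<phi> b v) = g b u v - \<eta> b u * \<eta> b v)"
    using kenmotsu assms unfolding kenmotsu_manifold_def almost_contact_metric_manifold_def by blast
  show ?thesis
    by (rule almost_contact_form.intro) (use lin alg in blast)+
qed

lemma kenmotsu_identity: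
  assumes "openin (mfd_top M) U" "smooth_vector_field_on M U X" "smooth_vector_field_on M U Y" "b \<in> U"
  shows "cov M g (\<lambda>q. \<phi> q (Y q)) b (X b) - \<phi> b (cov M g Y b (X b)) =
    g b (\<phi> b (X b)) (Y b) *\<^sub>R \<xi> b - \<eta> b (Y b) *\<^sub>R \<phi> b (X b)"
  using kenmotsu assms unfolding kenmotsu_manifold_def by blast

text \<open>The tensor \<phi> in the fixed chart at \<open>b\<close>, with chart coordinates
  \<open>y\<close> and a constant vector \<open>w\<close>, so that ordinary derivatives in
  \<open>y\<close> make sense.\<close>

definition phi_rep :: "'m \<Rightarrow> 'k \<Rightarrow> 'k \<Rightarrow> 'k" where
  "phi_rep b y w = (let q = chart_inv (chart_at M b) y in
     to_chart M (chart_at M b) q (\<phi> q (coord_field M b w q)))"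

definition xi_rep :: "'m \<Rightarrow> 'k \<Rightarrow> 'k" where
  "xi_rep b y = (let q = chart_inv (chart_at M b) y in to_chart M (chart_at M b) q (\<xi> q))"

context
  fixes b assumes b: "b \<in> carrier M"
begin

lemmas chart_b = chart_at_atlas[OF M b] chart_at_dom[OF M b]

lemma phi_rep_map:
  "q \<in> chart_dom (chart_at M b) \<Longrightarrow> phi_rep b (chart_map (chart_at M b) q) w =
    to_chart M (chart_at M b) q (\<phi> q (from_chart M (chart_at M b) q w))"
  by (simp add: phi_rep_def chart_inv_map[OF M chart_b(1)] coord_field_def)

lemma phi_rep_linear:
  assumes q: "q \<in> chart_dom (chart_at M b)"
  shows "linear (phi_rep b (chart_map (chart_at M b) q))"
proof -
  interpret almost_contact_form "g q" "\<phi> q" "\<xi> q" "\<eta> q"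
    using contact_form[OF chart_dom_carrier[OF M chart_b(1) q]] .
  have "linear (\<lambda>w. to_chart M (chart_at M b) q (\<phi> q (from_chart M (chart_at M b) q w)))"
    using linear_compose[OF linear_compose[OF from_chart_linear[OF M chart_b(1) q] phi]
        to_chart_linear[OF M chart_b(1) q]] by (simp add: o_def)
  moreover have "phi_rep b (chart_map (chart_at M b) q) =
      (\<lambda>w. to_chart M (chart_at M b) q (\<phi> q (from_chart M (chart_at M b) q w)))"
    using phi_rep_map[OF q] by (intro ext)
  ultimately show ?thesis by simp
qed

text \<open>The Kenmotsu identity for two coordinate fields of the chart at \<open>b\<close>: their
  covariant derivatives are Christoffel terms, so what remains is a formula for the ordinary
  derivative of \<phi>.\<close>

lemma phi_rep_has_derivative:
  obtains \<phi>' where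
    "\<And>w. ((\<lambda>y. phi_rep b y w) has_derivative \<phi>' w) (at (chart_map (chart_at M b) b))"
    "\<And>u w. \<phi>' w u + christoffel M g b u (\<phi> b w) =
      \<phi> b (christoffel M g b u w) + g b (\<phi> b u) w *\<^sub>R \<xi> b - \<eta> b w *\<^sub>R \<phi> b u"
proof
  let ?d = "chart_at M b"
  let ?\<phi>' = "\<lambda>w. frechet_derivative (\<lambda>y. phi_rep b y w) (at (chart_map ?d b))"
  have "smooth_on (chart_map ?d ` chart_dom ?d) (\<lambda>y. phi_rep b y w)" for w
    using smooth_phi chart_b(1) by (simp add: smooth_endomorphism_def phi_rep_def coord_field_def Let_def)
  from smooth_on_has_derivative[OF this imageI[OF chart_b(2)]]
  show D: "((\<lambda>y. phi_rep b y w) has_derivative ?\<phi>' w) (at (chart_map ?d b))" for w .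
  have at_b: "coord_field M b w b = w" for w
    by (simp add: coord_field_def to_from_chart_at[OF M b])
  fix u w
  have "cov M g (\<lambda>q. \<phi> q (coord_field M b w q)) b u = ?\<phi>' w u + christoffel M g b u (\<phi> b (coord_field M b w b))"
    by (rule cov_in_chart[OF M b]) (use D[of w] in \<open>simp add: phi_rep_def Let_def\<close>)
  moreover have "cov M g (\<lambda>q. \<phi> q (coord_field M b w q)) b (coord_field M b u b) -
      \<phi> b (cov M g (coord_field M b w) b (coord_field M b u b)) =
    g b (\<phi> b (coord_field M b u b)) (coord_field M b w b) *\<^sub>R \<xi> b -
      \<eta> b (coord_field M b w b) *\<^sub>R \<phi> b (coord_field M b u b)"
    by (rule kenmotsu_identity[OF C1_atlas_openin[OF M chart_b(1)] smooth_coord_field[OF smooth_M b]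
        smooth_coord_field[OF smooth_M b] chart_b(2)])
  ultimately show "?\<phi>' w u + christoffel M g b u (\<phi> b w) =
      \<phi> b (christoffel M g b u w) + g b (\<phi> b u) w *\<^sub>R \<xi> b - \<eta> b w *\<^sub>R \<phi> b u"
    by (simp add: at_b cov_coord_field[OF M b] algebra_simps)
qed

text \<open>Up to its \<open>\<xi>\<close>-component, \<open>\<nabla>\<^sub>u \<xi>\<close> is \<open>u\<close>: apply the Kenmotsu identity to \<open>Y = \<xi>\<close>.\<close>

lemma xi_rep_has_derivative:
  obtains \<xi>' c where
    "(xi_rep b has_derivative \<xi>') (at (chart_map (chart_at M b) b))"
    "\<And>u. \<xi>' u + christoffel M g b u (\<xi> b) = u + c u *\<^sub>R \<xi> b"
proof
  let ?d = "chart_at M b"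
  let ?\<xi>' = "frechet_derivative (xi_rep b) (at (chart_map ?d b))"
  interpret b: almost_contact_form "g b" "\<phi> b" "\<xi> b" "\<eta> b" using contact_form[OF b] .
  have sub: "chart_dom ?d \<subseteq> carrier M" using chart_dom_carrier[OF M chart_b(1)] by blast
  have "smooth_on (chart_map ?d ` (chart_dom ?d \<inter> carrier M)) (xi_rep b)"
    using smooth_xi chart_b(1) by (simp add: smooth_vector_field_on_def xi_rep_def[abs_def] Let_def)
  then have "(xi_rep b has_derivative ?\<xi>') (at (chart_map ?d b))"
    by (rule smooth_on_has_derivative) (use chart_b b in auto)
  then show D: "(xi_rep b has_derivative ?\<xi>') (at (chart_map ?d b))" .
  have smooth_xi': "smooth_vector_field_on M (chart_dom ?d) \<xi>"
    using smooth_xi sub unfolding smooth_vector_field_on_def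
    by (meson Int_mono image_mono order_refl smooth_on_subset)
  fix u
  have cov_xi: "cov M g \<xi> b u = ?\<xi>' u + christoffel M g b u (\<xi> b)"
    by (rule cov_in_chart[OF M b]) (use D in \<open>simp add: xi_rep_def[abs_def] Let_def\<close>)
  have W: "open (chart_map ?d ` chart_dom ?d)" "chart_map ?d b \<in> chart_map ?d ` chart_dom ?d"
    using C1_atlas_open_image[OF M chart_b(1) C1_atlas_openin[OF M chart_b(1)]] chart_b by auto
  \<comment> \<open>The field \<phi>\<xi> vanishes identically, hence so does its covariant
    derivative, and the Kenmotsu identity reduces to \<phi>(\<nabla>_u \<xi>) = \<phi>u.\<close>
  have "((\<lambda>y. to_chart M ?d (chart_inv ?d y) (\<phi> (chart_inv ?d y) (\<xi> (chart_inv ?d y)))) has_derivative (\<lambda>_. 0))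
      (at (chart_map ?d b))"
  proof (rule has_derivative_transform_within_open[OF has_derivative_const[of 0] W])
    fix y assume "y \<in> chart_map ?d ` chart_dom ?d"
    then obtain q where q: "q \<in> chart_dom ?d" "y = chart_map ?d q" by auto
    interpret q: almost_contact_form "g q" "\<phi> q" "\<xi> q" "\<eta> q"
      using contact_form[OF chart_dom_carrier[OF M chart_b(1) q(1)]] .
    show "0 = to_chart M ?d (chart_inv ?d y) (\<phi> (chart_inv ?d y) (\<xi> (chart_inv ?d y)))"
      by (simp add: q(2) chart_inv_map[OF M chart_b(1) q(1)] q.phi_xi
          linear_0[OF to_chart_linear[OF M chart_b(1) q(1)]])
  qed
  from cov_in_chart[OF M b this]
  have "cov M g (\<lambda>q. \<phi> q (\<xi> q)) b u = 0"
    by (simp add: b.phi_xi bilinear_rzero[OF riemannian_christoffel(1)[OF M g b]])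
  moreover have "cov M g (\<lambda>q. \<phi> q (\<xi> q)) b (coord_field M b u b) - \<phi> b (cov M g \<xi> b (coord_field M b u b)) =
    g b (\<phi> b (coord_field M b u b)) (\<xi> b) *\<^sub>R \<xi> b - \<eta> b (\<xi> b) *\<^sub>R \<phi> b (coord_field M b u b)"
    by (rule kenmotsu_identity[OF C1_atlas_openin[OF M chart_b(1)] smooth_coord_field[OF smooth_M b]
        smooth_xi' chart_b(2)])
  moreover have "coord_field M b u b = u" by (simp add: coord_field_def to_from_chart_at[OF M b])
  ultimately have "\<phi> b (cov M g \<xi> b u) = \<phi> b u"
    using b.eta_eq[of "\<phi> b u"] by (simp add: b.eta_phi b.eta_xi)
  then have "\<phi> b (cov M g \<xi> b u - u) = 0" by (simp add: linear_diff[OF b.phi])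
  \<comment> \<open>Applying \<phi> once more determines \<nabla>_u \<xi> up to a multiple of \<xi>.
    That multiple may stay unknown, as it will be paired with vectors orthogonal to \<xi>.\<close>
  then have "- (cov M g \<xi> b u - u) + \<eta> b (cov M g \<xi> b u - u) *\<^sub>R \<xi> b = 0"
    using b.phi_phi[of "cov M g \<xi> b u - u"] linear_0[OF b.phi] by simp
  then show "?\<xi>' u + christoffel M g b u (\<xi> b) = u + \<eta> b (cov M g \<xi> b u - u) *\<^sub>R \<xi> b"
    unfolding cov_xi[symmetric] by (simp add: algebra_simps)
qed

end

end

section \<open>The warped product in the Kenmotsu manifold\<close>

locale kenmotsu_semi_slant = kenmotsu M \<phi> \<xi> \<eta> g
  for M :: "('m, 'k::euclidean_space) mfd" and \<phi> \<xi> \<eta> g +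
  fixes MT :: "('a, 'e::euclidean_space) mfd" and gT :: "('a, 'e) metric" and f :: "'a \<Rightarrow> real"
    and M\<theta> :: "('b, 'f::euclidean_space) mfd" and g\<theta> :: "('b, 'f) metric"
    and F :: "'a \<times> 'b \<Rightarrow> 'm" and \<theta> :: real
  assumes semi_slant: "warped_product_semi_slant M \<phi> \<xi> g MT gT f M\<theta> g\<theta> F \<theta>"
begin

lemma MT: "C1_atlas MT" and M\<theta>: "C1_atlas M\<theta>"
  and gT: "riemannian_metric MT gT" and g\<theta>: "riemannian_metric M\<theta> g\<theta>"
  and smooth_f: "smooth_function MT f" and f_pos: "p \<in> carrier MT \<Longrightarrow> f p > 0"
  and immersion_F: "immersion (prod_mfd MT M\<theta>) M F"
  and isometric: "x \<in> carrier (prod_mfd MT M\<theta>) \<Longrightarrow>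
    pullback_metric (prod_mfd MT M\<theta>) M F g x = warped_metric MT gT f M\<theta> g\<theta> x"
  and invariant_T: "q \<in> carrier M\<theta> \<Longrightarrow> invariant_submanifold MT M \<phi> (\<lambda>p. F (p, q))"
  and tangent_T: "q \<in> carrier M\<theta> \<Longrightarrow> tangent_to MT M \<xi> (\<lambda>p. F (p, q))"
  and slant_\<theta>: "p \<in> carrier MT \<Longrightarrow> proper_slant_submanifold M\<theta> M \<phi> \<xi> g (\<lambda>q. F (p, q)) \<theta>"
  using semi_slant by (auto simp: warped_product_semi_slant_def smooth_manifold_C1_atlas)

sublocale imm: riemannian_immersion "prod_mfd MT M\<theta>" M g F
  using C1_atlas_prod[OF MT M\<theta>] M g immersion_F by unfold_locales

abbreviation "N \<equiv> prod_mfd MT M\<theta>"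

lemmas slice_T = chartwise_affine_slices(1)[OF MT M\<theta>]
lemmas slice_\<theta> = chartwise_affine_slices(2)[OF MT M\<theta>]

lemma carrier_N: "p \<in> carrier MT \<Longrightarrow> q \<in> carrier M\<theta> \<Longrightarrow> (p, q) \<in> carrier N"
  by (simp add: prod_mfd_simps)

lemma mdiff_T: "p \<in> carrier MT \<Longrightarrow> q \<in> carrier M\<theta> \<Longrightarrow> mdiff MT M (\<lambda>p. F (p, q)) p u = mdiff N M F (p, q) (u, 0)"
  using chartwise_affine.immersion_compose(2)[OF slice_T M immersion_F] .

lemma mdiff_\<theta>: "p \<in> carrier MT \<Longrightarrow> q \<in> carrier M\<theta> \<Longrightarrow> mdiff M\<theta> M (\<lambda>q. F (p, q)) q u = mdiff N M F (p, q) (0, u)"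
  using chartwise_affine.immersion_compose(2)[OF slice_\<theta> M immersion_F] .

lemma metric:
  assumes "p \<in> carrier MT" "q \<in> carrier M\<theta>"
  shows "g (F (p, q)) (mdiff N M F (p, q) u) (mdiff N M F (p, q) v) =
    gT p (fst u) (fst v) + (f p)\<^sup>2 * g\<theta> q (snd u) (snd v)"
proof -
  have "pullback_metric N M F g (p, q) u v = warped_metric MT gT f M\<theta> g\<theta> (p, q) u v"
    using isometric[OF carrier_N[OF assms]] by simp
  then show ?thesis
    by (simp add: pullback_metric_def warped_metric_def mdiff_projections[OF MT M\<theta> assms])
qed

lemma phi_mdiff_T:
  assumes "p \<in> carrier MT" "q \<in> carrier M\<theta>"
  shows "\<exists>x'. \<phi> (F (p, q)) (mdiff N M F (p, q) (x, 0)) = mdiff N M F (p, q) (x', 0)"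
proof -
  have "\<phi> (F (p, q)) (mdiff MT M (\<lambda>p. F (p, q)) p x) \<in> range (mdiff MT M (\<lambda>p. F (p, q)) p)"
    using invariant_T[OF assms(2)] assms(1) unfolding invariant_submanifold_def by blast
  then show ?thesis using mdiff_T[OF assms] by (metis rangeE)
qed

lemma xi_mdiff_T:
  assumes "p \<in> carrier MT" "q \<in> carrier M\<theta>"
  shows "\<exists>x'. \<xi> (F (p, q)) = mdiff N M F (p, q) (x', 0)"
proof -
  have "\<xi> (F (p, q)) \<in> range (mdiff MT M (\<lambda>p. F (p, q)) p)"
    using tangent_T[OF assms(2)] assms(1) unfolding tangent_to_def by blast
  then show ?thesis using mdiff_T[OF assms] by (metis rangeE)
qed

context
  fixes p q assumes p: "p \<in> carrier MT" and q: "q \<in> carrier M\<theta>"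
begin

lemmas chart_T = chart_at_atlas[OF MT p] chart_at_dom[OF MT p]
text \<open>With the derivative of f written as f times that of ln f, the product rule for f^2
  yields the term 2 X(ln f) f^2 \<open>g\<theta>\<close> of the warped metric.\<close>

lemma f_has_derivative:
  "((\<lambda>y. f (chart_inv (chart_at MT p) y)) has_derivative (\<lambda>u. f p * fun_diff MT (\<lambda>x. ln (f x)) p u)) (at (chart_map (chart_at MT p) p))"
  and L_linear: "linear (fun_diff MT (\<lambda>x. ln (f x)) p)"
proof -
  let ?c = "chart_at MT p"
  have "smooth_on (chart_map ?c ` chart_dom ?c) (f \<circ> chart_inv ?c)"
    using smooth_f chart_T(1) by (simp add: smooth_function_def)
  from smooth_on_has_derivative[OF this imageI[OF chart_T(2)]]
  obtain f' where f': "((\<lambda>y. f (chart_inv ?c y)) has_derivative f') (at (chart_map ?c p))"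
    by (auto simp: o_def)
  have fp: "f (chart_inv ?c (chart_map ?c p)) = f p"
    using chart_inv_map[OF MT chart_T] by simp
  have ln: "((\<lambda>y. ln (f (chart_inv ?c y))) has_derivative (\<lambda>u. f' u * inverse (f p))) (at (chart_map ?c p))"
    using has_derivative_ln[OF _ f'] f_pos[OF p] by (simp add: fp)
  from frechet_derivative_at[OF this] have L: "fun_diff MT (\<lambda>x. ln (f x)) p u = f' u * inverse (f p)" for u
    by (simp add: fun_diff_def o_def fun_eq_iff)
  have "f' = (\<lambda>u. f p * fun_diff MT (\<lambda>x. ln (f x)) p u)" using f_pos[OF p] by (simp add: L fun_eq_iff)
  then show "((\<lambda>y. f (chart_inv ?c y)) has_derivative (\<lambda>u. f p * fun_diff MT (\<lambda>x. ln (f x)) p u)) (at (chart_map ?c p))"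
    using f' by simp
  show "linear (fun_diff MT (\<lambda>x. ln (f x)) p)" using has_derivative_linear[OF ln] L by (simp add: linear_iff)
qed

lemma pos_def_gT: "pos_def_form (gT p)" and pos_def_g\<theta>: "pos_def_form (g\<theta> q)"
  using riemannian_metric_pos_def[OF gT p] riemannian_metric_pos_def[OF g\<theta> q] .

lemma pos_def_gF: "pos_def_form (\<lambda>u v. (f p)\<^sup>2 * g\<theta> q u v)"
  using pos_def_formD[OF pos_def_g\<theta>] f_pos[OF p] unfolding pos_def_form_def
  by (auto simp: bilinear_def intro: linear_compose_scale_right[where 'b = real, simplified])

lemma zeros:
  "gT p 0 v = 0" "gT p v 0 = 0" "g\<theta> q 0 w = 0" "g\<theta> q w 0 = 0"
  "christoffel MT gT p 0 v = 0" "christoffel MT gT p v 0 = 0"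
  "christoffel M\<theta> g\<theta> q 0 w = 0" "christoffel M\<theta> g\<theta> q w 0 = 0" "fun_diff MT (\<lambda>x. ln (f x)) p 0 = 0"
proof -
  note b = pos_def_formD(1)[OF pos_def_gT] pos_def_formD(1)[OF pos_def_g\<theta>]
    riemannian_christoffel(1)[OF MT gT p] riemannian_christoffel(1)[OF M\<theta> g\<theta> q]
  show "gT p 0 v = 0" "gT p v 0 = 0" "g\<theta> q 0 w = 0" "g\<theta> q w 0 = 0"
    "christoffel MT gT p 0 v = 0" "christoffel MT gT p v 0 = 0"
    "christoffel M\<theta> g\<theta> q 0 w = 0" "christoffel M\<theta> g\<theta> q w 0 = 0"
    by (rule b[THEN bilinear_lzero] b[THEN bilinear_rzero])+
  show "fun_diff MT (\<lambda>x. ln (f x)) p 0 = 0" using linear_0[OF L_linear] .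
qed

end

context
  fixes p q assumes p: "p \<in> carrier MT" and q: "q \<in> carrier M\<theta>"
begin

abbreviation (input) "G \<equiv> g (F (p, q))"
abbreviation (input) "T \<equiv> mdiff N M F (p, q)"
abbreviation (input) "L \<equiv> fun_diff MT (\<lambda>x. ln (f x)) p"
abbreviation (input) "gF u v \<equiv> (f p)\<^sup>2 * g\<theta> q u v"
abbreviation (input) "S \<equiv> imm.ambient_deriv (p, q)"

lemmas x = carrier_N[OF p q]
lemmas Fx = imm.F_carrier[OF x]
lemmas chart_p = chart_at_atlas[OF MT p] chart_at_dom[OF MT p]
lemmas chart_q = chart_at_atlas[OF M\<theta> q] chart_at_dom[OF M\<theta> q]

lemma base_prod: "imm.base (p, q) = (chart_map (chart_at MT p) p, chart_map (chart_at M\<theta> q) q)"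
  by (simp add: imm.base_def prod_mfd_simps)

lemma product_metric_has_derivative:
  "((\<lambda>y. chart_metric N (pullback_metric N M F g) (chart_at N (p, q)) y v w) has_derivative
    (\<lambda>u. gT p (christoffel MT gT p (fst u) (fst v)) (fst w) + gT p (fst v) (christoffel MT gT p (fst u) (fst w)) +
       (2 * L (fst u) * gF (snd v) (snd w) +
        (f p)\<^sup>2 * (g\<theta> q (christoffel M\<theta> g\<theta> q (snd u) (snd v)) (snd w) +
          g\<theta> q (snd v) (christoffel M\<theta> g\<theta> q (snd u) (snd w)))))) (at (imm.base (p, q)))"
proof -
  let ?c = "chart_at MT p" and ?d = "chart_at M\<theta> q"
  let ?a = "(chart_map ?c p, chart_map ?d q)"
  let ?W = "chart_map ?c ` chart_dom ?c \<times> chart_map ?d ` chart_dom ?d"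
  have W: "open ?W" "?a \<in> ?W"
    using C1_atlas_open_image[OF MT chart_p(1) C1_atlas_openin[OF MT chart_p(1)]]
      C1_atlas_open_image[OF M\<theta> chart_q(1) C1_atlas_openin[OF M\<theta> chart_q(1)]] chart_p chart_q
    by (auto intro: open_Times)
  have 1: "((\<lambda>y. chart_metric MT gT ?c (fst y) (fst v) (fst w)) has_derivative
      (\<lambda>u. gT p (christoffel MT gT p (fst u) (fst v)) (fst w) + gT p (fst v) (christoffel MT gT p (fst u) (fst w)))) (at ?a)"
    by (rule has_derivative_compose[OF has_derivative_fst[OF has_derivative_ident]])
      (use riemannian_christoffel(3)[OF MT gT p] in simp)
  have 2: "((\<lambda>y. chart_metric M\<theta> g\<theta> ?d (snd y) (snd v) (snd w)) has_derivative
      (\<lambda>u. g\<theta> q (christoffel M\<theta> g\<theta> q (snd u) (snd v)) (snd w) + g\<theta> q (snd v) (christoffel M\<theta> g\<theta> q (snd u) (snd w)))) (at ?a)"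
    by (rule has_derivative_compose[OF has_derivative_snd[OF has_derivative_ident]])
      (use riemannian_christoffel(3)[OF M\<theta> g\<theta> q] in simp)
  have 3: "((\<lambda>y. f (chart_inv ?c (fst y))) has_derivative (\<lambda>u. f p * L (fst u))) (at ?a)"
    by (rule has_derivative_compose[OF has_derivative_fst[OF has_derivative_ident]])
      (use f_has_derivative[OF p q] in simp)
  note has_derivative_add[OF 1 has_derivative_mult[OF has_derivative_mult[OF 3 3] 2]]
  note 4 = has_derivative_transform_within_open[OF this W]
  show ?thesis
    unfolding base_prod
  proof (rule has_derivative_eq_rhs[OF 4])
    fix y assume "y \<in> ?W"
    then obtain p' q' where y: "p' \<in> chart_dom ?c" "q' \<in> chart_dom ?d" "y = (chart_map ?c p', chart_map ?d q')"
      by auto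
    note pq' = chart_dom_carrier[OF MT chart_p(1) y(1)] chart_dom_carrier[OF M\<theta> chart_q(1) y(2)]
    have "chart_inv (prod_chart ?c ?d) y = (p', q')"
      using y chart_inv_prod[OF MT M\<theta> chart_p(1) chart_q(1)] chart_inv_map[OF MT chart_p(1) y(1)]
        chart_inv_map[OF M\<theta> chart_q(1) y(2)] by simp
    then have "chart_metric N (pullback_metric N M F g) (prod_chart ?c ?d) y v w =
        chart_metric N (warped_metric MT gT f M\<theta> g\<theta>) (prod_chart ?c ?d) y v w"
      by (simp add: chart_metric_def isometric[OF carrier_N[OF pq']])
    then show "chart_metric MT gT ?c (fst y) (fst v) (fst w) +
        f (chart_inv ?c (fst y)) * f (chart_inv ?c (fst y)) * chart_metric M\<theta> g\<theta> ?d (snd y) (snd v) (snd w) =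
        chart_metric N (pullback_metric N M F g) (chart_at N (p, q)) y v w"
      by (simp add: prod_mfd_simps y(3) warped_chart_metric[OF MT M\<theta> chart_p(1) y(1) chart_q(1) y(2)]
        chart_inv_map[OF MT chart_p(1) y(1)] power2_eq_square)
  next
    show "(\<lambda>u. gT p (christoffel MT gT p (fst u) (fst v)) (fst w) + gT p (fst v) (christoffel MT gT p (fst u) (fst w)) +
       (f (chart_inv ?c (fst ?a)) * f (chart_inv ?c (fst ?a)) * (g\<theta> q (christoffel M\<theta> g\<theta> q (snd u) (snd v)) (snd w) +
          g\<theta> q (snd v) (christoffel M\<theta> g\<theta> q (snd u) (snd w))) +
        (f (chart_inv ?c (fst ?a)) * (f p * L (fst u)) + f p * L (fst u) * f (chart_inv ?c (fst ?a))) *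
          chart_metric M\<theta> g\<theta> ?d (snd ?a) (snd v) (snd w))) =
      (\<lambda>u. gT p (christoffel MT gT p (fst u) (fst v)) (fst w) + gT p (fst v) (christoffel MT gT p (fst u) (fst w)) +
       (2 * L (fst u) * gF (snd v) (snd w) +
        (f p)\<^sup>2 * (g\<theta> q (christoffel M\<theta> g\<theta> q (snd u) (snd v)) (snd w) +
          g\<theta> q (snd v) (christoffel M\<theta> g\<theta> q (snd u) (snd w)))))"
      by (simp add: chart_inv_map[OF MT chart_p] chart_metric_at[OF M\<theta> q] power2_eq_square algebra_simps)
  qed
qed

text \<open>In the Koszul formula the Christoffel terms of both factors vanish for these arguments,
  each containing a zero component; what is left comes from the derivative of f^2. The last equation
  says that the leaves of \<open>MT\<close> are totally geodesic in the warped product.\<close>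

lemma
  shows ambient_mixed: "G (S (0, z) (y, 0)) (T w) = L y * gF z (snd w)"
    and ambient_\<theta>: "G (S (0, z) (0, z')) (T (y, 0)) = - L y * gF z z'"
    and ambient_T: "G (S (y, 0) (y', 0)) (T (0, z)) = 0"
proof -
  have A: "frechet_derivative (\<lambda>y. chart_metric N (pullback_metric N M F g) (chart_at N (p, q)) y v w)
      (at (imm.base (p, q))) u =
    gT p (christoffel MT gT p (fst u) (fst v)) (fst w) + gT p (fst v) (christoffel MT gT p (fst u) (fst w)) +
       (2 * L (fst u) * gF (snd v) (snd w) +
        (f p)\<^sup>2 * (g\<theta> q (christoffel M\<theta> g\<theta> q (snd u) (snd v)) (snd w) +
          g\<theta> q (snd v) (christoffel M\<theta> g\<theta> q (snd u) (snd w))))" for u v w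
    using frechet_derivative_at[OF product_metric_has_derivative[where v = v and w = w]]
    by (simp add: fun_eq_iff)
  show "G (S (0, z) (y, 0)) (T w) = L y * gF z (snd w)"
    "G (S (0, z) (0, z')) (T (y, 0)) = - L y * gF z z'"
    "G (S (y, 0) (y', 0)) (T (0, z)) = 0"
    unfolding imm.koszul_ambient[OF x] Let_def A by (simp_all add: zeros[OF p q])
qed


text \<open>Coordinate directions of the two factors stay tangent to the two leaves through every
  nearby point. Invariance and orthogonality thus hold on an open set and can be
  differentiated.\<close>

lemma loc_dom_E:
  assumes "y \<in> imm.loc_dom (p, q)"
  obtains p' q' where "p' \<in> carrier MT" "q' \<in> carrier M\<theta>"
    "F (p', q') \<in> chart_dom (chart_at M (F (p, q)))"
    "imm.loc_rep (p, q) y = chart_map (chart_at M (F (p, q))) (F (p', q'))"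
    "\<And>v. frechet_derivative (imm.loc_rep (p, q)) (at y) (v, 0) =
      to_chart M (chart_at M (F (p, q))) (F (p', q')) (mdiff N M F (p', q') (from_chart MT (chart_at MT p) p' v, 0))"
    "\<And>w. frechet_derivative (imm.loc_rep (p, q)) (at y) (0, w) =
      to_chart M (chart_at M (F (p, q))) (F (p', q')) (mdiff N M F (p', q') (0, from_chart M\<theta> (chart_at M\<theta> q) q' w))"
proof -
  note c = chart_at_atlas[OF MT p] and d = chart_at_atlas[OF M\<theta> q]
  obtain p' q' where pq': "p' \<in> chart_dom (chart_at MT p)" "q' \<in> chart_dom (chart_at M\<theta> q)"
    "F (p', q') \<in> chart_dom (chart_at M (F (p, q)))" "y = chart_map (chart_at N (p, q)) (p', q')"
    using assms by (auto simp: imm.loc_dom_def prod_mfd_simps)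
  have dom: "(p', q') \<in> chart_dom (chart_at N (p, q))" using pq' by (simp add: prod_mfd_simps)
  have from_N: "from_chart N (chart_at N (p, q)) (p', q') (v, w) =
      (from_chart MT (chart_at MT p) p' v, from_chart M\<theta> (chart_at M\<theta> q) q' w)" for v w
    by (simp add: prod_mfd_simps from_chart_prod[OF MT M\<theta> c pq'(1) d pq'(2)])
  have zero: "from_chart MT (chart_at MT p) p' 0 = 0" "from_chart M\<theta> (chart_at M\<theta> q) q' 0 = 0"
    using linear_0[OF from_chart_linear[OF MT c pq'(1)]] linear_0[OF from_chart_linear[OF M\<theta> d pq'(2)]] .
  have rep: "imm.loc_rep (p, q) y = chart_map (chart_at M (F (p, q))) (F (p', q'))"
    unfolding imm.loc_rep_def pq'(4) using chart_inv_map[OF imm.N imm.chart_N(1)[OF x] dom] by simp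
  show ?thesis
  proof (rule that[OF chart_dom_carrier[OF MT c pq'(1)] chart_dom_carrier[OF M\<theta> d pq'(2)] pq'(3) rep])
  qed (simp_all add: pq'(4) imm.loc_rep_deriv[OF x dom pq'(3)] from_N zero)
qed

text \<open>Obtained by differentiating \<open>g (\<phi> X) Z = 0\<close>, for coordinate fields \<open>X\<close> of \<open>MT\<close> and \<open>Z\<close> of
  \<open>M\<theta>\<close>. In this way \<open>\<phi> X\<close> need not be known to be a smooth field.\<close>

lemma phi_along:
  "G (\<phi> (F (p, q)) (S u (v, 0)) + G (\<phi> (F (p, q)) (T u)) (T (v, 0)) *\<^sub>R \<xi> (F (p, q))
      - \<eta> (F (p, q)) (T (v, 0)) *\<^sub>R \<phi> (F (p, q)) (T u)) (T (0, w)) +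
    G (\<phi> (F (p, q)) (T (v, 0))) (S u (0, w)) = 0"
proof -
  let ?b = "F (p, q)"
  let ?d = "chart_at M ?b" and ?D = "frechet_derivative (imm.loc_rep (p, q))"
  let ?\<Gamma> = "christoffel M g ?b"
  interpret b: almost_contact_form "g ?b" "\<phi> ?b" "\<xi> ?b" "\<eta> ?b" using contact_form[OF Fx] .
  note W = imm.open_loc_dom[OF x] imm.base_in_loc_dom[OF x]
  note d = imm.chart_M[OF x]
  obtain \<phi>' where \<phi>': "\<And>w. ((\<lambda>y. phi_rep ?b y w) has_derivative \<phi>' w) (at (chart_map ?d ?b))"
    "\<And>u w. \<phi>' w u + ?\<Gamma> u (\<phi> ?b w) = \<phi> ?b (?\<Gamma> u w) + g ?b (\<phi> ?b u) w *\<^sub>R \<xi> ?b - \<eta> ?b w *\<^sub>R \<phi> ?b u"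
    using phi_rep_has_derivative[OF Fx] by blast
  have phi_base: "phi_rep ?b (chart_map ?d ?b) w = \<phi> ?b w" for w
    by (simp add: phi_rep_map[OF Fx d(2)] to_from_chart_at[OF M Fx])
  have 1: "((\<lambda>y. phi_rep ?b (imm.loc_rep (p, q) y) w) has_derivative (\<lambda>u. \<phi>' w (T u))) (at (imm.base (p, q)))" for w
    by (rule has_derivative_compose[OF imm.loc_rep_has_derivative[OF x]])
      (simp add: imm.loc_rep_base[OF x] \<phi>'(1))
  have lin: "linear (phi_rep ?b (imm.loc_rep (p, q) y))" if y: "y \<in> imm.loc_dom (p, q)" for y
    using loc_dom_E[OF y] phi_rep_linear[OF Fx] by metis
  have 2: "((\<lambda>y. phi_rep ?b (imm.loc_rep (p, q) y) (?D (at y) (v, 0))) has_derivative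
      (\<lambda>u. \<phi>' (T (v, 0)) (T u) + \<phi> ?b (imm.second_deriv (p, q) u (v, 0)))) (at (imm.base (p, q)))"
    using has_derivative_linear_family(2)[OF W lin 1 imm.second_deriv_has_derivative[OF x, of "(v, 0)"]]
    by (simp add: imm.loc_rep_base[OF x] phi_base imm.mdiff_eq)
  note 3 = imm.metric_compatible_along[OF x 2 imm.second_deriv_has_derivative[OF x, of "(0, w)"]]
  \<comment> \<open>Invariance at each nearby point keeps \<phi>X tangent to the leaf of
    \<open>MT\<close>, which is orthogonal to the leaf of \<open>M\<theta>\<close>; a function
    vanishing on an open set has derivative 0.\<close>
  have "chart_metric M g ?d (imm.loc_rep (p, q) y)
      (phi_rep ?b (imm.loc_rep (p, q) y) (?D (at y) (v, 0))) (?D (at y) (0, w)) = 0"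
    if "y \<in> imm.loc_dom (p, q)" for y
  proof (rule loc_dom_E[OF that])
    fix p' q'
    assume p': "p' \<in> carrier MT" and q': "q' \<in> carrier M\<theta>" and dom: "F (p', q') \<in> chart_dom ?d"
      and rep: "imm.loc_rep (p, q) y = chart_map ?d (F (p', q'))"
      and v: "\<And>v. ?D (at y) (v, 0) =
        to_chart M ?d (F (p', q')) (mdiff N M F (p', q') (from_chart MT (chart_at MT p) p' v, 0))"
      and w: "\<And>w. ?D (at y) (0, w) =
        to_chart M ?d (F (p', q')) (mdiff N M F (p', q') (0, from_chart M\<theta> (chart_at M\<theta> q) q' w))"
    obtain v' where "\<phi> (F (p', q')) (mdiff N M F (p', q') (from_chart MT (chart_at MT p) p' v, 0)) =
        mdiff N M F (p', q') (v', 0)"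
      using phi_mdiff_T[OF p' q'] by blast
    then show ?thesis
      unfolding rep v w
      by (simp add: phi_rep_map[OF Fx dom] to_from_chart[OF M d(1) dom] metric_in_chart[OF M d(1) dom]
        metric[OF p' q'] zeros[OF p' q'])
  qed
  from fun_cong[OF has_derivative_unique[OF has_derivative_transform_within_open[OF 3 W this] has_derivative_const], of u]
  have "G (\<phi>' (T (v, 0)) (T u) + \<phi> ?b (imm.second_deriv (p, q) u (v, 0)) + ?\<Gamma> (T u) (\<phi> ?b (T (v, 0)))) (T (0, w)) +
      G (\<phi> ?b (T (v, 0))) (S u (0, w)) = 0"
    by (simp add: imm.mdiff_eq[symmetric] imm.loc_rep_base[OF x] phi_base imm.ambient_deriv_def)
  \<comment> \<open>The Kenmotsu identity trades the derivative of \<phi> for \<phi> of the ambient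
    derivative and the two correction terms.\<close>
  moreover have "\<phi>' (T (v, 0)) (T u) + \<phi> ?b (imm.second_deriv (p, q) u (v, 0)) + ?\<Gamma> (T u) (\<phi> ?b (T (v, 0))) =
      \<phi> ?b (S u (v, 0)) + G (\<phi> ?b (T u)) (T (v, 0)) *\<^sub>R \<xi> ?b - \<eta> ?b (T (v, 0)) *\<^sub>R \<phi> ?b (T u)"
    using \<phi>'(2)[of "T (v, 0)" "T u"] by (simp add: imm.ambient_deriv_def linear_add[OF b.phi] algebra_simps)
  ultimately show ?thesis by simp
qed

text \<open>Obtained in the same way from \<open>g \<xi> Z = 0\<close>.\<close>

lemma xi_along: "G (T u) (T (0, w)) + G (\<xi> (F (p, q))) (S u (0, w)) = 0"
proof -
  let ?b = "F (p, q)"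
  let ?d = "chart_at M ?b" and ?D = "frechet_derivative (imm.loc_rep (p, q))"
  let ?\<Gamma> = "christoffel M g ?b"
  interpret b: almost_contact_form "g ?b" "\<phi> ?b" "\<xi> ?b" "\<eta> ?b" using contact_form[OF Fx] .
  note W = imm.open_loc_dom[OF x] imm.base_in_loc_dom[OF x]
  note d = imm.chart_M[OF x]
  obtain \<xi>' c where \<xi>': "(xi_rep ?b has_derivative \<xi>') (at (chart_map ?d ?b))"
    "\<And>u. \<xi>' u + ?\<Gamma> u (\<xi> ?b) = u + c u *\<^sub>R \<xi> ?b"
    using xi_rep_has_derivative[OF Fx] by blast
  have xi_base: "xi_rep ?b (chart_map ?d ?b) = \<xi> ?b"
    by (simp add: xi_rep_def chart_inv_map[OF M d] to_from_chart_at[OF M Fx])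
  have 1: "((\<lambda>y. xi_rep ?b (imm.loc_rep (p, q) y)) has_derivative (\<lambda>u. \<xi>' (T u))) (at (imm.base (p, q)))"
    by (rule has_derivative_compose[OF imm.loc_rep_has_derivative[OF x]])
      (simp add: imm.loc_rep_base[OF x] \<xi>'(1))
  note 2 = imm.metric_compatible_along[OF x 1 imm.second_deriv_has_derivative[OF x, of "(0, w)"]]
  have "chart_metric M g ?d (imm.loc_rep (p, q) y) (xi_rep ?b (imm.loc_rep (p, q) y)) (?D (at y) (0, w)) = 0"
    if "y \<in> imm.loc_dom (p, q)" for y
  proof (rule loc_dom_E[OF that])
    fix p' q'
    assume p': "p' \<in> carrier MT" and q': "q' \<in> carrier M\<theta>" and dom: "F (p', q') \<in> chart_dom ?d"
      and rep: "imm.loc_rep (p, q) y = chart_map ?d (F (p', q'))"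
      and w: "\<And>w. ?D (at y) (0, w) =
        to_chart M ?d (F (p', q')) (mdiff N M F (p', q') (0, from_chart M\<theta> (chart_at M\<theta> q) q' w))"
    obtain v' where "\<xi> (F (p', q')) = mdiff N M F (p', q') (v', 0)"
      using xi_mdiff_T[OF p' q'] by blast
    then show ?thesis
      unfolding rep w
      by (simp add: xi_rep_def chart_inv_map[OF M d(1) dom] metric_in_chart[OF M d(1) dom]
        metric[OF p' q'] zeros[OF p' q'])
  qed
  from fun_cong[OF has_derivative_unique[OF has_derivative_transform_within_open[OF 2 W this] has_derivative_const], of u]
  have "G (\<xi>' (T u) + ?\<Gamma> (T u) (\<xi> ?b)) (T (0, w)) + G (\<xi> ?b) (S u (0, w)) = 0"
    by (simp add: imm.mdiff_eq[symmetric] imm.loc_rep_base[OF x] xi_base imm.ambient_deriv_def)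
  \<comment> \<open>Removes the unknown multiple \<open>c u\<close> of \<xi>.\<close>
  moreover have "G (\<xi> ?b) (T (0, w)) = 0"
    using xi_mdiff_T[OF p q] by (auto simp: metric[OF p q] zeros[OF p q])
  ultimately show ?thesis
    by (simp add: \<xi>'(2) bilinear_ladd[OF b.bil] bilinear_lmul[OF b.bil])
qed

section \<open>Pointwise estimate and the equality case\<close>

lemma orthogonal_range_eq_0:
  assumes "\<And>w. G (T u) (T w) = 0"
  shows "T u = 0"
  using assms pos_def_formD(5)[OF riemannian_metric_pos_def[OF g Fx]] by blast

lemma orthogonal_leaves_eq_0:
  assumes "\<And>y. G (T u) (T (y, 0)) = 0" "\<And>z. G (T u) (T (0, z)) = 0"
  shows "T u = 0"
proof (rule orthogonal_range_eq_0)
  show "G (T u) (T w) = 0" for w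
    using assms(1)[of "fst w"] assms(2)[of "snd w"] by (simp add: metric[OF p q] zeros[OF p q])
qed

lemma gradient_eq: "gT p (gradient MT gT (\<lambda>x. ln (f x)) p) u = L u"
proof -
  obtain n where n: "\<And>u. gT p n u = L u"
    using form_representation[OF pos_def_gT[OF p q] L_linear[OF p q]] by blast
  have "gradient MT gT (\<lambda>x. ln (f x)) p = n"
    unfolding gradient_def
  proof (rule the_equality)
    fix w assume "\<forall>u. gT p w u = L u"
    then show "w = n" using n by (intro pos_def_form_eqI[OF pos_def_gT[OF p q]]) simp
  qed (use n in blast)
  then show ?thesis using n by simp
qed

text \<open>The passage from geometry to the algebra of one tangent space; \<open>gF\<close> is the
  metric induced on the slant leaf, with the factor f^2 included.\<close>

lemma semi_slant_point:
  obtains \<xi>0 where "semi_slant_point G (\<phi> (F (p, q))) (\<xi> (F (p, q))) (\<eta> (F (p, q))) T (gT p) (\<lambda>u v. gF u v) L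
    (gradient MT gT (\<lambda>x. ln (f x)) p) \<xi>0 (sff N M g F (p, q)) \<theta>"
proof -
  let ?b = "F (p, q)"
  interpret b: almost_contact_form G "\<phi> ?b" "\<xi> ?b" "\<eta> ?b" using contact_form[OF Fx] .
  note lin = imm.mdiff_lin[OF x] and pos = pos_def_g\<theta>[OF p q]
  obtain \<xi>0 where \<xi>0: "\<xi> ?b = T (\<xi>0, 0)" using xi_mdiff_T[OF p q] by blast
  have h_sym: "sff N M g F (p, q) u v = sff N M g F (p, q) v u" for u v
  proof -
    have "G (T (christoffel N (pullback_metric N M F g) (p, q) u v) -
        T (christoffel N (pullback_metric N M F g) (p, q) v u)) (T w) = 0" for w
      by (simp add: bilinear_lsub[OF b.bil] imm.pullback_christoffel(2)[OF x] imm.ambient_deriv_sym[OF x, of u v])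
    then show ?thesis
      using orthogonal_range_eq_0[of "christoffel N (pullback_metric N M F g) (p, q) u v -
          christoffel N (pullback_metric N M F g) (p, q) v u"]
      by (simp add: imm.sff_eq[OF x] imm.ambient_deriv_sym[OF x, of u v] linear_diff[OF lin])
  qed
  \<comment> \<open>The tangential part of \<nabla>_Z X is X(ln f) Z, identified by its products
    with all tangent vectors.\<close>
  have S_mixed: "S (0, z) (y, 0) = sff N M g F (p, q) (0, z) (y, 0) + T (0, L y *\<^sub>R z)" for z y
  proof -
    have "G (T (christoffel N (pullback_metric N M F g) (p, q) (0, z) (y, 0)) - T (0, L y *\<^sub>R z)) (T w) = 0" for w
      unfolding bilinear_lsub[OF b.bil] imm.pullback_christoffel(2)[OF x] ambient_mixed
      by (simp add: metric[OF p q] zeros[OF p q] bilinear_lmul[OF pos_def_formD(1)[OF pos]])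
    then have "T (christoffel N (pullback_metric N M F g) (p, q) (0, z) (y, 0)) = T (0, L y *\<^sub>R z)"
      using orthogonal_range_eq_0[of "christoffel N (pullback_metric N M F g) (p, q) (0, z) (y, 0) - (0, L y *\<^sub>R z)"]
      by (simp add: linear_diff[OF lin])
    then show ?thesis by (simp add: imm.sff_eq[OF x])
  qed
  have "semi_slant_point G (\<phi> ?b) (\<xi> ?b) (\<eta> ?b) T (gT p) (\<lambda>u v. gF u v) L
    (gradient MT gT (\<lambda>x. ln (f x)) p) \<xi>0 (sff N M g F (p, q)) \<theta>"
  proof (intro semi_slant_point.intro semi_slant_point_axioms.intro)
    show "almost_contact_form G (\<phi> ?b) (\<xi> ?b) (\<eta> ?b)" by unfold_locales
    show "linear T" "pos_def_form (gT p)" "pos_def_form (\<lambda>u v. gF u v)"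
      using lin pos_def_gT[OF p q] pos_def_gF[OF p q] .
    show "G (T u) (T v) = gT p (fst u) (fst v) + gF (snd u) (snd v)" for u v
      using metric[OF p q] by simp
    show "bilinear (sff N M g F (p, q))" using imm.sff_bilinear[OF x] .
    show "sff N M g F (p, q) u v = sff N M g F (p, q) v u" for u v by (rule h_sym)
    show "G (sff N M g F (p, q) u v) (T y) = 0" for u v y by (rule imm.sff_normal[OF x])
    show "\<exists>x'. \<phi> ?b (T (y, 0)) = T (x', 0)" for y by (rule phi_mdiff_T[OF p q])
    show "\<xi> ?b = T (\<xi>0, 0)" by (rule \<xi>0)
    show "\<theta> \<noteq> 0" using slant_\<theta>[OF p] by (simp add: proper_slant_submanifold_def)
    show "L y = gT p (gradient MT gT (\<lambda>x. ln (f x)) p) y" for y by (rule gradient_eq[symmetric])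
    show "angle_to_subspace G (\<phi> ?b (T (0, z))) (range (\<lambda>z. T (0, z))) = \<theta>" if z: "z \<noteq> 0" for z
    proof -
      have T0: "T (0, z) \<noteq> 0"
        using imm.inj[OF x] z linear_injective_0[OF lin] by (metis Pair_inject zero_prod_def)
      \<comment> \<open>The slant condition speaks of vectors off the line of \<xi>; a vector of the
        slant leaf is orthogonal to \<xi>, so it lies on that line only if it is 0.\<close>
      moreover have "T (0, z) \<notin> span {\<xi> ?b}"
      proof
        assume "T (0, z) \<in> span {\<xi> ?b}"
        then obtain k where "T (0, z) = k *\<^sub>R \<xi> ?b" by (auto simp: span_singleton)
        then have "G (T (0, z)) (T (0, z)) = k * G (T (\<xi>0, 0)) (T (0, z))"
          by (metis \<xi>0 b.bil bilinear_lmul real_scaleR_def)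
        then have "G (T (0, z)) (T (0, z)) = 0" by (simp add: metric[OF p q] zeros[OF p q])
        then show False using T0 pos_def_formD(5)[OF b.G] by blast
      qed
      moreover have "range (mdiff M\<theta> M (\<lambda>q. F (p, q)) q) = range (\<lambda>z. T (0, z))"
        using mdiff_\<theta>[OF p q] by simp
      ultimately show ?thesis
        using slant_\<theta>[OF p] q unfolding proper_slant_submanifold_def slant_submanifold_def
        by (metis rangeI)
    qed
    \<comment> \<open>For Z \<noteq> 0, \<open>xi_along\<close> gives |Z|^2 + g(\<xi>, \<nabla>_Z Z)
      = 0, while the warping gives g(\<xi>, \<nabla>_Z Z) = - \<xi>(ln f) |Z|^2.\<close>
    show "L \<xi>0 = 1"
    proof -
      obtain z :: 'f where z: "z \<noteq> 0" using nonempty_Basis nonzero_Basis by blast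
      have "gF z z + G (\<xi> ?b) (S (0, z) (0, z)) = 0"
        using xi_along[of "(0, z)" z] by (simp add: metric[OF p q] zeros[OF p q])
      moreover have "G (\<xi> ?b) (S (0, z) (0, z)) = - L \<xi>0 * gF z z"
        using ambient_\<theta>[of z z \<xi>0] b.sym[of "\<xi> ?b"] by (simp add: \<xi>0)
      moreover have "gF z z > 0" using pos_def_formD(3)[OF pos_def_gF[OF p q] z] .
      ultimately show ?thesis by (auto simp: algebra_simps)
    qed
    show "G (sff N M g F (p, q) (0, z) (y, 0)) (\<phi> ?b (T (0, w))) =
        (L y - \<eta> ?b (T (y, 0))) * G (\<phi> ?b (T (0, z))) (T (0, w)) - L x' * gF z w"
      if x': "\<phi> ?b (T (y, 0)) = T (x', 0)" for y x' z w
    proof -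
      \<comment> \<open>By skewness and invariance \<phi>Z is orthogonal to the leaf of
        \<open>MT\<close>, which removes the \<xi>-term from \<open>phi_along\<close>.\<close>
      have 1: "G (\<phi> ?b (T (0, z))) (T (y, 0)) = 0"
        unfolding b.phi_skew x' by (simp add: metric[OF p q] zeros[OF p q])
      have 2: "G (T (x', 0)) (S (0, z) (0, w)) = - L x' * gF z w"
        using ambient_\<theta>[of z w x'] b.sym[of "T (x', 0)"] by simp
      have T_scale: "T (0, L y *\<^sub>R z) = L y *\<^sub>R T (0, z)"
        using linear_scale[OF lin, of "L y" "(0, z)"] by simp
      have 3: "G (\<phi> ?b (S (0, z) (y, 0))) (T (0, w)) =
          - G (sff N M g F (p, q) (0, z) (y, 0)) (\<phi> ?b (T (0, w))) + L y * G (\<phi> ?b (T (0, z))) (T (0, w))"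
        by (simp add: S_mixed T_scale linear_add[OF b.phi] linear_scale[OF b.phi] bilinear_ladd[OF b.bil]
          bilinear_lmul[OF b.bil] b.phi_skew[of "sff N M g F (p, q) (0, z) (y, 0)"])
      from phi_along[of "(0, z)" y w] show ?thesis
        by (simp add: x' 1 2 3 bilinear_ladd[OF b.bil] bilinear_lsub[OF b.bil] bilinear_lmul[OF b.bil] algebra_simps)
    qed
  qed
  then show ?thesis by (rule that)
qed

lemma some_frame_orthonormal: "orthonormal_basis (\<lambda>u v. G (T u) (T v)) (some_frame N M g F (p, q))"
  using someI_ex[OF orthonormal_basis_exists[OF imm.pullback_pos_def[OF x]]]
  by (simp add: some_frame_def pullback_metric_def[abs_def])

lemma
  defines "c \<equiv> 2 * real DIM('f) * ((1 / sin \<theta>)\<^sup>2 + (cot \<theta>)\<^sup>2) *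
      ((gnorm (gT p) (gradient MT gT (\<lambda>x. ln (f x)) p))\<^sup>2 - 1)"
  shows sff_sqnorm_ge: "sff_sqnorm N M g F (p, q) \<ge> c"
    and sff_T: "sff_sqnorm N M g F (p, q) = c \<Longrightarrow> sff N M g F (p, q) (u, 0) (v, 0) = 0"
    and sff_\<theta>: "sff_sqnorm N M g F (p, q) = c \<Longrightarrow> sff N M g F (p, q) (0, z) (0, w) = 0"
proof -
  obtain \<xi>0 where "semi_slant_point G (\<phi> (F (p, q))) (\<xi> (F (p, q))) (\<eta> (F (p, q))) T (gT p) (\<lambda>u v. gF u v) L
    (gradient MT gT (\<lambda>x. ln (f x)) p) \<xi>0 (sff N M g F (p, q)) \<theta>"
    by (rule semi_slant_point)
  from semi_slant_point.sqnorm_ge[OF this some_frame_orthonormal]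
  have *: "(\<Sum>u\<in>some_frame N M g F (p, q). \<Sum>v\<in>some_frame N M g F (p, q).
      G (sff N M g F (p, q) u v) (sff N M g F (p, q) u v)) = sff_sqnorm N M g F (p, q)"
    by (simp add: sff_sqnorm_def)
  have n: "(gnorm (gT p) v)\<^sup>2 = gT p v v" for v
    using pos_def_formD(4)[OF pos_def_gT[OF p q]] by (simp add: gnorm_def)
  note ** = semi_slant_point.sqnorm_ge[OF \<open>semi_slant_point _ _ _ _ _ _ _ _ _ _ _ _\<close> some_frame_orthonormal,
      unfolded *, folded n, folded c_def]
  show "sff_sqnorm N M g F (p, q) \<ge> c" by (rule **(1))
  show "sff_sqnorm N M g F (p, q) = c \<Longrightarrow> sff N M g F (p, q) (u, 0) (v, 0) = 0" by (rule **(2))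
  show "sff_sqnorm N M g F (p, q) = c \<Longrightarrow> sff N M g F (p, q) (0, z) (0, w) = 0" by (rule **(3))
qed

text \<open>If \<open>h\<close> vanishes here, the second fundamental form of the leaf is tangent to
  the submanifold. It is normal to the leaf itself and, by \<open>ambient_T\<close>, orthogonal to
  the other factor, so nothing is left.\<close>

lemma sff_leaf_T:
  assumes "\<And>u v. sff N M g F (p, q) (u, 0) (v, 0) = 0"
  shows "sff MT M g (\<lambda>p. F (p, q)) p u v = 0"
proof -
  interpret b: almost_contact_form G "\<phi> (F (p, q))" "\<xi> (F (p, q))" "\<eta> (F (p, q))" using contact_form[OF Fx] .
  note leaf = chartwise_affine.ambient_deriv_compose[OF slice_T[OF q] imm.riemannian_immersion_axioms p]
  interpret leaf: riemannian_immersion MT M g "\<lambda>p. F (p, q)" by (rule leaf(1))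
  define k where "k = christoffel N (pullback_metric N M F g) (p, q) (u, 0) (v, 0) -
      (christoffel MT (pullback_metric MT M (\<lambda>p. F (p, q)) g) p u v, 0)"
  have S: "S (u, 0) (v, 0) = T (christoffel N (pullback_metric N M F g) (p, q) (u, 0) (v, 0))"
    using assms[of u v] by (simp add: imm.sff_eq[OF x])
  have k: "sff MT M g (\<lambda>p. F (p, q)) p u v = T k"
    by (simp add: leaf.sff_eq[OF p] leaf(2) S mdiff_T[OF p q] k_def linear_diff[OF imm.mdiff_lin[OF x]])
  have "G (T k) (T (y, 0)) = 0" for y
    using leaf.sff_normal[OF p, of u v y] by (simp add: k mdiff_T[OF p q])
  moreover have "G (T k) (T (0, z)) = 0" for z
    unfolding k[symmetric] leaf.sff_eq[OF p] leaf(2)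
    by (simp add: bilinear_lsub[OF b.bil] mdiff_T[OF p q] ambient_T metric[OF p q] zeros[OF p q])
  ultimately show ?thesis unfolding k by (rule orthogonal_leaves_eq_0)
qed

text \<open>Again only the part tangent to the submanifold is left, and it is normal to the leaf.
  Its products with the directions of \<open>MT\<close> are given by
  \<open>ambient_\<theta>\<close>, which makes it a multiple of the gradient of ln f.\<close>

lemma sff_leaf_\<theta>:
  assumes "\<And>u v. sff N M g F (p, q) (0, u) (0, v) = 0"
  shows "sff M\<theta> M g (\<lambda>q. F (p, q)) q u v =
    - (pullback_metric M\<theta> M (\<lambda>q. F (p, q)) g q u v *\<^sub>R T (gradient MT gT (\<lambda>x. ln (f x)) p, 0))"
proof -
  interpret b: almost_contact_form G "\<phi> (F (p, q))" "\<xi> (F (p, q))" "\<eta> (F (p, q))" using contact_form[OF Fx] .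
  note leaf = chartwise_affine.ambient_deriv_compose[OF slice_\<theta>[OF p] imm.riemannian_immersion_axioms q]
  interpret leaf: riemannian_immersion M\<theta> M g "\<lambda>q. F (p, q)" by (rule leaf(1))
  note lin = imm.mdiff_lin[OF x]
  define n where "n = gradient MT gT (\<lambda>x. ln (f x)) p"
  have pull: "pullback_metric M\<theta> M (\<lambda>q. F (p, q)) g q u v = gF u v"
    by (simp add: pullback_metric_def mdiff_\<theta>[OF p q] metric[OF p q] zeros[OF p q])
  define k where "k = christoffel N (pullback_metric N M F g) (p, q) (0, u) (0, v) -
      (0, christoffel M\<theta> (pullback_metric M\<theta> M (\<lambda>q. F (p, q)) g) q u v)"
  have S: "S (0, u) (0, v) = T (christoffel N (pullback_metric N M F g) (p, q) (0, u) (0, v))"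
    using assms[of u v] by (simp add: imm.sff_eq[OF x])
  have k: "sff M\<theta> M g (\<lambda>q. F (p, q)) q u v = T k"
    by (simp add: leaf.sff_eq[OF q] leaf(2) S mdiff_\<theta>[OF p q] k_def linear_diff[OF lin])
  have nT: "T (gF u v *\<^sub>R (n, 0)) = gF u v *\<^sub>R T (n, 0)" by (rule linear_scale[OF lin])
  have theta: "G (T k) (T (0, z)) = 0" for z
    using leaf.sff_normal[OF q, of u v z] by (simp add: k mdiff_\<theta>[OF p q])
  have "G (T k) (T (y, 0)) = - L y * gF u v" for y
    unfolding k[symmetric] leaf.sff_eq[OF q] leaf(2)
    by (simp add: bilinear_lsub[OF b.bil] mdiff_\<theta>[OF p q] ambient_\<theta> metric[OF p q] zeros[OF p q])
  then have "G (T (k + gF u v *\<^sub>R (n, 0))) (T (y, 0)) = 0" for y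
    by (simp only: linear_add[OF lin] nT bilinear_ladd[OF b.bil] bilinear_lmul[OF b.bil])
      (simp add: metric[OF p q] zeros[OF p q] n_def gradient_eq)
  moreover have "G (T (k + gF u v *\<^sub>R (n, 0))) (T (0, z)) = 0" for z
    by (simp only: linear_add[OF lin] nT bilinear_ladd[OF b.bil] bilinear_lmul[OF b.bil] theta)
      (simp add: metric[OF p q] zeros[OF p q])
  ultimately have "T (k + gF u v *\<^sub>R (n, 0)) = 0" by (rule orthogonal_leaves_eq_0)
  then show ?thesis
    unfolding k pull n_def[symmetric] linear_add[OF lin] nT by (simp add: eq_neg_iff_add_eq_0)
qed

text \<open>Each unit vector of a frame contributes the same vector, minus the gradient of ln f, so
  this vector is the mean curvature.\<close>

lemma sff_leaf_umbilical:
  assumes "\<And>u v. sff N M g F (p, q) (0, u) (0, v) = 0"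
  shows "sff M\<theta> M g (\<lambda>q. F (p, q)) q u v =
    pullback_metric M\<theta> M (\<lambda>q. F (p, q)) g q u v *\<^sub>R mean_curvature M\<theta> M g (\<lambda>q. F (p, q)) q"
proof -
  interpret leaf: riemannian_immersion M\<theta> M g "\<lambda>q. F (p, q)"
    by (rule chartwise_affine.ambient_deriv_compose(1)[OF slice_\<theta>[OF p] imm.riemannian_immersion_axioms q])
  let ?B = "some_frame M\<theta> M g (\<lambda>q. F (p, q)) q"
  note pos = leaf.pullback_pos_def[OF q]
  have B: "orthonormal_basis (pullback_metric M\<theta> M (\<lambda>q. F (p, q)) g q) ?B"
    using someI_ex[OF orthonormal_basis_exists[OF pos]] by (simp add: some_frame_def)
  let ?n = "T (gradient MT gT (\<lambda>x. ln (f x)) p, 0)"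
  have "(\<Sum>u\<in>?B. sff M\<theta> M g (\<lambda>q. F (p, q)) q u u) = (\<Sum>u\<in>?B. - ?n)"
    using B by (intro sum.cong refl) (auto simp: sff_leaf_\<theta>[OF assms] orthonormal_basis_def)
  also have "\<dots> = real DIM('f) *\<^sub>R (- ?n)"
    by (simp only: sum_constant_scaleR orthonormal_basis_card[OF pos B])
  finally have "mean_curvature M\<theta> M g (\<lambda>q. F (p, q)) q = - ?n"
    by (simp add: mean_curvature_def)
  then show ?thesis by (simp add: sff_leaf_\<theta>[OF assms])
qed

text \<open>In a frame adapted to the two factors the trace meets pairs from one factor only; the
  mixed values of \<open>h\<close>, which may be nonzero, do not occur.\<close>

lemma mean_curvature_eq_0:
  assumes "\<And>u v. sff N M g F (p, q) (u, 0) (v, 0) = 0" "\<And>u v. sff N M g F (p, q) (0, u) (0, v) = 0"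
  shows "mean_curvature N M g F (p, q) = 0"
proof -
  obtain B1 where B1: "orthonormal_basis (gT p) B1"
    using orthonormal_basis_exists[OF pos_def_gT[OF p q]] by blast
  obtain B2 where B2: "orthonormal_basis (\<lambda>u v. gF u v) B2"
    using orthonormal_basis_exists[OF pos_def_gF[OF p q]] by blast
  note prod = orthonormal_basis_prod(1)[OF pos_def_gT[OF p q] pos_def_gF[OF p q] metric[OF p q] B1 B2]
  have pos: "pos_def_form (\<lambda>u v. G (T u) (T v))"
    using imm.pullback_pos_def[OF x] by (simp add: pullback_metric_def[abs_def])
  have "(\<Sum>u\<in>some_frame N M g F (p, q). sff N M g F (p, q) u u) =
      (\<Sum>u\<in>(\<lambda>x. (x, 0)) ` B1 \<union> Pair 0 ` B2. sff N M g F (p, q) u u)"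
    by (rule trace_orthonormal_invariant[OF pos some_frame_orthonormal prod imm.sff_bilinear[OF x]])
  also have "\<dots> = 0" using assms by (intro sum.neutral) auto
  finally show ?thesis by (simp add: mean_curvature_def)
qed

end

end

theorem theorem3:
  fixes M :: "('m, 'k::euclidean_space) mfd"
    and \<phi> :: "'m \<Rightarrow> 'k \<Rightarrow> 'k" and \<xi> :: "'m \<Rightarrow> 'k" and \<eta> :: "'m \<Rightarrow> 'k \<Rightarrow> real"
    and g :: "('m, 'k) metric"
    and MT :: "('a, 'e::euclidean_space) mfd" and gT :: "('a, 'e) metric"
    and f :: "'a \<Rightarrow> real"
    and M\<theta> :: "('b, 'f::euclidean_space) mfd" and g\<theta> :: "('b, 'f) metric"
    and F :: "'a \<times> 'b \<Rightarrow> 'm" and \<theta> s :: real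
  assumes "kenmotsu_manifold M \<phi> \<xi> \<eta> g"
    and "warped_product_semi_slant M \<phi> \<xi> g MT gT f M\<theta> g\<theta> F \<theta>"
    and "2 * s = real DIM('f)"
  shows "(\<forall>p\<in>carrier MT. \<forall>q\<in>carrier M\<theta>.
            sff_sqnorm (prod_mfd MT M\<theta>) M g F (p, q)
              \<ge> 4 * s * ((1 / sin \<theta>)\<^sup>2 + (cot \<theta>)\<^sup>2) *
                ((gnorm (gT p) (gradient MT gT (\<lambda>x. ln (f x)) p))\<^sup>2 - 1)) \<and>
         ((\<forall>p\<in>carrier MT. \<forall>q\<in>carrier M\<theta>.
            sff_sqnorm (prod_mfd MT M\<theta>) M g F (p, q)
              = 4 * s * ((1 / sin \<theta>)\<^sup>2 + (cot \<theta>)\<^sup>2) *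
                ((gnorm (gT p) (gradient MT gT (\<lambda>x. ln (f x)) p))\<^sup>2 - 1))
          \<longrightarrow> (\<forall>q\<in>carrier M\<theta>. totally_geodesic MT M g (\<lambda>p. F (p, q))) \<and>
              (\<forall>p\<in>carrier MT. totally_umbilical M\<theta> M g (\<lambda>q. F (p, q))) \<and>
              minimal (prod_mfd MT M\<theta>) M g F)"
proof -
  interpret kenmotsu_semi_slant M \<phi> \<xi> \<eta> g MT gT f M\<theta> g\<theta> F \<theta>
    using assms(1,2) by unfold_locales
  have s: "4 * s = 2 * real DIM('f)" using assms(3) by simp
  show ?thesis
    unfolding s
  proof (intro conjI impI ballI)
    fix p q assume "p \<in> carrier MT" "q \<in> carrier M\<theta>"
    then show "sff_sqnorm N M g F (p, q) \<ge> 2 * real DIM('f) * ((1 / sin \<theta>)\<^sup>2 + (cot \<theta>)\<^sup>2) *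
        ((gnorm (gT p) (gradient MT gT (\<lambda>x. ln (f x)) p))\<^sup>2 - 1)"
      by (rule sff_sqnorm_ge)
  next
    assume eq: "\<forall>p\<in>carrier MT. \<forall>q\<in>carrier M\<theta>. sff_sqnorm N M g F (p, q) =
        2 * real DIM('f) * ((1 / sin \<theta>)\<^sup>2 + (cot \<theta>)\<^sup>2) *
        ((gnorm (gT p) (gradient MT gT (\<lambda>x. ln (f x)) p))\<^sup>2 - 1)"
    have hT: "sff N M g F (p, q) (u, 0) (v, 0) = 0" and h\<theta>: "sff N M g F (p, q) (0, z) (0, w) = 0"
      if "p \<in> carrier MT" "q \<in> carrier M\<theta>" for p q u v z w
      using sff_T[OF that bspec[OF bspec[OF eq that(1)] that(2)]]
        sff_\<theta>[OF that bspec[OF bspec[OF eq that(1)] that(2)]] .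
    show "totally_geodesic MT M g (\<lambda>p. F (p, q))" if "q \<in> carrier M\<theta>" for q
      using sff_leaf_T[OF _ that hT] that by (simp add: totally_geodesic_def)
    show "totally_umbilical M\<theta> M g (\<lambda>q. F (p, q))" if "p \<in> carrier MT" for p
      using sff_leaf_umbilical[OF that _ h\<theta>] that by (simp add: totally_umbilical_def)
    show "minimal N M g F"
      using mean_curvature_eq_0 hT h\<theta> by (auto simp: minimal_def prod_mfd_simps)
  qed
qed

end
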